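(* Let $(X,\varphi)$ be a Cantor minimal system. Then the kernel of the signature map $\operatorname{sgn}:[[\varphi]]_0\to K^0(X,\varphi)/2K^0(X,\varphi)$ equals the commutator subgroup $D([[\varphi]]_0)$. Thus $\operatorname{sgn}$ induces an isomorphism between $[[\varphi]]_0/D([[\varphi]]_0)$ and $K^0(X,\varphi)/2K^0(X,\varphi)$.
   Context: A Cantor minimal system $(X,\varphi)$ is a Cantor set $X$ (compact, metrizable, perfect, totally disconnected, nonempty) with a homeomorphism $\varphi$ of $X$ that is minimal: the only closed $\varphi$-invariant subsets are $\emptyset$ and $X$. The topological full group $[[\varphi]]$ is the group of all homeomorphisms $\gamma$ of $X$ for which there is a continuous map $n_\gamma:X\to\mathbb{Z}$ with $\gamma(x)=\varphi^{n_\gamma(x)}(x)$ for all $x\in X$. The index map $I:[[\varphi]]\to\mathbb{Z}$ is $I(\gamma)=\int n_\gamma\,d\mu$, where $\mu$ is a $\varphi$-invariant probability measure; it is known that $I(\gamma)$ is an integer independent of $\mu$ and that $I$ is a surjective homomorphism. $[[\varphi]]_0$ is the kernel of $I$. For a group $H$, $D(H)$ is its commutator subgroup. $K^0(X,\varphi)=C(X,\mathbb{Z})/\{f-f\circ\varphi^{-1}:f\in C(X,\mathbb{Z})\}$, and $[f]$ is the class of $f$. For $x\in X$, $[[\varphi]]_x$ is the subgroup of all $\gamma\in[[\varphi]]$ that preserve both the forward orbit $\{\varphi^n(x):n\ge 1\}$ and the backward orbit $\{\varphi^{1-n}(x):n\ge1\}$ (each is mapped onto itself). Every element of $[[\varphi]]_x$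 has finite order, and $[[\varphi]]_x\subset[[\varphi]]_0$. Signature map. For $\gamma\in[[\varphi]]_x$, let $f(z)$ be the least positive integer with $\gamma^{f(z)}(z)=z$ (a continuous function of $z\in X$); for each $n$ choose a clopen set $V_n\subset f^{-1}(n)$ such that $f^{-1}(n)$ is the disjoint union of $V_n,\gamma(V_n),\dots,\gamma^{n-1}(V_n)$. Put $\operatorname{sgn}(\gamma)=\sum_{n\text{ even}}[1_{V_n}]+2K^0(X,\varphi)$; this does not depend on the choice of the $V_n$ and is a homomorphism on $[[\varphi]]_x$. For $\gamma\in[[\varphi]]_0$, choose $x,y\in X$ in distinct $\varphi$-orbits and $\gamma_1\in[[\varphi]]_x$, $\gamma_2\in[[\varphi]]_y$ with $\gamma=\gamma_1\gamma_2$ (always possible), and put $\operatorname{sgn}(\gamma)=\operatorname{sgn}(\gamma_1)+\operatorname{sgn}(\gamma_2)$; this is independent of all choices, and $\operatorname{sgn}$ is a group homomorphism on $[[\varphi]]_0$. *)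

theory Defs
  imports "HOL-Probability.Probability" "HOL-Algebra.Generated_Groups" "HOL-Algebra.FiniteProduct"
begin

text \<open>The Cantor set is the whole of a type \<open>'a\<close>, with the topology of its class
  \<open>topological_space\<close>; nonemptiness is automatic for types. Inverse maps are written
  \<open>inv_into UNIV\<close> because the notation \<open>inv\<close> is taken by HOL-Algebra.\<close>

definition cantor_space :: "'a::topological_space itself \<Rightarrow> bool" where
  "cantor_space _ \<longleftrightarrow>
     compact (UNIV :: 'a set) \<and>
     metrizable_space (euclidean :: 'a topology) \<and>
     (\<forall>x::'a. x islimpt UNIV) \<and>
     (\<forall>S::'a set. connected S \<longrightarrow> (\<exists>a. S \<subseteq> {a}))"

definition self_homeomorphism :: "('a::topological_space \<Rightarrow> 'a) \<Rightarrow> bool" where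
  "self_homeomorphism \<gamma> \<longleftrightarrow> homeomorphism UNIV UNIV \<gamma> (inv_into UNIV \<gamma>)"

definition cantor_minimal_system :: "('a::topological_space \<Rightarrow> 'a) \<Rightarrow> bool" where
  "cantor_minimal_system \<phi> \<longleftrightarrow>
     cantor_space TYPE('a) \<and>
     self_homeomorphism \<phi> \<and>
     (\<forall>C. closed C \<and> \<phi> ` C = C \<longrightarrow> C = {} \<or> C = UNIV)"

definition int_iter :: "('a \<Rightarrow> 'a) \<Rightarrow> int \<Rightarrow> 'a \<Rightarrow> 'a" where
  "int_iter \<phi> k = (if 0 \<le> k then \<phi> ^^ nat k else inv_into UNIV \<phi> ^^ nat (- k))"

definition int_orbit :: "('a \<Rightarrow> 'a) \<Rightarrow> 'a \<Rightarrow> 'a set" where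
  "int_orbit \<phi> x = range (\<lambda>k. int_iter \<phi> k x)"


section \<open>The topological full group and the index map\<close>

definition is_cocycle ::
  "('a::topological_space \<Rightarrow> 'a) \<Rightarrow> ('a \<Rightarrow> 'a) \<Rightarrow> ('a \<Rightarrow> int) \<Rightarrow> bool" where
  "is_cocycle \<phi> \<gamma> n \<longleftrightarrow> continuous_on UNIV n \<and> (\<forall>x. \<gamma> x = int_iter \<phi> (n x) x)"

definition full_group :: "('a::topological_space \<Rightarrow> 'a) \<Rightarrow> ('a \<Rightarrow> 'a) set" where
  "full_group \<phi> = {\<gamma>. self_homeomorphism \<gamma> \<and> (\<exists>n. is_cocycle \<phi> \<gamma> n)}"

text \<open>The cocycle of an element of the full group is unique, as a minimal homeomorphism of an
  infinite space has no periodic points.\<close>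

definition cocycle :: "('a::topological_space \<Rightarrow> 'a) \<Rightarrow> ('a \<Rightarrow> 'a) \<Rightarrow> 'a \<Rightarrow> int" where
  "cocycle \<phi> \<gamma> = (SOME n. is_cocycle \<phi> \<gamma> n)"

definition invariant_prob :: "('a::topological_space \<Rightarrow> 'a) \<Rightarrow> 'a measure \<Rightarrow> bool" where
  "invariant_prob \<phi> \<mu> \<longleftrightarrow> prob_space \<mu> \<and> sets \<mu> = sets borel \<and> distr \<mu> borel \<phi> = \<mu>"

text \<open>For a Cantor minimal system an invariant probability measure exists, and the index is an
  integer that does not depend on which one is chosen.\<close>

definition index_map :: "('a::topological_space \<Rightarrow> 'a) \<Rightarrow> ('a \<Rightarrow> 'a) \<Rightarrow> real" where
  "index_map \<phi> \<gamma> =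
     (LINT x|(SOME \<mu>. invariant_prob \<phi> \<mu>). real_of_int (cocycle \<phi> \<gamma> x))"

definition full_group0 :: "('a::topological_space \<Rightarrow> 'a) \<Rightarrow> ('a \<Rightarrow> 'a) monoid" where
  "full_group0 \<phi> =
     \<lparr>carrier = {\<gamma> \<in> full_group \<phi>. index_map \<phi> \<gamma> = 0}, mult = (\<circ>), one = id\<rparr>"

definition full_group_at :: "('a::topological_space \<Rightarrow> 'a) \<Rightarrow> 'a \<Rightarrow> ('a \<Rightarrow> 'a) set" where
  "full_group_at \<phi> x =
     (let fwd = {int_iter \<phi> (int n) x | n::nat. 1 \<le> n};
          bwd = {int_iter \<phi> (1 - int n) x | n::nat. 1 \<le> n}
      in {\<gamma> \<in> full_group \<phi>. \<gamma> ` fwd = fwd \<and> \<gamma> ` bwd = bwd})"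


section \<open>The group \<open>K\<^sup>0\<close> modulo 2\<close>

text \<open>These abelian groups are additive, but are presented as multiplicative HOL-Algebra groups
  so that the quotient \<open>Mod\<close> applies. In particular \<open>c \<otimes> c\<close> below is \<open>2 c\<close>.\<close>

definition CXZ :: "('a::topological_space \<Rightarrow> int) monoid" where
  "CXZ = \<lparr>carrier = {f. continuous_on UNIV f}, mult = (\<lambda>f g x. f x + g x), one = (\<lambda>x. 0)\<rparr>"

definition coboundaries :: "('a::topological_space \<Rightarrow> 'a) \<Rightarrow> ('a \<Rightarrow> int) set" where
  "coboundaries \<phi> = {\<lambda>x. f x - f (inv_into UNIV \<phi> x) | f. f \<in> carrier CXZ}"

definition K0 :: "('a::topological_space \<Rightarrow> 'a) \<Rightarrow> ('a \<Rightarrow> int) set monoid" where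
  "K0 \<phi> = CXZ Mod coboundaries \<phi>"

definition K0_class :: "('a::topological_space \<Rightarrow> 'a) \<Rightarrow> ('a \<Rightarrow> int) \<Rightarrow> ('a \<Rightarrow> int) set" where
  "K0_class \<phi> f = coboundaries \<phi> #>\<^bsub>CXZ\<^esub> f"

definition twoK0 :: "('a::topological_space \<Rightarrow> 'a) \<Rightarrow> ('a \<Rightarrow> int) set set" where
  "twoK0 \<phi> = {c \<otimes>\<^bsub>K0 \<phi>\<^esub> c | c. c \<in> carrier (K0 \<phi>)}"

definition K0_mod2 :: "('a::topological_space \<Rightarrow> 'a) \<Rightarrow> ('a \<Rightarrow> int) set set monoid" where
  "K0_mod2 \<phi> = K0 \<phi> Mod twoK0 \<phi>"


section \<open>The signature map\<close>

definition return_time :: "('a \<Rightarrow> 'a) \<Rightarrow> 'a \<Rightarrow> nat" where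
  "return_time \<gamma> z = (LEAST n. 0 < n \<and> (\<gamma> ^^ n) z = z)"

definition tower_bases :: "('a::topological_space \<Rightarrow> 'a) \<Rightarrow> (nat \<Rightarrow> 'a set) \<Rightarrow> bool" where
  "tower_bases \<gamma> V \<longleftrightarrow>
     (\<forall>n. open (V n) \<and> closed (V n) \<and> V n \<subseteq> return_time \<gamma> -` {n} \<and>
          return_time \<gamma> -` {n} = (\<Union>i<n. (\<gamma> ^^ i) ` V n) \<and>
          disjoint_family_on (\<lambda>i. (\<gamma> ^^ i) ` V n) {..<n})"

text \<open>The restriction to nonempty \<open>V n\<close> only makes the index set of the sum finite (\<open>finprod\<close> over
  an infinite set is trivial): return times are bounded, by compactness.\<close>

definition sgn_at :: "('a::topological_space \<Rightarrow> 'a) \<Rightarrow> ('a \<Rightarrow> 'a) \<Rightarrow> ('a \<Rightarrow> int) set set" where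
  "sgn_at \<phi> \<gamma> =
     (let V = (SOME V. tower_bases \<gamma> V)
      in twoK0 \<phi> #>\<^bsub>K0 \<phi>\<^esub>
           finprod (K0 \<phi>) (\<lambda>n. K0_class \<phi> (indicator (V n))) {n. even n \<and> V n \<noteq> {}})"

text \<open>\<open>sgn_at\<close> is the signature on each group \<open>full_group_at \<phi> x\<close>; its formula does not involve
  the point \<open>x\<close>. As for \<open>V\<close> above, the value below does not depend on the choice.\<close>

definition sgn_decomposition ::
  "('a::topological_space \<Rightarrow> 'a) \<Rightarrow> ('a \<Rightarrow> 'a) \<Rightarrow> ('a \<Rightarrow> 'a) \<times> ('a \<Rightarrow> 'a) \<Rightarrow> bool" where
  "sgn_decomposition \<phi> \<gamma> = (\<lambda>(\<gamma>1, \<gamma>2).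
     \<exists>x y. int_orbit \<phi> x \<noteq> int_orbit \<phi> y \<and>
           \<gamma>1 \<in> full_group_at \<phi> x \<and> \<gamma>2 \<in> full_group_at \<phi> y \<and> \<gamma> = \<gamma>1 \<circ> \<gamma>2)"

definition signature :: "('a::topological_space \<Rightarrow> 'a) \<Rightarrow> ('a \<Rightarrow> 'a) \<Rightarrow> ('a \<Rightarrow> int) set set" where
  "signature \<phi> \<gamma> =
     (let (\<gamma>1, \<gamma>2) = (SOME p. sgn_decomposition \<phi> \<gamma> p)
      in sgn_at \<phi> \<gamma>1 \<otimes>\<^bsub>K0_mod2 \<phi>\<^esub> sgn_at \<phi> \<gamma>2)"

end

theory Submission
  imports Defs
begin

text \<open>The signature is computed by counting inversions. An element \<open>\<gamma>\<close> of the topological full group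
  permutes every orbit, which is a copy of the ordered set \<open>\<int>\<close>, with bounded displacement; let \<open>ninv \<gamma> z\<close>
  be the number of points of the orbit of \<open>z\<close> that are after \<open>z\<close> but are mapped before the image of \<open>z\<close>.
  Modulo 2 and coboundaries this is a homomorphism on the whole group, and its value on the swap of
  \<open>U\<close> and \<open>\<phi>(U)\<close> is the class of \<open>U\<close>.

  In the abelianization of \<open>[[\<phi>]]\<^sub>0\<close>, conjugation shows that the class of the involution exchanging
  \<open>U\<close> and \<open>g(U)\<close> does not depend on \<open>g\<close>. This defines a class \<open>t U\<close> for every clopen set \<open>U\<close>, which is
  additive, \<open>\<phi>\<close>-invariant and killed by 2, so that \<open>t U = 0\<close> as soon as the indicator of \<open>U\<close> is
  trivial in \<open>K\<^sup>0\<close> modulo 2. An element of \<open>[[\<phi>]]\<^sub>x\<close> has bounded periods, and cutting its cycles into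
  transpositions shows that its class is \<open>t\<close> of the union of the bases of the towers of even height.
  Finally an element of index zero moves as many points of the orbit of \<open>x\<close> forward across the cut as
  backward, and these crossings are removed by swaps that respect the cut of another orbit.\<close>

section \<open>Locally constant maps\<close>

text \<open>The signature is defined through arbitrary choices, and its independence of them has to
  come out of the proof. The inversion count \<open>sg\<close> involves no choice and lives on the
  whole group, so it suffices that every admissible choice yields \<open>sg\<close>. The link is one
  statement: the class \<open>q \<gamma>\<close> in the abelianization equals \<open>t E\<close> for
  some clopen set \<open>E\<close>. Since the target of \<open>sg\<close> is abelian,
  \<open>sg\<close> factors through \<open>q\<close>, and its value on one product of swaps with
  class \<open>t E\<close> gives \<open>sg \<gamma> = Q (indicator E)\<close>. The same
  \<open>E\<close> serves for the kernel: if its indicator is trivial modulo 2, then so is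
  \<open>t E\<close>, and \<gamma> lies in the commutator subgroup.

  A swap is an involution and so has index zero, even when the map along which it is taken does not.
  This permits swaps along \<phi> itself and keeps every conjugation inside
  \<open>[[\<phi>]]_0\<close>. The remaining obstacle is that \<open>U\<close> may meet
  \<open>\<phi>(U)\<close>; a finite clopen colouring that separates \<open>x\<close> from
  \<open>\<phi> x\<close> splits \<open>U\<close> into pieces for which the swap exists.\<close>

definition loc_const :: "('a::topological_space \<Rightarrow> 'b) \<Rightarrow> bool" where
  "loc_const f \<longleftrightarrow> (\<forall>x. \<forall>\<^sub>F y in nhds x. f y = f x)"

lemma loc_constD: "loc_const f \<Longrightarrow> \<forall>\<^sub>F y in nhds x. f y = f x"
  by (simp add: loc_const_def)

lemma loc_const_openE:
  assumes "loc_const f"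
  obtains W where "open W" "x \<in> W" "\<And>y. y \<in> W \<Longrightarrow> f y = f x"
  using loc_constD[OF assms, of x] unfolding eventually_nhds by blast

lemma loc_const_const [simp, intro]: "loc_const (\<lambda>x. v)"
  by (simp add: loc_const_def)

lemma loc_const_comp: "loc_const f \<Longrightarrow> loc_const (\<lambda>x. h (f x))"
  unfolding loc_const_def by (metis (mono_tags, lifting) eventually_mono)

lemma loc_const_comp2:
  "loc_const f \<Longrightarrow> loc_const g \<Longrightarrow> loc_const (\<lambda>x. h (f x) (g x))"
  unfolding loc_const_def
proof safe
  fix x
  assume "\<forall>x. \<forall>\<^sub>F y in nhds x. f y = f x" "\<forall>x. \<forall>\<^sub>F y in nhds x. g y = g x"
  then have "\<forall>\<^sub>F y in nhds x. f y = f x" "\<forall>\<^sub>F y in nhds x. g y = g x" by auto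
  then show "\<forall>\<^sub>F y in nhds x. h (f y) (g y) = h (f x) (g x)"
    by eventually_elim simp
qed

text \<open>Near \<open>x\<close> the value of \<open>f\<close> is frozen, so of the whole family
  \<open>g\<close> only the member \<open>g (f x)\<close> matters.\<close>

lemma loc_const_subst:
  assumes "loc_const f" "\<And>v. loc_const (g v)"
  shows "loc_const (\<lambda>x. g (f x) x)"
  unfolding loc_const_def
proof
  fix x
  show "\<forall>\<^sub>F y in nhds x. g (f y) y = g (f x) x"
    using loc_constD[OF assms(1), of x] loc_constD[OF assms(2)[of "f x"], of x]
    by eventually_elim simp
qed

lemma loc_const_cont:
  assumes "loc_const f" "continuous_on UNIV g"
  shows "loc_const (\<lambda>x. f (g x))"
  unfolding loc_const_def
proof
  fix x
  have "filterlim g (nhds (g x)) (nhds x)"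
    using assms(2) by (metis UNIV_I at_within_open continuous_on_def open_UNIV tendsto_at_iff_tendsto_nhds)
  from eventually_compose_filterlim[OF loc_constD[OF assms(1)] this]
  show "\<forall>\<^sub>F y in nhds x. f (g y) = f (g x)" .
qed

lemma loc_const_add: "loc_const f \<Longrightarrow> loc_const g \<Longrightarrow> loc_const (\<lambda>x. f x + g x)"
  by (rule loc_const_comp2)

lemma loc_const_diff: "loc_const f \<Longrightarrow> loc_const g \<Longrightarrow> loc_const (\<lambda>x. f x - g x)"
  by (rule loc_const_comp2)

lemma loc_const_mult: "loc_const f \<Longrightarrow> loc_const g \<Longrightarrow> loc_const (\<lambda>x. f x * g x)"
  by (rule loc_const_comp2)

lemma loc_const_minus: "loc_const f \<Longrightarrow> loc_const (\<lambda>x. - f x)"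
  by (rule loc_const_comp)

lemma loc_const_not: "loc_const P \<Longrightarrow> loc_const (\<lambda>x. \<not> P x)"
  by (rule loc_const_comp)

lemma loc_const_conj: "loc_const P \<Longrightarrow> loc_const Q \<Longrightarrow> loc_const (\<lambda>x. P x \<and> Q x)"
  by (rule loc_const_comp2)

lemma loc_const_disj: "loc_const P \<Longrightarrow> loc_const Q \<Longrightarrow> loc_const (\<lambda>x. P x \<or> Q x)"
  by (rule loc_const_comp2)

lemma loc_const_imp: "loc_const P \<Longrightarrow> loc_const Q \<Longrightarrow> loc_const (\<lambda>x. P x \<longrightarrow> Q x)"
  by (rule loc_const_comp2)

lemma loc_const_eq: "loc_const f \<Longrightarrow> loc_const g \<Longrightarrow> loc_const (\<lambda>x. f x = g x)"
  by (rule loc_const_comp2)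

lemma loc_const_le: "loc_const f \<Longrightarrow> loc_const g \<Longrightarrow> loc_const (\<lambda>x. f x \<le> g x)"
  by (rule loc_const_comp2)

lemma loc_const_less: "loc_const f \<Longrightarrow> loc_const g \<Longrightarrow> loc_const (\<lambda>x. f x < g x)"
  by (rule loc_const_comp2)

lemma loc_const_if:
  "loc_const P \<Longrightarrow> loc_const f \<Longrightarrow> loc_const g \<Longrightarrow> loc_const (\<lambda>x. if P x then f x else g x)"
  by (rule loc_const_subst[of P "\<lambda>b. if b then f else g", THEN arg_cong[of _ _ loc_const, THEN iffD1, rotated]])
     auto

lemma loc_const_of_bool: "loc_const P \<Longrightarrow> loc_const (\<lambda>x. of_bool (P x))"
  by (rule loc_const_comp)

lemmas loc_const_intros = loc_const_const loc_const_add loc_const_diff loc_const_mult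
  loc_const_minus loc_const_not loc_const_conj loc_const_disj loc_const_imp loc_const_eq loc_const_le
  loc_const_less loc_const_if loc_const_of_bool

lemma loc_const_sum:
  assumes "finite K" "\<And>k. k \<in> K \<Longrightarrow> loc_const (f k)"
  shows "loc_const (\<lambda>x. \<Sum>k\<in>K. f k x)"
  using assms by (induction K rule: finite_induct) (auto intro: loc_const_add)

lemma loc_const_ball:
  assumes "finite K" "\<And>k. k \<in> K \<Longrightarrow> loc_const (\<lambda>x. P k x)"
  shows "loc_const (\<lambda>x. \<forall>k\<in>K. P k x)"
  using assms by (induction K rule: finite_induct) (auto intro: loc_const_conj)

lemma loc_const_bex:
  assumes "finite K" "\<And>k. k \<in> K \<Longrightarrow> loc_const (\<lambda>x. P k x)"
  shows "loc_const (\<lambda>x. \<exists>k\<in>K. P k x)"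
  using assms by (induction K rule: finite_induct) (auto intro: loc_const_disj)

text \<open>With finitely many candidates the set of those that satisfy \<open>P\<close> is locally
  constant, and then so are its cardinality and its minimum. The values are sets, which is why
  \<open>loc_const\<close> asks for no topology on the codomain.\<close>

lemma loc_const_Collect:
  assumes "finite K" "\<And>k. k \<in> K \<Longrightarrow> loc_const (P k)"
  shows "loc_const (\<lambda>x. {k \<in> K. P k x})"
  using assms
proof (induction K rule: finite_induct)
  case (insert k K)
  have "(\<lambda>x. {j \<in> insert k K. P j x}) = (\<lambda>x. if P k x then insert k {j \<in> K. P j x} else {j \<in> K. P j x})"
    by (rule ext) auto
  moreover have "loc_const (\<lambda>x. if P k x then insert k {j \<in> K. P j x} else {j \<in> K. P j x})"
    using insert by (intro loc_const_if loc_const_comp[of _ "insert k"]) auto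
  ultimately show ?case by simp
qed simp

lemma loc_const_iff_continuous_on:
  fixes f :: "'a::topological_space \<Rightarrow> 'b::discrete_topology"
  shows "loc_const f \<longleftrightarrow> continuous_on UNIV f"
proof
  assume f: "loc_const f"
  show "continuous_on UNIV f"
    unfolding continuous_on_def
  proof safe
    fix x
    have "\<forall>\<^sub>F y in at x. f y = f x"
      using loc_constD[OF f, of x] by (simp add: eventually_at_filter eventually_mono)
    then show "f \<midarrow>x\<rightarrow> f x"
      by (rule tendsto_eventually)
  qed
next
  assume f: "continuous_on UNIV f"
  show "loc_const f"
    unfolding loc_const_def
  proof
    fix x
    have "open (f -` {f x})"
      using f discrete_topology_class.open_discrete[of "{f x}"] continuous_on_open_vimage[OF open_UNIV, of f]
      by (metis Int_UNIV_right)
    then show "\<forall>\<^sub>F y in nhds x. f y = f x"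
      unfolding eventually_nhds by (intro exI[of _ "f -` {f x}"]) auto
  qed
qed

lemma loc_const_imp_open: "loc_const P \<Longrightarrow> open {x. P x}"
  unfolding open_subopen[of "{x. P x}"] by (metis loc_const_openE mem_Collect_eq subsetI)

text \<open>Clopen sets are treated as locally constant predicates, so that membership conditions
  and integer-valued functions share one set of closure rules.\<close>

abbreviation clopen :: "'a::topological_space set \<Rightarrow> bool" where
  "clopen U \<equiv> loc_const (\<lambda>x. x \<in> U)"

lemma clopen_iff: "clopen U \<longleftrightarrow> open U \<and> closed U"
proof safe
  assume U: "clopen U"
  then show "open U" using loc_const_imp_open[OF U] by simp
  show "closed U" using loc_const_imp_open[OF loc_const_not[OF U]]
    by (simp add: closed_def Compl_eq)
next
  assume U: "open U" "closed U"
  show "clopen U"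
    unfolding loc_const_def
  proof
    fix x
    show "\<forall>\<^sub>F y in nhds x. (y \<in> U) = (x \<in> U)"
      using eventually_nhds_in_open[OF U(1), of x] eventually_nhds_in_open[of "- U" x] U(2)
      by (cases "x \<in> U") (auto simp: closed_def elim: eventually_mono)
  qed
qed

lemma clopen_Un: "clopen A \<Longrightarrow> clopen B \<Longrightarrow> clopen (A \<union> B)"
  by (simp add: loc_const_disj)

lemma clopen_Int: "clopen A \<Longrightarrow> clopen B \<Longrightarrow> clopen (A \<inter> B)"
  by (simp add: loc_const_conj)

lemma clopen_Diff: "clopen A \<Longrightarrow> clopen B \<Longrightarrow> clopen (A - B)"
  by (simp add: loc_const_conj loc_const_not)

lemma compact_bound:
  fixes f :: "'a::topological_space \<Rightarrow> int"
  assumes "compact (UNIV :: 'a set)" "loc_const f"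
  obtains N where "N > 0" "\<And>x. \<bar>f x\<bar> \<le> N"
proof -
  have "\<exists>D \<subseteq> UNIV. finite D \<and> UNIV \<subseteq> (\<Union>v\<in>D. {x. f x = v})"
    by (rule compactE_image[OF assms(1), of UNIV "\<lambda>v. {x. f x = v}"])
       (auto intro!: loc_const_imp_open loc_const_eq assms(2))
  then obtain D where D: "finite D" "UNIV \<subseteq> (\<Union>v\<in>D. {x. f x = v})" by auto
  then have "f x \<in> D" for x by blast
  then have "\<bar>f x\<bar> \<le> Max (abs ` D) + 1" for x
    using Max_ge[of "abs ` D" "\<bar>f x\<bar>"] D(1) by fastforce
  moreover have "Max (abs ` D) \<ge> 0"
    using Max_ge[of "abs ` D" "\<bar>f undefined\<bar>"] D(1) \<open>\<And>x. f x \<in> D\<close> by fastforce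
  ultimately show thesis using that[of "Max (abs ` D) + 1"] by simp
qed

text \<open>Serves twice: for uniform hitting times, and for continuity at the empty set in the
  construction of the measure.\<close>

lemma compact_bound_family:
  fixes Q :: "nat \<Rightarrow> 'a::topological_space \<Rightarrow> bool"
  assumes "compact (UNIV :: 'a set)" "\<And>k. open {x. Q k x}" "\<And>x. \<exists>k. Q k x"
  obtains R where "\<And>x. \<exists>k\<le>R. Q k x"
proof -
  have "\<exists>D \<subseteq> UNIV. finite D \<and> UNIV \<subseteq> (\<Union>v\<in>D. {x. Q v x})"
    by (rule compactE_image[OF assms(1), of UNIV "\<lambda>v. {x. Q v x}"])
       (use assms in auto)
  then obtain D where D: "finite D" "UNIV \<subseteq> (\<Union>v\<in>D. {x. Q v x})" by auto
  have "\<exists>k\<le>Max D. Q k x" for x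
    using D Max_ge[of D] by blast
  then show thesis using that by blast
qed

section \<open>Cantor minimal systems\<close>

locale cms =
  fixes \<phi> :: "'a::topological_space \<Rightarrow> 'a"
  assumes minimal_system: "cantor_minimal_system \<phi>"
begin

abbreviation T :: "int \<Rightarrow> 'a \<Rightarrow> 'a" where "T \<equiv> int_iter \<phi>"

lemma compact_UNIV: "compact (UNIV :: 'a set)"
  and metrizable: "metrizable_space (euclidean :: 'a topology)"
  and islimpt_UNIV: "(x::'a) islimpt UNIV"
  and disconnected: "connected S \<Longrightarrow> \<exists>a::'a. S \<subseteq> {a}"
  using minimal_system unfolding cantor_minimal_system_def cantor_space_def by auto

lemma minimal: "closed C \<Longrightarrow> \<phi> ` C = C \<Longrightarrow> C = {} \<or> C = UNIV"
  using minimal_system unfolding cantor_minimal_system_def by auto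

lemma homeo: "homeomorphism UNIV UNIV \<phi> (inv_into UNIV \<phi>)"
  using minimal_system unfolding cantor_minimal_system_def self_homeomorphism_def by auto

lemma bij_phi: "bij \<phi>"
  using homeo unfolding homeomorphism_def by (metis UNIV_I bijI' surj_def)

lemma cont_phi: "continuous_on UNIV \<phi>" and cont_inv_phi: "continuous_on UNIV (inv_into UNIV \<phi>)"
  using homeo unfolding homeomorphism_def by auto

section \<open>Integer iterates of the homeomorphism\<close>

lemma T_0 [simp]: "T 0 x = x"
  by (simp add: int_iter_def)

lemma T_1 [simp]: "T 1 x = \<phi> x"
  by (simp add: int_iter_def)

lemma T_minus_1: "T (- 1) x = inv_into UNIV \<phi> x"
  by (simp add: int_iter_def)

lemma phi_inv [simp]: "\<phi> (inv_into UNIV \<phi> x) = x" "inv_into UNIV \<phi> (\<phi> x) = x"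
  using bij_phi by (auto simp: bij_def surj_f_inv_f)

lemma T_add_1: "T (k + 1) x = \<phi> (T k x)"
proof (cases "k \<ge> 0")
  case True
  then have "nat (k + 1) = Suc (nat k)" by simp
  with True show ?thesis by (simp add: int_iter_def)
next
  case False
  then have "nat (- k) = Suc (nat (- (k + 1)))" by simp
  then have "T k x = inv_into UNIV \<phi> ((inv_into UNIV \<phi> ^^ nat (- (k + 1))) x)"
    using False by (simp add: int_iter_def)
  moreover have "T (k + 1) x = (inv_into UNIV \<phi> ^^ nat (- (k + 1))) x"
    using False by (cases "k = -1") (auto simp: int_iter_def)
  ultimately show ?thesis by simp
qed

lemma T_add: "T (a + b) x = T a (T b x)"
proof (induction a rule: int_induct[where k = 0])
  case (step1 i)
  then show ?case using T_add_1[of "i + b"] T_add_1[of i] by (simp add: algebra_simps)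
next
  case (step2 i)
  have "\<phi> (T (i - 1 + b) x) = \<phi> (T (i - 1) (T b x))"
    using step2 T_add_1[of "i - 1 + b" x] T_add_1[of "i - 1" "T b x"] by (simp add: algebra_simps)
  then show ?case using bij_phi by (simp add: bij_def inj_eq)
qed simp

lemma T_cancel [simp]: "T k (T (- k) x) = x" "T (- k) (T k x) = x"
  using T_add[of k "- k" x] T_add[of "- k" k x] by auto

lemma T_phi: "T k (\<phi> x) = T (k + 1) x"
  using T_add[of k 1 x] by simp

lemma T_eqD: "T a x = y \<Longrightarrow> T (- a) y = x"
  by auto

lemma cont_T: "continuous_on UNIV (T k)"
proof -
  have "continuous_on UNIV (f ^^ n)" if "continuous_on UNIV f" for f :: "'a \<Rightarrow> 'a" and n
  proof (induction n)
    case (Suc n)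
    then have "continuous_on UNIV (\<lambda>x. f ((f ^^ n) x))"
      using continuous_on_compose2[OF that Suc] by simp
    then show ?case by (simp add: o_def)
  qed (simp add: id_def)
  then show ?thesis
    unfolding int_iter_def using cont_phi cont_inv_phi by auto
qed

lemma bij_T: "bij (T k)"
  by (rule bij_betw_byWitness[where f' = "T (- k)"]) auto

lemma loc_const_T: "loc_const f \<Longrightarrow> loc_const (\<lambda>x. f (T k x))"
  by (rule loc_const_cont[OF _ cont_T])

lemma loc_const_phi: "loc_const f \<Longrightarrow> loc_const (\<lambda>x. f (\<phi> x))"
  by (rule loc_const_cont[OF _ cont_phi])

lemma clopen_T_image:
  assumes "clopen U" shows "clopen (T k ` U)"
proof -
  have "(y \<in> T k ` U) = (T (- k) y \<in> U)" for y
    by (metis T_cancel image_iff)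
  then show ?thesis using loc_const_T[OF assms, of "- k"] by simp
qed

lemma T_image_iff: "y \<in> T k ` U \<longleftrightarrow> T (- k) y \<in> U"
  by (metis T_cancel image_iff)

section \<open>Separation of points and absence of periodic points\<close>

lemma hausdorff: "Hausdorff_space (euclidean :: 'a topology)"
  by (rule metrizable_imp_Hausdorff_space[OF metrizable])

lemma separate_open:
  assumes "(x::'a) \<noteq> y"
  obtains U V where "open U" "open V" "x \<in> U" "y \<in> V" "U \<inter> V = {}"
proof -
  have "\<exists>U V. open U \<and> open V \<and> x \<in> U \<and> y \<in> V \<and> U \<inter> V = {}"
    using hausdorff assms unfolding Hausdorff_space_def disjnt_def by auto
  then show thesis using that by blast
qed

lemma closed_finite:
  assumes "finite (F :: 'a set)" shows "closed F"
  using closedin_Hausdorff_finite[OF hausdorff _ assms] by simp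

lemma infinite_UNIV: "infinite (UNIV :: 'a set)"
proof
  assume fin: "finite (UNIV :: 'a set)"
  have "open {x}" for x :: 'a
    using closed_finite[of "- {x}"] finite_subset[OF _ fin] by (simp add: closed_def)
  then show False
    using islimpt_UNIV unfolding islimpt_def by blast
qed

text \<open>A periodic orbit would be finite, hence closed, and invariant. Minimality would make it
  the whole space, which is infinite because it has no isolated points.\<close>

theorem aperiodic:
  assumes "T k x = x" shows "k = 0"
proof (rule ccontr)
  assume "k \<noteq> 0"
  have per: "T (k * i) x = x" for i
  proof (induction i rule: int_induct[where k = 0])
    case (step1 i)
    then show ?case using T_add[of k "k * i" x] assms by (simp add: algebra_simps)
  next
    case (step2 i)
    then show ?case using T_add[of "- k" "k * i" x] T_eqD[OF assms] by (simp add: algebra_simps)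
  qed simp
  have "T j x = T (j mod k) x" for j
    using T_add[of "j mod k" "k * (j div k)" x] per by (simp add: mult.commute)
  moreover have "\<bar>j mod k\<bar> \<le> \<bar>k\<bar>" for j
    using \<open>k \<noteq> 0\<close> by (metis abs_mod_less less_imp_le)
  moreover have "j mod k \<in> {- \<bar>k\<bar>..\<bar>k\<bar>}" for j
    using calculation(2)[of j] by auto
  ultimately have "range (\<lambda>j. T j x) \<subseteq> (\<lambda>j. T j x) ` {- \<bar>k\<bar>..\<bar>k\<bar>}"
    by blast
  then have fin: "finite (range (\<lambda>j. T j x))"
    by (rule finite_subset) simp
  have "\<phi> ` range (\<lambda>j. T j x) = range (\<lambda>j. T j x)"
  proof -
    have "T j x \<in> \<phi> ` range (\<lambda>j. T j x)" for j
      using T_add_1[of "j - 1" x] by auto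
    moreover have "\<phi> (T j x) \<in> range (\<lambda>j. T j x)" for j
      by (metis T_add_1 rangeI)
    ultimately show ?thesis by blast
  qed
  then have "range (\<lambda>j. T j x) = UNIV"
    using minimal[OF closed_finite[OF fin]] by blast
  then show False using fin infinite_UNIV by simp
qed

lemma T_inj: "T j x = T k x \<Longrightarrow> j = k"
  using aperiodic[of "j - k" "T k x"] T_add[of "j - k" k x] by simp

subsection \<open>Clopen sets\<close>

text \<open>In a compact Hausdorff space components and quasi-components coincide. Connected sets
  have at most one point here, so the quasi-component of \<open>x\<close> is \<open>{x}\<close>, and
  a quasi-component can be separated by a clopen set from any compact set that it misses, such as
  the complement of \<open>B\<close>.\<close>

lemma clopen_basis:
  assumes "open (B :: 'a set)" "x \<in> B"
  obtains W where "clopen W" "x \<in> W" "W \<subseteq> B"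
proof -
  have cpt: "compact_space (euclidean :: 'a topology)"
    using compact_UNIV by (simp add: compact_space_def)
  have "compactin euclidean (quasi_component_of_set (euclidean :: 'a topology) x)"
    using closedin_compact_space[OF cpt closedin_quasi_component_of, of x] .
  from compact_quasi_eq_connected_components_of[OF compact_imp_locally_compact_space[OF cpt] hausdorff this]
  have Q: "quasi_component_of_set (euclidean :: 'a topology) x \<in> connected_components_of euclidean"
    by (rule iffD1) (simp add: quasi_components_of_def)
  then have "connected (quasi_component_of_set (euclidean :: 'a topology) x)"
    using connectedin_connected_components_of by fastforce
  then obtain a where "quasi_component_of_set euclidean x \<subseteq> {a}"
    using disconnected by blast
  moreover have "x \<in> quasi_component_of_set euclidean x" by simp
  ultimately have qx: "quasi_component_of_set euclidean x = {x}" by blast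
  have "compactin euclidean (- B)"
    using closedin_compact_space[OF cpt] assms(1) by (simp add: closed_Compl)
  then have "separated_between euclidean {x} (- B)"
    using separated_between_quasi_component_compact[of "{x}" "euclidean" "- B"] assms(2) qx
    by (auto simp: quasi_components_of_def)
  then obtain U V where UV: "open U" "open V" "U \<union> V = UNIV" "U \<inter> V = {}" "x \<in> U" "- B \<subseteq> V"
    unfolding separated_between_def by (auto simp: disjnt_def)
  have "V = - U" using UV by auto
  then have "clopen U" using UV unfolding clopen_iff by (simp add: closed_def)
  then show thesis using that UV by blast
qed

lemma clopen_separate:
  assumes "(x::'a) \<noteq> y"
  obtains W where "clopen W" "x \<in> W" "y \<notin> W"
proof -
  obtain U V where UV: "open U" "x \<in> U" "y \<in> V" "U \<inter> V = {}"
    using separate_open[OF assms] by metis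
  obtain W where "clopen W" "x \<in> W" "W \<subseteq> U" by (rule clopen_basis[OF UV(1,2)])
  then show thesis using that UV by blast
qed

lemma clopen_separate_finite:
  assumes "finite F" "(x::'a) \<notin> F"
  obtains W where "clopen W" "x \<in> W" "W \<inter> F = {}"
proof -
  have "open (- F)" using closed_finite[OF assms(1)] by (simp add: closed_def)
  then obtain W where "clopen W" "x \<in> W" "W \<subseteq> - F"
    using clopen_basis assms(2) by (metis ComplI)
  then show thesis using that by blast
qed

lemma clopen_nbhd_loc_const:
  assumes "loc_const f"
  obtains W where "clopen W" "x \<in> W" "\<And>y. y \<in> W \<Longrightarrow> f y = f x"
proof
  show "clopen {y. f y = f x}" by (simp add: loc_const_eq assms)
qed auto

text \<open>\<open>U\<close> is cut along a finite cover by small sets. The pieces have to be made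
  disjoint, so the local hypothesis must cover all clopen subsets of \<open>W\<close> and not only
  \<open>W\<close> itself.\<close>

theorem clopen_induct:
  assumes local: "\<And>z. \<exists>W. clopen W \<and> z \<in> W \<and> (\<forall>W'. clopen W' \<and> W' \<subseteq> W \<longrightarrow> P W')"
    and Un: "\<And>A B. clopen A \<Longrightarrow> clopen B \<Longrightarrow> A \<inter> B = {} \<Longrightarrow> P A \<Longrightarrow> P B \<Longrightarrow> P (A \<union> B)"
    and U: "clopen (U :: 'a set)"
  shows "P U"
proof -
  obtain W where W: "\<And>z. clopen (W z)" "\<And>z. z \<in> W z" "\<And>z W'. clopen W' \<Longrightarrow> W' \<subseteq> W z \<Longrightarrow> P W'"
    using local by metis
  have "\<exists>D \<subseteq> UNIV. finite D \<and> UNIV \<subseteq> (\<Union>v\<in>D. W v)"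
    by (rule compactE_image[OF compact_UNIV, of UNIV W])
       (use W in \<open>auto simp: clopen_iff\<close>)
  then obtain D where D: "finite D" "(\<Union>v\<in>D. W v) = UNIV" by auto
  have "P (U \<inter> (\<Union>v\<in>D. W v)) \<and> clopen (\<Union>v\<in>D. W v)"
    using D(1)
  proof (induction D rule: finite_induct)
    case empty
    show ?case using W(3)[of "{}"] by auto
  next
    case (insert v D)
    let ?A = "\<Union>v\<in>D. W v"
    have cl: "clopen ?A" using insert by simp
    have "P ((U \<inter> ?A) \<union> (U \<inter> (W v - ?A)))"
      using insert U W cl by (intro Un clopen_Int clopen_Diff W(3)[of "U \<inter> (W v - ?A)" v]) auto
    moreover have "(U \<inter> ?A) \<union> (U \<inter> (W v - ?A)) = U \<inter> (\<Union>v\<in>insert v D. W v)" by auto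
    moreover have "clopen (\<Union>v\<in>insert v D. W v)"
      using clopen_Un[OF W(1)[of v] cl] by simp
    ultimately show ?case by simp
  qed
  then show ?thesis using D(2) by simp
qed

text \<open>Level sets are closed and invariant, so minimality leaves room for only one.\<close>

lemma invariant_loc_const:
  assumes "loc_const f" "\<And>x. f (\<phi> x) = f x"
  shows "f x = f y"
proof -
  let ?C = "{z. f z = f y}"
  have "clopen ?C" by (simp add: loc_const_eq assms(1))
  then have "closed ?C" by (simp only: clopen_iff)
  moreover have "\<phi> ` ?C = ?C"
    using assms(2) by (auto simp: image_iff) (metis phi_inv(1))
  ultimately show ?thesis using minimal[of ?C] by blast
qed

text \<open>The points that never visit \<open>W\<close> form a closed invariant set that misses
  \<open>x\<close>, hence an empty one; compactness then bounds the time of the first visit.\<close>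

lemma bounded_hitting:
  assumes "clopen W" "x \<in> W"
  obtains R where "R > 0" "\<And>z. \<exists>k. \<bar>k\<bar> \<le> R \<and> T k z \<in> W"
proof -
  let ?C = "{z. \<forall>k. T k z \<notin> W}"
  have "open {z. T k z \<in> W}" for k
    using loc_const_imp_open[OF loc_const_T[OF assms(1)]] .
  then have "open (\<Union>k. {z. T k z \<in> W})" by blast
  then have "closed ?C" unfolding closed_def by (simp add: Collect_ex_eq[symmetric] Collect_neg_eq[symmetric])
  moreover have "\<phi> ` ?C = ?C"
  proof -
    have "inv_into UNIV \<phi> z \<in> ?C" if "z \<in> ?C" for z
      using that by (auto simp flip: T_minus_1 T_add)
    then show ?thesis
      by (auto simp: T_phi image_iff) (metis phi_inv(1))
  qed
  ultimately have "?C = {}"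
    using minimal[of ?C] assms(2) by (metis (mono_tags, lifting) T_0 UNIV_I mem_Collect_eq)
  then have "\<exists>k. \<bar>k\<bar> \<le> int n \<and> T k z \<in> W" if "n \<ge> nat \<bar>SOME k. T k z \<in> W\<bar>" for z n
    using that by (intro exI[of _ "SOME k. T k z \<in> W"]) (auto intro: someI_ex)
  then have ex: "\<exists>n. \<exists>k. \<bar>k\<bar> \<le> int n \<and> T k z \<in> W" for z by blast
  have op: "open {z. \<exists>k. \<bar>k\<bar> \<le> int n \<and> T k z \<in> W}" for n
  proof -
    have "{z. \<exists>k. \<bar>k\<bar> \<le> int n \<and> T k z \<in> W} = (\<Union>k\<in>{k. \<bar>k\<bar> \<le> int n}. {z. T k z \<in> W})" by auto
    then show ?thesis using \<open>\<And>k. open {z. T k z \<in> W}\<close> by auto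
  qed
  obtain R where R: "\<And>z. \<exists>n\<le>R. \<exists>k. \<bar>k\<bar> \<le> int n \<and> T k z \<in> W"
    using compact_bound_family[OF compact_UNIV op ex] by blast
  show thesis
  proof
    show "int R + 1 > 0" by simp
    show "\<exists>k. \<bar>k\<bar> \<le> int R + 1 \<and> T k z \<in> W" for z
      using R[of z] by (meson le_trans nat_le_iff of_nat_mono order_trans zle_add1_eq_le less_imp_le zless_add1_eq)
  qed
qed

lemma int_bound:
  fixes f :: "'a \<Rightarrow> int"
  assumes "loc_const f"
  obtains N where "N > 0" "\<And>x. \<bar>f x\<bar> \<le> N"
  using compact_bound[OF compact_UNIV assms] by blast

subsection \<open>The topological full group\<close>

abbreviation FG :: "('a \<Rightarrow> 'a) set" where "FG \<equiv> full_group \<phi>"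
abbreviation c :: "('a \<Rightarrow> 'a) \<Rightarrow> 'a \<Rightarrow> int" where "c \<equiv> cocycle \<phi>"

text \<open>Locally \<gamma> is a power of \<phi>, hence continuous, and a continuous bijection of a
  compact Hausdorff space is a homeomorphism. So membership in the full group is reduced to
  bijectivity and a locally constant displacement.\<close>

lemma FG_I:
  assumes "bij \<gamma>" "loc_const n" "\<And>x. \<gamma> x = T (n x) x"
  shows "\<gamma> \<in> FG"
proof -
  have cont: "continuous_on UNIV \<gamma>"
    unfolding continuous_on_def
  proof safe
    fix x
    have "T (n x) \<midarrow>x\<rightarrow> T (n x) x"
      using cont_T[of "n x"] unfolding continuous_on_def by auto
    moreover have "\<forall>\<^sub>F y in at x. T (n x) y = \<gamma> y"
      using loc_constD[OF assms(2), of x] assms(3) by (auto simp: eventually_at_filter elim!: eventually_mono)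
    ultimately show "\<gamma> \<midarrow>x\<rightarrow> \<gamma> x"
      using assms(3)[of x] tendsto_cong by fastforce
  qed
  have "continuous_on UNIV (inv_into UNIV \<gamma>)"
  proof -
    have "continuous_map euclidean euclidean \<gamma>" using cont by simp
    then have "homeomorphic_map euclidean euclidean \<gamma>"
      using continuous_imp_homeomorphic_map[of "euclidean :: 'a topology" euclidean \<gamma>] compact_UNIV hausdorff assms(1)
      by (simp add: compact_space_def bij_def)
    then obtain g where g: "homeomorphic_maps euclidean euclidean \<gamma> g"
      using homeomorphic_map_maps by blast
    then have "g = inv_into UNIV \<gamma>"
      using assms(1) by (auto simp: homeomorphic_maps_def bij_def intro!: ext) (metis inv_f_f surj_f_inv_f)
    then show ?thesis using g by (simp add: homeomorphic_maps_def)
  qed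
  then have "self_homeomorphism \<gamma>"
    using cont assms(1) unfolding self_homeomorphism_def homeomorphism_def
    by (auto simp: bij_def surj_f_inv_f inj_imp_surj_inv)
  moreover have "is_cocycle \<phi> \<gamma> n"
    using assms by (simp add: is_cocycle_def loc_const_iff_continuous_on)
  ultimately show ?thesis unfolding full_group_def by blast
qed

lemma FG_cocycle:
  assumes "\<gamma> \<in> FG" shows "loc_const (c \<gamma>)" "\<gamma> x = T (c \<gamma> x) x"
proof -
  have "\<exists>n. is_cocycle \<phi> \<gamma> n" using assms by (simp add: full_group_def)
  then have "is_cocycle \<phi> \<gamma> (c \<gamma>)" unfolding cocycle_def by (rule someI_ex)
  then show "loc_const (c \<gamma>)" "\<gamma> x = T (c \<gamma> x) x"
    by (auto simp: is_cocycle_def loc_const_iff_continuous_on)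
qed

lemma FG_bij: "\<gamma> \<in> FG \<Longrightarrow> bij \<gamma>"
  unfolding full_group_def self_homeomorphism_def homeomorphism_def by (auto intro!: bijI') (metis UNIV_I)+

lemma FG_cont: "\<gamma> \<in> FG \<Longrightarrow> continuous_on UNIV \<gamma>"
  unfolding full_group_def self_homeomorphism_def homeomorphism_def by auto

lemma cocycle_eq: "\<gamma> \<in> FG \<Longrightarrow> \<gamma> x = T k x \<Longrightarrow> c \<gamma> x = k"
  using FG_cocycle(2)[of \<gamma> x] T_inj by metis

lemma FG_id: "id \<in> FG"
  by (rule FG_I[of _ "\<lambda>x. 0"]) auto

lemma cocycle_id: "c id x = 0"
  by (rule cocycle_eq[OF FG_id]) simp

lemma FG_comp:
  assumes "\<gamma> \<in> FG" "\<delta> \<in> FG" shows "\<gamma> \<circ> \<delta> \<in> FG"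
proof (rule FG_I)
  show "bij (\<gamma> \<circ> \<delta>)" using FG_bij assms by (simp add: bij_comp)
  show "loc_const (\<lambda>x. c \<gamma> (\<delta> x) + c \<delta> x)"
    using assms by (intro loc_const_add loc_const_cont[OF FG_cocycle(1) FG_cont] FG_cocycle(1))
  show "(\<gamma> \<circ> \<delta>) x = T (c \<gamma> (\<delta> x) + c \<delta> x) x" for x
    using FG_cocycle(2)[OF assms(1), of "\<delta> x"] FG_cocycle(2)[OF assms(2), of x] by (simp add: T_add)
qed

lemma cocycle_comp:
  assumes "\<gamma> \<in> FG" "\<delta> \<in> FG" shows "c (\<gamma> \<circ> \<delta>) x = c \<gamma> (\<delta> x) + c \<delta> x"
  using FG_cocycle(2)[OF assms(1), of "\<delta> x"] FG_cocycle(2)[OF assms(2), of x]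
  by (intro cocycle_eq FG_comp assms) (simp add: T_add)

lemma FG_inv:
  assumes "\<gamma> \<in> FG" shows "inv_into UNIV \<gamma> \<in> FG"
proof (rule FG_I)
  note b = FG_bij[OF assms]
  show "bij (inv_into UNIV \<gamma>)" using b by (rule bij_imp_bij_inv)
  have "continuous_on UNIV (inv_into UNIV \<gamma>)"
    using assms unfolding full_group_def self_homeomorphism_def homeomorphism_def by auto
  then show "loc_const (\<lambda>x. - c \<gamma> (inv_into UNIV \<gamma> x))"
    by (intro loc_const_minus loc_const_cont[OF FG_cocycle(1)[OF assms]])
  show "inv_into UNIV \<gamma> x = T (- c \<gamma> (inv_into UNIV \<gamma> x)) x" for x
    using FG_cocycle(2)[OF assms, of "inv_into UNIV \<gamma> x"] b by (metis T_cancel(2) bij_inv_eq_iff)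
qed

lemma FG_T: "T k \<in> FG"
  by (rule FG_I[of _ "\<lambda>x. k"]) (auto intro: bij_T)

lemma FG_phi: "\<phi> \<in> FG"
  using FG_T[of 1] by (metis T_1 ext)

lemma FG_funpow: "\<gamma> \<in> FG \<Longrightarrow> \<gamma> ^^ n \<in> FG"
  by (induction n) (auto intro: FG_comp FG_id)

lemma clopen_FG_image:
  assumes "\<gamma> \<in> FG" "clopen U" shows "clopen (\<gamma> ` U)"
proof -
  have "(y \<in> \<gamma> ` U) = (inv_into UNIV \<gamma> y \<in> U)" for y
    using FG_bij[OF assms(1)] by (metis bij_inv_eq_iff image_iff)
  then show ?thesis using loc_const_cont[OF assms(2) FG_cont[OF FG_inv[OF assms(1)]]] by simp
qed

subsection \<open>Coboundaries\<close>

abbreviation cob :: "('a \<Rightarrow> int) \<Rightarrow> bool" where "cob f \<equiv> f \<in> coboundaries \<phi>"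

lemma cobD: "cob f \<Longrightarrow> \<exists>g. loc_const g \<and> f = (\<lambda>x. g x - g (inv_into UNIV \<phi> x))"
  unfolding coboundaries_def CXZ_def by (auto simp: loc_const_iff_continuous_on)

lemma cobI: "loc_const g \<Longrightarrow> cob (\<lambda>x. g x - g (inv_into UNIV \<phi> x))"
  unfolding coboundaries_def CXZ_def by (auto simp: loc_const_iff_continuous_on)

lemma cob_0: "cob (\<lambda>x. 0)"
  using cobI[of "\<lambda>x. 0"] by simp

lemma cob_add: assumes "cob f" "cob g" shows "cob (\<lambda>x. f x + g x)"
proof -
  obtain u v where "loc_const u" "f = (\<lambda>x. u x - u (inv_into UNIV \<phi> x))"
    "loc_const v" "g = (\<lambda>x. v x - v (inv_into UNIV \<phi> x))"
    using assms[THEN cobD] by blast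
  then show ?thesis using cobI[of "\<lambda>x. u x + v x"] by (simp add: loc_const_add algebra_simps)
qed

lemma cob_minus: assumes "cob f" shows "cob (\<lambda>x. - f x)"
proof -
  obtain u where "loc_const u" "f = (\<lambda>x. u x - u (inv_into UNIV \<phi> x))"
    using assms[THEN cobD] by blast
  then show ?thesis using cobI[of "\<lambda>x. - u x"] by (simp add: loc_const_minus algebra_simps)
qed

lemma cob_diff: "cob f \<Longrightarrow> cob g \<Longrightarrow> cob (\<lambda>x. f x - g x)"
  using cob_add[of f "\<lambda>x. - g x"] cob_minus[of g] by simp

lemma cob_sum: "finite K \<Longrightarrow> (\<And>k. k \<in> K \<Longrightarrow> cob (f k)) \<Longrightarrow> cob (\<lambda>x. \<Sum>k\<in>K. f k x)"
  by (induction K rule: finite_induct) (auto intro: cob_0 cob_add)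

lemma cob_loc_const: "cob f \<Longrightarrow> loc_const f"
proof -
  assume "cob f"
  then obtain g where g: "loc_const g" "f = (\<lambda>x. g x - g (inv_into UNIV \<phi> x))" using cobD by blast
  show ?thesis unfolding g(2) using loc_const_diff[OF g(1) loc_const_T[OF g(1), of "-1"]]
    by (simp only: T_minus_1)
qed

lemma cob_phi: assumes "loc_const g" shows "cob (\<lambda>x. g (\<phi> x) - g x)"
  using cobI[OF loc_const_phi[OF assms]] by simp

lemma cob_T: assumes "loc_const g" shows "cob (\<lambda>x. g (T k x) - g x)"
proof (induction k rule: int_induct[where k = 0])
  case base
  then show ?case by (simp add: cob_0)
next
  case (step1 i)
  have "cob (\<lambda>x. (g (T i (\<phi> x)) - g (T i x)) + (g (T i x) - g x))"
    using cob_phi[OF loc_const_T[OF assms, of i]] step1(2) by (rule cob_add)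
  then show ?case by (simp add: T_phi)
next
  case (step2 i)
  have "cob (\<lambda>x. (g (T i x) - g x) - (g (T (i - 1) (\<phi> x)) - g (T (i - 1) x)))"
    using step2(2) cob_phi[OF loc_const_T[OF assms, of "i - 1"]] by (rule cob_diff)
  then show ?case by (simp add: T_phi)
qed

text \<open>Piece by piece \<delta> is a power of \<phi>. The part \<open>h k\<close> of
  \<open>f\<close> lives on the points at which \<delta> arrives with displacement \<open>k\<close>;
  on it composing with \<delta> amounts to composing with \<open>T k\<close>, and only finitely many
  \<open>k\<close> occur.\<close>

theorem cob_FG:
  assumes "\<delta> \<in> FG" "loc_const f" shows "cob (\<lambda>x. f (\<delta> x) - f x)"
proof -
  obtain N where N: "N > 0" "\<And>x. \<bar>c \<delta> x\<bar> \<le> N"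
    using int_bound[OF FG_cocycle(1)[OF assms(1)]] by blast
  define \<delta>' where "\<delta>' = inv_into UNIV \<delta>"
  have inv: "\<delta>' (\<delta> x) = x" "\<delta> (\<delta>' x) = x" for x
    using FG_bij[OF assms(1)] unfolding \<delta>'_def by (simp_all add: bij_def surj_f_inv_f)
  define h where "h = (\<lambda>k x. if c \<delta> (\<delta>' x) = k then f x else 0)"
  have lc: "loc_const (h k)" for k
    unfolding h_def \<delta>'_def
    by (intro loc_const_intros assms loc_const_cont[OF FG_cocycle(1) FG_cont] FG_inv)
  have "h k (T k x) = (if c \<delta> x = k then f (\<delta> x) else 0)" for k x
  proof (cases "c \<delta> x = k")
    case True
    then have "T k x = \<delta> x" using FG_cocycle(2)[OF assms(1), of x] by simp
    then show ?thesis using True inv by (simp add: h_def)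
  next
    case False
    have "c \<delta> (\<delta>' (T k x)) \<noteq> k"
    proof
      assume a: "c \<delta> (\<delta>' (T k x)) = k"
      then have "T k (\<delta>' (T k x)) = T k x"
        using FG_cocycle(2)[OF assms(1), of "\<delta>' (T k x)"] inv by simp
      then have "\<delta>' (T k x) = x" using bij_T[of k] by (simp add: bij_def inj_eq)
      then show False using a False by simp
    qed
    then show ?thesis using False by (simp add: h_def)
  qed
  then have "(\<Sum>k\<in>{-N..N}. h k (T k x) - h k x) = f (\<delta> x) - f x" for x
    using N(2)[of x] N(2)[of "\<delta>' x"] by (simp add: sum_subtractf h_def abs_le_iff)
  then show ?thesis
    using cob_sum[of "{-N..N}" "\<lambda>k x. h k (T k x) - h k x"] cob_T[OF lc] by simp
qed

subsection \<open>An invariant probability measure\<close>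

lemma clopen_between:
  assumes "closed K" "open U" "K \<subseteq> (U :: 'a set)"
  obtains W where "clopen W" "K \<subseteq> W" "W \<subseteq> U"
proof -
  have "\<exists>W. clopen W \<and> x \<in> W \<and> (x \<in> K \<longrightarrow> W \<subseteq> U)" for x
  proof (cases "x \<in> K")
    case True
    then show ?thesis using clopen_basis[OF assms(2), of x] assms(3) by blast
  next
    case False
    then show ?thesis by (intro exI[of _ UNIV]) simp
  qed
  then obtain W where W: "\<And>x. clopen (W x)" "\<And>x. x \<in> W x" "\<And>x. x \<in> K \<Longrightarrow> W x \<subseteq> U" by metis
  have "compact K" using compact_Int_closed[OF compact_UNIV assms(1)] by simp
  have "\<exists>D \<subseteq> K. finite D \<and> K \<subseteq> (\<Union>v\<in>D. W v)"
    by (rule compactE_image[OF \<open>compact K\<close>, of K W]) (use W in \<open>auto simp: clopen_iff\<close>)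
  then obtain D where D: "D \<subseteq> K" "finite D" "K \<subseteq> (\<Union>v\<in>D. W v)" by auto
  have "clopen (\<Union>v\<in>D. W v)"
    using D(2) loc_const_bex[of D "\<lambda>v x. x \<in> W v"] W(1) by simp
  then show thesis using that[of "\<Union>v\<in>D. W v"] D W(3) by blast
qed

text \<open>In a metrizable space an open set is a countable union of closed sets, and each of these
  can be enlarged to a clopen set inside the open one.\<close>

lemma sigma_sets_clopen: "sigma_sets UNIV {U :: 'a set. clopen U} = sets borel"
proof -
  have "sigma_sets UNIV {U :: 'a set. clopen U} = sigma_sets UNIV {S. open S}"
  proof (rule sigma_sets_eqI)
    fix U :: "'a set" assume "U \<in> {S. open S}"
    then have U: "open U" by simp
    then have "fsigma_in euclidean U"
      using open_imp_fsigma_in[OF metrizable] by simp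
    then obtain C where C: "\<And>n::nat. closed (C n)" "\<Union> (range C) = U"
      unfolding fsigma_in_ascending by auto
    then have "\<exists>W. clopen W \<and> C n \<subseteq> W \<and> W \<subseteq> U" for n
      using clopen_between[OF C(1) U, of n] by (metis UN_upper UNIV_I)
    then obtain W where W: "\<And>n. clopen (W n)" "\<And>n. C n \<subseteq> W n" "\<And>n. W n \<subseteq> U" by metis
    have "(\<Union>n. W n) \<in> sigma_sets UNIV {U :: 'a set. clopen U}"
      using W(1) by (intro sigma_sets.Union sigma_sets.Basic) auto
    moreover have "(\<Union>n. W n) = U" using W C(2) by blast
    ultimately show "U \<in> sigma_sets UNIV {U :: 'a set. clopen U}" by simp
  qed (auto simp: clopen_iff)
  then show ?thesis by (simp add: borel_def)
qed

text \<open>A cluster point, in the product topology, of the averages along one orbit.\<close>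

lemma invariant_mean:
  obtains m :: "'a set \<Rightarrow> real" where
    "\<And>A. 0 \<le> m A" "m UNIV = 1" "\<And>A B. A \<inter> B = {} \<Longrightarrow> m (A \<union> B) = m A + m B"
    "\<And>A. m (\<phi> -` A) = m A"
proof -
  define x0 :: 'a where "x0 = undefined"
  define av :: "nat \<Rightarrow> 'a set \<Rightarrow> real"
    where "av = (\<lambda>N A. (\<Sum>k<Suc N. indicator A (T (int k) x0)) / real (Suc N))"
  have av01: "av N A \<in> {0..1}" for N A
  proof -
    have "(\<Sum>k<Suc N. indicator A (T (int k) x0) :: real) \<le> (\<Sum>k<Suc N. 1)"
      by (intro sum_mono) (auto simp: indicator_def)
    moreover have "(\<Sum>k<Suc N. indicator A (T (int k) x0) :: real) \<ge> 0"
      by (intro sum_nonneg) auto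
    ultimately show ?thesis by (simp add: av_def divide_simps del: sum.lessThan_Suc)
  qed
  let ?S = "PiE UNIV (\<lambda>_. {0..1}) :: ('a set \<Rightarrow> real) set"
  have "compactin (product_topology (\<lambda>_. euclidean) UNIV) ?S"
    by (simp add: compactin_PiE)
  then have S: "compact ?S" by (simp add: euclidean_product_topology)
  have "filtermap av sequentially \<noteq> bot" by (simp add: filtermap_bot_iff)
  moreover have "eventually (\<lambda>f. f \<in> ?S) (filtermap av sequentially)"
    unfolding eventually_filtermap using av01 by (intro always_eventually) (auto simp: PiE_def)
  ultimately obtain m where m: "inf (nhds m) (filtermap av sequentially) \<noteq> bot"
    using S unfolding compact_filter by blast
  \<comment> \<open>A proper filter finer than both: along \<open>H\<close> every coordinate
    converges to that of \<open>m\<close>, and whatever holds for all large \<open>N\<close> remains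
    true.\<close>
  define H where "H = inf (nhds m) (filtermap av sequentially)"
  have H: "H \<noteq> bot" using m by (simp add: H_def)
  have lim: "((\<lambda>f. f A) \<longlongrightarrow> m A) H" for A
  proof -
    have "continuous_on UNIV (\<lambda>f::'a set \<Rightarrow> real. f A)" by (rule continuous_on_product_coordinates)
    then have "((\<lambda>f. f A) \<longlongrightarrow> m A) (nhds m)"
      unfolding continuous_on_def by (metis UNIV_I at_within_open open_UNIV tendsto_at_iff_tendsto_nhds)
    then show ?thesis by (rule tendsto_mono[rotated]) (simp add: H_def)
  qed
  have ev: "eventually P H" if "\<forall>\<^sub>F N in sequentially. P (av N)" for P
    using that filter_leD[of H "filtermap av sequentially" P] by (simp add: H_def eventually_filtermap)
  show thesis
  proof
    show "0 \<le> m A" for A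
      using lim ev[of "\<lambda>f. 0 \<le> f A"] av01 by (intro tendsto_lowerbound[OF lim _ H]) auto
    have "av N UNIV = 1" for N by (simp add: av_def)
    then have "\<forall>\<^sub>F f in H. f UNIV = 1" by (intro ev) simp
    then show "m UNIV = 1"
      by (intro tendsto_unique[OF H lim[of UNIV]] tendsto_eventually)
    show "m (A \<union> B) = m A + m B" if "A \<inter> B = {}" for A B
    proof -
      have "av N (A \<union> B) = av N A + av N B" for N
        using that by (simp add: av_def indicator_disj_union indicator_add[symmetric] sum.distrib add_divide_distrib[symmetric] Int_commute del: sum.lessThan_Suc)
      then have "\<forall>\<^sub>F f in H. f (A \<union> B) = f A + f B" by (intro ev) auto
      then have "((\<lambda>f. f (A \<union> B)) \<longlongrightarrow> m A + m B) H"
        using tendsto_add[OF lim[of A] lim[of B]] by (simp add: tendsto_cong)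
      then show ?thesis using tendsto_unique[OF H lim[of "A \<union> B"]] by blast
    qed
    show "m (\<phi> -` A) = m A" for A
    proof -
      \<comment> \<open>The shift by \<phi> changes only the two end terms of the sum.\<close>
      have dif: "\<bar>av N (\<phi> -` A) - av N A\<bar> \<le> 1 / real (Suc N)" for N
      proof -
        have "(indicator (\<phi> -` A) (T (int k) x0) :: real) = indicator A (T (int (Suc k)) x0)" for k
          using T_add_1[of "int k" x0] by (auto simp: indicator_def add.commute)
        then have "(\<Sum>k<Suc N. indicator (\<phi> -` A) (T (int k) x0) :: real) - (\<Sum>k<Suc N. indicator A (T (int k) x0))
            = (\<Sum>k<Suc N. indicator A (T (int (Suc k)) x0) - indicator A (T (int k) x0))"
          by (simp only: sum_subtractf)
        also have "\<dots> = indicator A (T (int (Suc N)) x0) - indicator A (T (int 0) x0)"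
          by (rule sum_lessThan_telescope)
        finally have "av N (\<phi> -` A) - av N A
            = (indicator A (T (int (Suc N)) x0) - indicator A (T (int 0) x0)) / real (Suc N)"
          by (simp only: av_def diff_divide_distrib[symmetric])
        also have "\<bar>\<dots>\<bar> \<le> 1 / real (Suc N)"
          by (auto simp: indicator_def)
        finally show ?thesis .
      qed
      have "\<bar>m (\<phi> -` A) - m A\<bar> \<le> e" if "e > 0" for e
      proof -
        have "\<forall>\<^sub>F N in sequentially. 1 / real (Suc N) < e"
          using order_tendstoD(2)[OF LIMSEQ_inverse_real_of_nat that] by (simp add: inverse_eq_divide)
        then have "\<forall>\<^sub>F N in sequentially. \<bar>av N (\<phi> -` A) - av N A\<bar> \<le> e"
          by eventually_elim (use dif in \<open>meson less_imp_le order_trans\<close>)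
        then have "\<forall>\<^sub>F f in H. \<bar>f (\<phi> -` A) - f A\<bar> \<le> e" by (rule ev)
        then show ?thesis
          by (rule tendsto_upperbound[OF tendsto_rabs[OF tendsto_diff[OF lim lim]] _ H])
      qed
      then have "\<bar>m (\<phi> -` A) - m A\<bar> \<le> 0" by (rule field_le_epsilon) simp
      then show ?thesis by simp
    qed
  qed
qed

text \<open>On clopen sets the finitely additive mean is continuous at the empty set for free: by
  compactness a decreasing sequence of clopen sets with empty intersection is eventually empty.
  Caratheodory's theorem extends it, and invariance passes from the clopen sets, which are stable
  under intersection, to all Borel sets.\<close>

theorem invariant_prob_exists: "\<exists>\<mu>. invariant_prob \<phi> \<mu>"
proof -
  obtain m :: "'a set \<Rightarrow> real" where m: "\<And>A. 0 \<le> m A" "m UNIV = 1"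
    "\<And>A B. A \<inter> B = {} \<Longrightarrow> m (A \<union> B) = m A + m B" "\<And>A. m (\<phi> -` A) = m A"
    using invariant_mean by blast
  have m0: "m {} = 0" using m(3)[of "{}" "{}"] by simp
  let ?M = "{U :: 'a set. clopen U}"
  let ?f = "\<lambda>A. ennreal (m A)"
  interpret ring_of_sets UNIV ?M
    by (rule ring_of_setsI) (auto intro: clopen_Un clopen_Diff loc_const_disj loc_const_conj loc_const_not)
  have "\<exists>\<mu>. (\<forall>s\<in>?M. \<mu> s = ?f s) \<and> measure_space UNIV (sigma_sets UNIV ?M) \<mu>"
  proof (rule caratheodory_empty_continuous)
    show "positive ?M ?f" by (simp add: positive_def m0)
    show "additive ?M ?f" by (auto simp: additive_def m)
    fix A :: "nat \<Rightarrow> 'a set"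
    assume A: "range A \<subseteq> ?M" "decseq A" "(\<Inter>i. A i) = {}"
    have "open {x. x \<notin> A k}" for k
      using A(1) by (intro loc_const_imp_open loc_const_not) auto
    moreover have "\<exists>k. x \<notin> A k" for x using A(3) by blast
    ultimately obtain R where R: "\<And>x. \<exists>k\<le>R. x \<notin> A k"
      using compact_bound_family[OF compact_UNIV, of "\<lambda>k x. x \<notin> A k"] by metis
    have "A i = {}" if "i \<ge> R" for i
    proof -
      have "x \<notin> A i" for x
        using R[of x] decseqD[OF A(2)] that by (meson order_trans subsetD)
      then show ?thesis by blast
    qed
    then show "(\<lambda>i. ?f (A i)) \<longlonglongrightarrow> 0"
      by (intro tendsto_eventually eventually_sequentiallyI[of R]) (simp add: m0)
  qed simp
  then obtain \<nu> where \<nu>: "\<And>s. clopen s \<Longrightarrow> \<nu> s = ?f s" "measure_space UNIV (sigma_sets UNIV ?M) \<nu>" by auto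
  define \<mu> where "\<mu> = measure_of UNIV ?M \<nu>"
  have sets: "sets \<mu> = sets borel"
    by (simp add: \<mu>_def sigma_sets_clopen)
  then have space: "space \<mu> = UNIV" using sets_eq_imp_space_eq[OF sets] by simp
  have em: "emeasure \<mu> U = ?f U" if U: "clopen U" for U
  proof -
    have "sets \<mu> = sigma_sets UNIV ?M" by (simp add: \<mu>_def)
    then have "emeasure \<mu> U = \<nu> U"
      using \<nu>(2) U by (intro emeasure_measure_of[OF \<mu>_def]) (auto simp: measure_space_def)
    then show ?thesis using \<nu>(1)[OF U] by simp
  qed
  have "prob_space \<mu>"
    using em[of UNIV] by (intro prob_spaceI) (simp add: space m)
  have meas: "\<phi> \<in> measurable \<mu> borel"
    using borel_measurable_continuous_onI[OF cont_phi] measurable_cong_sets[OF sets refl] by blast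
  have "distr \<mu> borel \<phi> = \<mu>"
  proof (rule measure_eqI_generator_eq[where E = ?M and \<Omega> = UNIV and A = "\<lambda>_. UNIV"])
    show "Int_stable ?M" by (auto simp: Int_stable_def intro: loc_const_conj)
    show "emeasure (distr \<mu> borel \<phi>) X = emeasure \<mu> X" if "X \<in> ?M" for X
    proof -
      have X: "clopen X" using that by simp
      then have "X \<in> sets borel" by (simp add: clopen_iff)
      then have "emeasure (distr \<mu> borel \<phi>) X = emeasure \<mu> (\<phi> -` X)"
        using meas by (simp add: emeasure_distr space)
      also have "\<dots> = ?f X" using em[of "\<phi> -` X"] loc_const_phi[OF X] m(4) by simp
      finally show ?thesis using em[OF X] by simp
    qed
  qed (auto simp: sets sigma_sets_clopen emeasure_distr[OF meas] space em m)
  then show ?thesis using \<open>prob_space \<mu>\<close> sets unfolding invariant_prob_def by blast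
qed

definition mu :: "'a measure" where "mu = (SOME \<mu>. invariant_prob \<phi> \<mu>)"

lemma mu: "prob_space mu" "sets mu = sets borel" "distr mu borel \<phi> = mu"
proof -
  have "invariant_prob \<phi> mu"
    unfolding mu_def by (rule someI_ex[OF invariant_prob_exists])
  then show "prob_space mu" "sets mu = sets borel" "distr mu borel \<phi> = mu"
    unfolding invariant_prob_def by auto
qed

section \<open>Integrals of locally constant functions and additivity of the index\<close>

definition I :: "('a \<Rightarrow> int) \<Rightarrow> real" where "I f = (LINT x|mu. real_of_int (f x))"

lemma index_eq: "index_map \<phi> \<gamma> = I (c \<gamma>)"
  by (simp add: index_map_def I_def mu_def)

lemma meas_loc_const:
  fixes f :: "'a \<Rightarrow> int"
  assumes "loc_const f" shows "(\<lambda>x. real_of_int (f x)) \<in> borel_measurable mu"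
proof -
  have "continuous_on UNIV (\<lambda>x. real_of_int (f x))"
    unfolding continuous_on_def
  proof safe
    fix x
    have "\<forall>\<^sub>F y in at x. real_of_int (f y) = real_of_int (f x)"
      using loc_constD[OF assms, of x] by (auto simp: eventually_at_filter elim!: eventually_mono)
    then show "(\<lambda>x. real_of_int (f x)) \<midarrow>x\<rightarrow> real_of_int (f x)" by (rule tendsto_eventually)
  qed
  then show ?thesis
    using borel_measurable_continuous_onI measurable_cong_sets[OF mu(2) refl] by blast
qed

lemma integrable_loc_const:
  fixes f :: "'a \<Rightarrow> int"
  assumes "loc_const f" shows "integrable mu (\<lambda>x. real_of_int (f x))"
proof -
  interpret prob_space mu by (rule mu)
  obtain N where "\<And>x. \<bar>f x\<bar> \<le> N" using int_bound[OF assms] by blast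
  then have "norm (real_of_int (f x)) \<le> real_of_int N" for x
    by (simp flip: of_int_abs)
  then show ?thesis
    by (intro integrable_const_bound[of _ "real_of_int N"] meas_loc_const assms) auto
qed

lemma I_add: "loc_const f \<Longrightarrow> loc_const g \<Longrightarrow> I (\<lambda>x. f x + g x) = I f + I g"
  unfolding I_def using integrable_loc_const by simp

lemma I_minus: "I (\<lambda>x. - f x) = - I f"
  unfolding I_def by simp

lemma I_const: "I (\<lambda>x. k) = real_of_int k"
proof -
  interpret prob_space mu by (rule mu)
  show ?thesis unfolding I_def by (simp add: prob_space)
qed

lemma I_phi:
  assumes "loc_const f" shows "I (\<lambda>x. f (\<phi> x)) = I f"
proof -
  have "\<phi> \<in> measurable mu borel"
    using borel_measurable_continuous_onI[OF cont_phi] measurable_cong_sets[OF mu(2) refl] by blast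
  moreover have "(\<lambda>x. real_of_int (f x)) \<in> borel_measurable borel"
    using meas_loc_const[OF assms] measurable_cong_sets[OF mu(2) refl] by blast
  ultimately have "(LINT x|distr mu borel \<phi>. real_of_int (f x)) = (LINT x|mu. real_of_int (f (\<phi> x)))"
    by (rule integral_distr)
  then show ?thesis by (simp add: I_def mu)
qed

lemma I_cob:
  assumes "cob f" shows "I f = 0"
proof -
  obtain u where u: "loc_const u" "f = (\<lambda>x. u x - u (inv_into UNIV \<phi> x))"
    using assms[THEN cobD] by blast
  have lc: "loc_const (\<lambda>x. u (inv_into UNIV \<phi> x))" using loc_const_T[OF u(1), of "-1"] by (simp add: T_minus_1)
  have "I u = I (\<lambda>x. f x + u (inv_into UNIV \<phi> x))" using u by simp
  also have "\<dots> = I f + I (\<lambda>x. u (inv_into UNIV \<phi> x))"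
    using I_add[OF cob_loc_const[OF assms] lc] .
  also have "I (\<lambda>x. u (inv_into UNIV \<phi> x)) = I u"
    using I_phi[OF lc] by simp
  finally show ?thesis by simp
qed

lemma I_cong_cob:
  assumes "cob (\<lambda>x. f x - g x)" "loc_const g" shows "I f = I g"
  using I_add[OF cob_loc_const[OF assms(1)] assms(2)] I_cob[OF assms(1)] by simp

lemma index_comp:
  assumes "\<gamma> \<in> FG" "\<delta> \<in> FG" shows "index_map \<phi> (\<gamma> \<circ> \<delta>) = index_map \<phi> \<gamma> + index_map \<phi> \<delta>"
proof -
  have "c (\<gamma> \<circ> \<delta>) = (\<lambda>x. c \<gamma> (\<delta> x) + c \<delta> x)"
    using cocycle_comp[OF assms] by (rule ext)
  then have "I (c (\<gamma> \<circ> \<delta>)) = I (\<lambda>x. c \<gamma> (\<delta> x) + c \<delta> x)" by (rule arg_cong)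
  also have "\<dots> = I (\<lambda>x. c \<gamma> (\<delta> x)) + I (c \<delta>)"
    using assms by (intro I_add loc_const_cont[OF FG_cocycle(1) FG_cont] FG_cocycle(1))
  also have "I (\<lambda>x. c \<gamma> (\<delta> x)) = I (c \<gamma>)"
    using assms by (intro I_cong_cob cob_FG FG_cocycle(1))
  finally show ?thesis by (simp only: index_eq)
qed

lemma index_id: "index_map \<phi> id = 0"
  using index_comp[OF FG_id FG_id] by simp

subsection \<open>The index counts the crossings of a point of an orbit\<close>

text \<open>With \<open>k \<mapsto> T k z\<close> as coordinate, the orbit of \<open>z\<close> is a
  copy of the integers, and \<open>pos \<gamma> z\<close> is the permutation that \<gamma> induces
  on it.\<close>

definition pos :: "('a \<Rightarrow> 'a) \<Rightarrow> 'a \<Rightarrow> int \<Rightarrow> int" where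
  "pos \<gamma> z k = k + c \<gamma> (T k z)"

lemma pos: "\<gamma> \<in> FG \<Longrightarrow> \<gamma> (T k z) = T (pos \<gamma> z k) z"
  using FG_cocycle(2)[of \<gamma> "T k z"] by (simp add: pos_def T_add add.commute[of k])

lemma pos_eqI: "\<gamma> \<in> FG \<Longrightarrow> \<gamma> (T k z) = T j z \<Longrightarrow> pos \<gamma> z k = j"
  using pos[of \<gamma> k z] T_inj by metis

lemma pos_bij:
  assumes "\<gamma> \<in> FG" shows "bij (pos \<gamma> z)"
proof (rule bijI')
  show "pos \<gamma> z j = pos \<gamma> z k \<longleftrightarrow> j = k" for j k
    using pos[OF assms, of _ z] FG_bij[OF assms] T_inj by (metis bij_def inj_eq)
  fix j
  have "\<gamma> (T (pos (inv_into UNIV \<gamma>) z j) z) = T j z"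
    using pos[OF FG_inv[OF assms], of j z] FG_bij[OF assms] by (metis bij_inv_eq_iff)
  then show "\<exists>k. j = pos \<gamma> z k" using pos_eqI[OF assms] by metis
qed

text \<open>A change of base point conjugates the permutation by a translation.\<close>

lemma pos_shift: "pos \<gamma> (T i z) k = pos \<gamma> z (k + i) - i"
  by (simp add: pos_def flip: T_add)

lemma loc_const_pos: "\<gamma> \<in> FG \<Longrightarrow> loc_const (\<lambda>z. pos \<gamma> z k)"
  unfolding pos_def by (rule loc_const_add[OF loc_const_const loc_const_T[OF FG_cocycle(1)]])

lemma pos_comp: "\<gamma> \<in> FG \<Longrightarrow> \<delta> \<in> FG \<Longrightarrow> pos (\<gamma> \<circ> \<delta>) z k = pos \<gamma> z (pos \<delta> z k)"
  by (rule pos_eqI[OF FG_comp]) (auto simp: pos)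

lemma pos_inv:
  assumes "\<gamma> \<in> FG" shows "pos (inv_into UNIV \<gamma>) z (pos \<gamma> z k) = k"
  using pos_comp[OF FG_inv[OF assms] assms] pos_eqI[OF FG_id, of k z k] FG_bij[OF assms]
  by (simp add: bij_is_inj)

lemma pos_bound:
  assumes "\<gamma> \<in> FG"
  obtains N where "N > 0" "\<And>z k. \<bar>pos \<gamma> z k - k\<bar> \<le> N"
proof -
  obtain N where N: "N > 0" "\<And>x. \<bar>c \<gamma> x\<bar> \<le> N"
    using int_bound[OF FG_cocycle(1)[OF assms]] by blast
  then show thesis using that[of N] by (simp add: pos_def)
qed

text \<open>The crossings from the forward to the backward half of the orbit. The cut lies between
  \<open>0\<close> and \<open>1\<close>, as in \<open>full_group_at\<close>.\<close>

definition down :: "('a \<Rightarrow> 'a) \<Rightarrow> 'a \<Rightarrow> int set" where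
  "down \<gamma> z = {k. k \<ge> 1 \<and> pos \<gamma> z k \<le> 0}"

definition up :: "('a \<Rightarrow> 'a) \<Rightarrow> 'a \<Rightarrow> int set" where
  "up \<gamma> z = {k. k \<le> 0 \<and> pos \<gamma> z k \<ge> 1}"

lemma finite_down_up:
  assumes "\<gamma> \<in> FG" shows "finite (down \<gamma> z)" "finite (up \<gamma> z)"
proof -
  obtain N where N: "N > 0" "\<And>z k. \<bar>pos \<gamma> z k - k\<bar> \<le> N" using pos_bound[OF assms] by blast
  have "down \<gamma> z \<subseteq> {1..N}" "up \<gamma> z \<subseteq> {-N..0}"
    unfolding down_def up_def using N(2)[of z] by (auto simp: abs_le_iff) (smt (verit))+
  then show "finite (down \<gamma> z)" "finite (up \<gamma> z)" using finite_subset by blast+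
qed

text \<open>The summand is \<open>1\<close> on \<open>down\<close>, \<open>-1\<close> on
  \<open>up\<close> and \<open>0\<close> elsewhere. Unlike the two cardinalities, a sum over a fixed
  window can be shifted and compared term by term.\<close>

lemma count_eq_sum:
  assumes "\<And>k. \<bar>pos \<gamma> z k - k\<bar> \<le> N"
  shows "int (card (down \<gamma> z)) - int (card (up \<gamma> z))
    = (\<Sum>k\<in>{-N..N}. of_bool (k \<ge> 1) - of_bool (pos \<gamma> z k \<ge> 1))"
proof -
  have d: "down \<gamma> z = {-N..N} \<inter> {k. k \<ge> 1 \<and> pos \<gamma> z k \<le> 0}"
    and u: "up \<gamma> z = {-N..N} \<inter> {k. k \<le> 0 \<and> pos \<gamma> z k \<ge> 1}"
    unfolding down_def up_def using assms by (auto simp: abs_le_iff) (smt (verit))+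
  have "int (card (down \<gamma> z)) - int (card (up \<gamma> z)) =
    (\<Sum>k\<in>{-N..N}. of_bool (k \<ge> 1 \<and> pos \<gamma> z k \<le> 0) - of_bool (k \<le> 0 \<and> pos \<gamma> z k \<ge> 1))"
    unfolding d u by (simp add: sum_subtractf)
  also have "\<dots> = (\<Sum>k\<in>{-N..N}. of_bool (k \<ge> 1) - of_bool (pos \<gamma> z k \<ge> 1))"
    by (intro sum.cong) auto
  finally show ?thesis .
qed

text \<open>Passing to \<open>\<phi> z\<close> moves the cut one step, between \<open>1\<close> and
  \<open>2\<close>. The sum is affected only through the source \<open>1\<close> and the one point
  \<open>k0\<close> that is sent to \<open>1\<close>, with opposite signs.\<close>

lemma count_invariant:
  assumes "\<gamma> \<in> FG"
  shows "int (card (down \<gamma> (\<phi> z))) - int (card (up \<gamma> (\<phi> z))) = int (card (down \<gamma> z)) - int (card (up \<gamma> z))"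
proof -
  obtain N where N: "N > 0" "\<And>z k. \<bar>pos \<gamma> z k - k\<bar> \<le> N" using pos_bound[OF assms] by blast
  obtain k0 where k0: "pos \<gamma> z k0 = 1" "\<And>k. pos \<gamma> z k = 1 \<longleftrightarrow> k = k0"
    using pos_bij[OF assms, of z] by (metis bij_pointE)
  have kN: "k0 \<in> {-N-1..N+1}" using N(2)[of z k0] k0(1) by (auto simp: abs_le_iff)
  \<comment> \<open>The window \<open>N+2\<close> leaves a margin: after the shift its two topmost
    terms vanish, and the remaining window \<open>N+1\<close> still contains
    \<open>k0\<close>.\<close>
  have "int (card (down \<gamma> (\<phi> z))) - int (card (up \<gamma> (\<phi> z)))
      = (\<Sum>k\<in>{-(N+2)..N+2}. of_bool (k \<ge> 1) - of_bool (pos \<gamma> (\<phi> z) k \<ge> 1))"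
    using N(2)[of "\<phi> z"] by (intro count_eq_sum) (smt (verit))
  also have "\<dots> = (\<Sum>k\<in>{-(N+2)..N+2}. of_bool (k + 1 \<ge> 2) - of_bool (pos \<gamma> z (k + 1) \<ge> 2))"
    using pos_shift[of \<gamma> 1 z] by (intro sum.cong) auto
  also have "\<dots> = (\<Sum>k\<in>{-(N+1)..N+3}. of_bool (k \<ge> 2) - of_bool (pos \<gamma> z k \<ge> 2))"
    by (rule sum.reindex_bij_witness[of _ "\<lambda>k. k - 1" "\<lambda>k. k + 1"]) auto
  also have "\<dots> = (\<Sum>k\<in>{-(N+1)..N+1}. of_bool (k \<ge> 2) - of_bool (pos \<gamma> z k \<ge> 2))"
  proof (rule sum.mono_neutral_right)
    show "\<forall>k\<in>{-(N+1)..N+3} - {-(N+1)..N+1}. of_bool (k \<ge> 2) - of_bool (pos \<gamma> z k \<ge> 2) = (0::int)"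
    proof
      fix k assume "k \<in> {-(N+1)..N+3} - {-(N+1)..N+1}"
      then have "k \<ge> N + 2" by auto
      moreover have "pos \<gamma> z k \<ge> 2" using N(2)[of z k] calculation by linarith
      ultimately show "of_bool (k \<ge> 2) - of_bool (pos \<gamma> z k \<ge> 2) = (0::int)" using N(1) by simp
    qed
  qed auto
  also have "\<dots> = (\<Sum>k\<in>{-(N+1)..N+1}. of_bool (k \<ge> 1) - of_bool (pos \<gamma> z k \<ge> 1))"
  proof -
    have "(\<Sum>k\<in>{-(N+1)..N+1}. of_bool (k \<ge> 1) - of_bool (pos \<gamma> z k \<ge> 1)) -
        (\<Sum>k\<in>{-(N+1)..N+1}. of_bool (k \<ge> 2) - of_bool (pos \<gamma> z k \<ge> 2))
        = (\<Sum>k\<in>{-(N+1)..N+1}. of_bool (k = 1) - of_bool (k = k0) :: int)"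
      unfolding sum_subtractf[symmetric] using k0
      by (intro sum.cong) (auto simp flip: k0(2))
    also have "\<dots> = 0"
      using kN N(1) by (simp add: sum_subtractf of_bool_def)
    finally show ?thesis by simp
  qed
  also have "\<dots> = int (card (down \<gamma> z)) - int (card (up \<gamma> z))"
    using N(2)[of z] by (intro count_eq_sum[symmetric]) (smt (verit))
  finally show ?thesis .
qed

text \<open>The signed count of crossings and the negated cocycle are sums of the same functions
  \<open>a k\<close> and \<open>b k\<close>, evaluated at \<open>T k x\<close> in the first case and
  at \<open>x\<close> in the second. They differ by a coboundary, so they have equal integrals, and
  the count is a constant by minimality. In particular the index is an integer.\<close>

theorem index_eq_count:
  assumes "\<gamma> \<in> FG"
  shows "index_map \<phi> \<gamma> = real (card (up \<gamma> z)) - real (card (down \<gamma> z))"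
proof -
  obtain N where N: "N > 0" "\<And>x. \<bar>c \<gamma> x\<bar> \<le> N"
    using int_bound[OF FG_cocycle(1)[OF assms]] by blast
  define cnt where "cnt = (\<lambda>z. int (card (down \<gamma> z)) - int (card (up \<gamma> z)))"
  define a where "a = (\<lambda>k x. of_bool (c \<gamma> x \<le> - k) :: int)"
  define b where "b = (\<lambda>k x. of_bool (c \<gamma> x \<ge> 1 - k) :: int)"
  have lc: "loc_const (a k)" "loc_const (b k)" for k
    unfolding a_def b_def by (intro loc_const_intros FG_cocycle assms)+
  have cnt: "cnt x = (\<Sum>k\<in>{1..N}. a k (T k x)) - (\<Sum>k\<in>{-N..0}. b k (T k x))" for x
  proof -
    have "down \<gamma> x = {1..N} \<inter> {k. c \<gamma> (T k x) \<le> - k}" "up \<gamma> x = {-N..0} \<inter> {k. c \<gamma> (T k x) \<ge> 1 - k}"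
      unfolding down_def up_def pos_def using N(2) by (auto simp: abs_le_iff) (smt (verit))+
    then show ?thesis unfolding cnt_def a_def b_def by simp
  qed
  \<comment> \<open>At most one of the two sums is nonzero; it counts the cuts passed by a jump of
    length \<open>\<bar>c \<gamma> x\<bar>\<close>.\<close>
  have cc: "- c \<gamma> x = (\<Sum>k\<in>{1..N}. a k x) - (\<Sum>k\<in>{-N..0}. b k x)" for x
  proof -
    have "{1..N} \<inter> {k. c \<gamma> x \<le> - k} = {1..- c \<gamma> x}" "{-N..0} \<inter> {k. c \<gamma> x \<ge> 1 - k} = {1 - c \<gamma> x..0}"
      using N(2)[of x] by (auto simp: abs_le_iff)
    then show ?thesis unfolding a_def b_def by simp
  qed
  have "cob (\<lambda>x. (\<Sum>k\<in>{1..N}. a k (T k x) - a k x) - (\<Sum>k\<in>{-N..0}. b k (T k x) - b k x))"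
    by (intro cob_diff cob_sum cob_T lc) auto
  moreover have "(\<Sum>k\<in>{1..N}. a k (T k x) - a k x) - (\<Sum>k\<in>{-N..0}. b k (T k x) - b k x) = cnt x - (- c \<gamma> x)" for x
    unfolding cnt cc sum_subtractf by simp
  ultimately have "cob (\<lambda>x. cnt x - (- c \<gamma> x))" by simp
  then have "I cnt = I (\<lambda>x. - c \<gamma> x)"
    by (rule I_cong_cob) (intro loc_const_minus FG_cocycle assms)
  moreover have "cnt = (\<lambda>x. cnt z)"
  proof
    have "loc_const cnt" unfolding cnt[abs_def]
      by (intro loc_const_diff loc_const_sum loc_const_T[OF lc(1)] loc_const_T[OF lc(2)]) auto
    then show "cnt x = cnt z" for x
      using invariant_loc_const[of cnt] count_invariant[OF assms] unfolding cnt_def by blast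
  qed
  ultimately have "- I (c \<gamma>) = real_of_int (cnt z)"
    using I_const[of "cnt z"] by (metis I_minus)
  then have "- index_map \<phi> \<gamma> = real_of_int (cnt z)" by (simp only: index_eq)
  then show ?thesis by (simp add: cnt_def)
qed

subsection \<open>The group \<open>K\<^sup>0\<close> modulo 2\<close>

lemma CXZ_carrier: "f \<in> carrier CXZ \<longleftrightarrow> loc_const f"
  by (simp add: CXZ_def loc_const_iff_continuous_on)

lemma CXZ_comm_group: "comm_group (CXZ :: ('a \<Rightarrow> int) monoid)"
proof (rule comm_groupI)
  fix f :: "'a \<Rightarrow> int" assume "f \<in> carrier CXZ"
  then show "\<exists>g\<in>carrier CXZ. g \<otimes>\<^bsub>CXZ\<^esub> f = \<one>\<^bsub>CXZ\<^esub>"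
    unfolding CXZ_carrier Bex_def
    by (intro exI[of _ "\<lambda>x. - f x"]) (simp add: CXZ_carrier loc_const_minus, simp add: CXZ_def)
next
  fix f g :: "'a \<Rightarrow> int" assume "f \<in> carrier CXZ" "g \<in> carrier CXZ"
  then show "f \<otimes>\<^bsub>CXZ\<^esub> g \<in> carrier CXZ"
    unfolding CXZ_carrier by (simp add: CXZ_def loc_const_add)
next
  show "\<one>\<^bsub>CXZ\<^esub> \<in> carrier (CXZ :: ('a \<Rightarrow> int) monoid)"
    unfolding CXZ_carrier by (simp add: CXZ_def)
qed (auto simp: CXZ_def add.assoc add.commute)

lemma CXZ_inv:
  fixes f :: "'a \<Rightarrow> int"
  assumes "loc_const f" shows "inv\<^bsub>CXZ\<^esub> f = (\<lambda>x. - f x)"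
proof -
  interpret comm_group "CXZ :: ('a \<Rightarrow> int) monoid" by (rule CXZ_comm_group)
  show ?thesis
  proof (rule inv_equality)
    show "(\<lambda>x. - f x) \<otimes>\<^bsub>CXZ\<^esub> f = \<one>\<^bsub>CXZ\<^esub>" by (simp add: CXZ_def)
  qed (simp_all add: CXZ_carrier loc_const_minus assms)
qed

lemma subgroup_cob: "subgroup (coboundaries \<phi>) CXZ"
proof -
  interpret comm_group "CXZ :: ('a \<Rightarrow> int) monoid" by (rule CXZ_comm_group)
  show ?thesis
  proof (rule subgroupI)
    show "coboundaries \<phi> \<subseteq> carrier CXZ" using cob_loc_const CXZ_carrier by blast
    show "coboundaries \<phi> \<noteq> {}" using cob_0 by blast
    show "inv\<^bsub>CXZ\<^esub> f \<in> coboundaries \<phi>" if "cob f" for f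
      using cob_minus[OF that] CXZ_inv[OF cob_loc_const[OF that]] by simp
    show "f \<otimes>\<^bsub>CXZ\<^esub> g \<in> coboundaries \<phi>" if "cob f" "cob g" for f g
      using cob_add[OF that] by (simp add: CXZ_def)
  qed
qed

lemma K0_comm_group: "comm_group (K0 \<phi>)"
  unfolding K0_def by (rule comm_group.abelian_FactGroup[OF CXZ_comm_group subgroup_cob])

lemma normal_cob: "coboundaries \<phi> \<lhd> CXZ"
  using comm_group.normal_iff_subgroup[OF CXZ_comm_group] subgroup_cob by blast

lemma K0_class_hom: "K0_class \<phi> \<in> hom CXZ (K0 \<phi>)"
  using normal.r_coset_hom_Mod[OF normal_cob] unfolding K0_def K0_class_def[abs_def] .

lemma K0_class_carrier: "loc_const f \<Longrightarrow> K0_class \<phi> f \<in> carrier (K0 \<phi>)"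
  using hom_in_carrier[OF K0_class_hom] CXZ_carrier by blast

lemma K0_class_add:
  assumes "loc_const f" "loc_const g"
  shows "K0_class \<phi> (\<lambda>x. f x + g x) = K0_class \<phi> f \<otimes>\<^bsub>K0 \<phi>\<^esub> K0_class \<phi> g"
  using hom_mult[OF K0_class_hom, of f g] assms by (simp add: CXZ_carrier) (simp add: CXZ_def)

lemma K0_class_surj:
  assumes "C \<in> carrier (K0 \<phi>)" obtains f where "loc_const f" "C = K0_class \<phi> f"
  using assms unfolding K0_def K0_class_def FactGroup_def RCOSETS_def by (auto simp: CXZ_carrier)

lemma K0_class_eqD:
  assumes "loc_const f" "loc_const g" "K0_class \<phi> f = K0_class \<phi> g" shows "cob (\<lambda>x. f x - g x)"
proof -
  interpret comm_group "CXZ :: ('a \<Rightarrow> int) monoid" by (rule CXZ_comm_group)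
  have "f \<in> coboundaries \<phi> #>\<^bsub>CXZ\<^esub> g"
    using assms rcos_self[OF _ subgroup_cob, of f] by (simp add: K0_class_def CXZ_carrier)
  then show ?thesis by (auto simp: r_coset_def CXZ_def)
qed

lemma K0_class_cob:
  assumes "cob f" shows "K0_class \<phi> f = \<one>\<^bsub>K0 \<phi>\<^esub>"
proof -
  interpret comm_group "CXZ :: ('a \<Rightarrow> int) monoid" by (rule CXZ_comm_group)
  show ?thesis
    using coset_join2[OF _ subgroup_cob assms] cob_loc_const[OF assms]
    by (simp add: K0_class_def K0_def FactGroup_def CXZ_carrier)
qed

lemma subgroup_twoK0: "subgroup (twoK0 \<phi>) (K0 \<phi>)"
proof -
  interpret comm_group "K0 \<phi>" by (rule K0_comm_group)
  show ?thesis
  proof (rule subgroupI)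
    show "twoK0 \<phi> \<subseteq> carrier (K0 \<phi>)" by (auto simp: twoK0_def)
    show "twoK0 \<phi> \<noteq> {}" using one_closed by (auto simp: twoK0_def)
    show "inv\<^bsub>K0 \<phi>\<^esub> a \<in> twoK0 \<phi>" if "a \<in> twoK0 \<phi>" for a
      using that by (auto simp: twoK0_def inv_mult_group)
    show "a \<otimes>\<^bsub>K0 \<phi>\<^esub> b \<in> twoK0 \<phi>" if ab: "a \<in> twoK0 \<phi>" "b \<in> twoK0 \<phi>" for a b
    proof -
      obtain u v where uv: "u \<in> carrier (K0 \<phi>)" "a = u \<otimes>\<^bsub>K0 \<phi>\<^esub> u" "v \<in> carrier (K0 \<phi>)" "b = v \<otimes>\<^bsub>K0 \<phi>\<^esub> v"
        using ab by (auto simp: twoK0_def)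
      then have "a \<otimes>\<^bsub>K0 \<phi>\<^esub> b = (u \<otimes>\<^bsub>K0 \<phi>\<^esub> v) \<otimes>\<^bsub>K0 \<phi>\<^esub> (u \<otimes>\<^bsub>K0 \<phi>\<^esub> v)"
        by (simp add: m_ac)
      then show ?thesis using uv by (auto simp: twoK0_def)
    qed
  qed
qed

abbreviation K :: "('a \<Rightarrow> int) set set monoid" where "K \<equiv> K0_mod2 \<phi>"

lemma K_comm_group: "comm_group K"
  unfolding K0_mod2_def by (rule comm_group.abelian_FactGroup[OF K0_comm_group subgroup_twoK0])

definition Q :: "('a \<Rightarrow> int) \<Rightarrow> ('a \<Rightarrow> int) set set" where
  "Q f = twoK0 \<phi> #>\<^bsub>K0 \<phi>\<^esub> K0_class \<phi> f"

lemma normal_twoK0: "twoK0 \<phi> \<lhd> K0 \<phi>"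
  using comm_group.normal_iff_subgroup[OF K0_comm_group] subgroup_twoK0 by blast

lemma Q_carrier: "loc_const f \<Longrightarrow> Q f \<in> carrier K"
  using hom_in_carrier[OF normal.r_coset_hom_Mod[OF normal_twoK0] K0_class_carrier]
  unfolding Q_def K0_mod2_def by blast

lemma Q_add:
  assumes "loc_const f" "loc_const g"
  shows "Q (\<lambda>x. f x + g x) = Q f \<otimes>\<^bsub>K\<^esub> Q g"
  using hom_mult[OF normal.r_coset_hom_Mod[OF normal_twoK0] K0_class_carrier K0_class_carrier, of f g] assms
  by (simp add: Q_def K0_mod2_def K0_class_add)

lemma Q_surj:
  assumes "C \<in> carrier K" obtains f where "loc_const f" "C = Q f"
proof -
  obtain d where d: "d \<in> carrier (K0 \<phi>)" "C = twoK0 \<phi> #>\<^bsub>K0 \<phi>\<^esub> d"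
    using assms unfolding K0_mod2_def FactGroup_def RCOSETS_def by auto
  then show thesis using that K0_class_surj[OF d(1)] unfolding Q_def by metis
qed

text \<open>For locally constant \<open>f\<close> this is \<open>Q f = \<one>\<close>, expressed
  with functions instead of cosets of cosets.\<close>

definition triv :: "('a \<Rightarrow> int) \<Rightarrow> bool" where
  "triv f \<longleftrightarrow> (\<exists>h. loc_const h \<and> cob (\<lambda>x. f x - 2 * h x))"

lemma Q_one_iff:
  assumes f: "loc_const f" shows "Q f = \<one>\<^bsub>K\<^esub> \<longleftrightarrow> triv f"
proof -
  interpret comm_group "K0 \<phi>" by (rule K0_comm_group)
  have dbl: "K0_class \<phi> (\<lambda>x. 2 * h x) = K0_class \<phi> h \<otimes>\<^bsub>K0 \<phi>\<^esub> K0_class \<phi> h" if "loc_const h" for h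
    using K0_class_add[OF that that] by simp
  have one: "\<one>\<^bsub>K\<^esub> = twoK0 \<phi>" by (simp add: K0_mod2_def FactGroup_def)
  have "Q f = \<one>\<^bsub>K\<^esub> \<longleftrightarrow> K0_class \<phi> f \<in> twoK0 \<phi>"
    unfolding one Q_def
    using coset_join1[OF _ K0_class_carrier[OF f] subgroup_twoK0] coset_join2[OF K0_class_carrier[OF f] subgroup_twoK0]
    by blast
  also have "\<dots> \<longleftrightarrow> triv f"
  proof
    assume "K0_class \<phi> f \<in> twoK0 \<phi>"
    then obtain d where d: "d \<in> carrier (K0 \<phi>)" "K0_class \<phi> f = d \<otimes>\<^bsub>K0 \<phi>\<^esub> d" by (auto simp: twoK0_def)
    obtain h where h: "loc_const h" "d = K0_class \<phi> h" using K0_class_surj[OF d(1)] by blast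
    have "loc_const (\<lambda>x. 2 * h x)" using h(1) by (rule loc_const_comp)
    then show "triv f"
      using K0_class_eqD[OF f _ ] d(2) h dbl unfolding triv_def by metis
  next
    assume "triv f"
    then obtain h where h: "loc_const h" "cob (\<lambda>x. f x - 2 * h x)" unfolding triv_def by blast
    have h2: "loc_const (\<lambda>x. 2 * h x)" using h(1) by (rule loc_const_comp)
    have "K0_class \<phi> f = K0_class \<phi> (\<lambda>x. (f x - 2 * h x) + 2 * h x)" by simp
    also have "\<dots> = \<one>\<^bsub>K0 \<phi>\<^esub> \<otimes>\<^bsub>K0 \<phi>\<^esub> K0_class \<phi> (\<lambda>x. 2 * h x)"
      using K0_class_add[OF cob_loc_const[OF h(2)] h2] K0_class_cob[OF h(2)] by simp
    also have "\<dots> = K0_class \<phi> h \<otimes>\<^bsub>K0 \<phi>\<^esub> K0_class \<phi> h"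
      using h K0_class_carrier by (simp add: dbl)
    finally show "K0_class \<phi> f \<in> twoK0 \<phi>" using K0_class_carrier[OF h(1)] by (auto simp: twoK0_def)
  qed
  finally show ?thesis .
qed

lemma triv_cob: "cob f \<Longrightarrow> triv f"
  unfolding triv_def by (intro exI[of _ "\<lambda>x. 0"]) simp

lemma triv_even:
  assumes "loc_const f" "\<And>x. even (f x)" shows "triv f"
  unfolding triv_def
proof (intro exI conjI)
  show "loc_const (\<lambda>x. f x div 2)" using assms(1) by (rule loc_const_comp)
  show "cob (\<lambda>x. f x - 2 * (f x div 2))" using assms(2) by (simp add: cob_0)
qed

lemma triv_add: assumes "triv f" "triv g" shows "triv (\<lambda>x. f x + g x)"
proof -
  obtain h k where "loc_const h" "cob (\<lambda>x. f x - 2 * h x)" "loc_const k" "cob (\<lambda>x. g x - 2 * k x)"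
    using assms unfolding triv_def by blast
  then show ?thesis
    using cob_add[of "\<lambda>x. f x - 2 * h x" "\<lambda>x. g x - 2 * k x"] unfolding triv_def
    by (intro exI[of _ "\<lambda>x. h x + k x"]) (simp add: loc_const_add algebra_simps)
qed

lemma Q_eqI:
  assumes "loc_const f" "loc_const g" "triv (\<lambda>x. f x - g x)" shows "Q f = Q g"
proof -
  interpret comm_group K by (rule K_comm_group)
  have "Q f = Q (\<lambda>x. (f x - g x) + g x)" by simp
  also have "\<dots> = Q (\<lambda>x. f x - g x) \<otimes>\<^bsub>K\<^esub> Q g"
    using assms by (intro Q_add loc_const_diff)
  also have "Q (\<lambda>x. f x - g x) = \<one>\<^bsub>K\<^esub>"
    using assms by (subst Q_one_iff) (auto intro: loc_const_diff)
  finally show ?thesis using Q_carrier[OF assms(2)] by simp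
qed

subsection \<open>The parity of the number of inversions\<close>

text \<open>Each inverted pair of points of an orbit is recorded at the earlier of the two.\<close>

definition invs :: "('a \<Rightarrow> 'a) \<Rightarrow> 'a \<Rightarrow> int set" where
  "invs \<gamma> z = {k. k > 0 \<and> pos \<gamma> z k < pos \<gamma> z 0}"

definition ninv :: "('a \<Rightarrow> 'a) \<Rightarrow> 'a \<Rightarrow> int" where
  "ninv \<gamma> z = int (card (invs \<gamma> z))"

lemma finite_invs:
  assumes "\<gamma> \<in> FG" shows "finite (invs \<gamma> z)"
proof -
  obtain N where N: "N > 0" "\<And>z k. \<bar>pos \<gamma> z k - k\<bar> \<le> N" using pos_bound[OF assms] by blast
  have "k \<le> 2 * N" if "k \<in> invs \<gamma> z" for k
    using that N(2)[of z k] N(2)[of z 0] unfolding invs_def by auto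
  then have "invs \<gamma> z \<subseteq> {0..2*N}" unfolding invs_def by auto
  then show ?thesis by (rule finite_subset) simp
qed

lemma loc_const_ninv:
  assumes "\<gamma> \<in> FG" shows "loc_const (ninv \<gamma>)"
proof -
  obtain N where N: "N > 0" "\<And>z k. \<bar>pos \<gamma> z k - k\<bar> \<le> N" using pos_bound[OF assms] by blast
  have "invs \<gamma> z = {k \<in> {1..2*N}. pos \<gamma> z k < pos \<gamma> z 0}" for z
  proof -
    have "k \<le> 2 * N" if "k \<in> invs \<gamma> z" for k
      using that N(2)[of z k] N(2)[of z 0] unfolding invs_def by auto
    then show ?thesis unfolding invs_def by auto
  qed
  then have *: "ninv \<gamma> = (\<lambda>z. int (card {k \<in> {1..2*N}. pos \<gamma> z k < pos \<gamma> z 0}))"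
    unfolding ninv_def by auto
  show ?thesis unfolding *
    by (intro loc_const_comp[of _ "\<lambda>A. int (card A)"] loc_const_Collect loc_const_less loc_const_pos assms) auto
qed

text \<open>An inverted pair of points of an orbit can be charged to either of its two points, as long as
  this is done in a locally constant way: the two functions of the charges differ by a coboundary.
  The pairs inverted by \<open>\<gamma> \<circ> \<delta>\<close> are the symmetric difference of those inverted by \<open>\<delta>\<close> and of the
  preimages of those inverted by \<open>\<gamma>\<close>; the latter are charged, through \<open>\<delta>\<close>, to the other point
  when \<open>\<delta>\<close> inverts them.\<close>

theorem ninv_comp:
  assumes \<gamma>: "\<gamma> \<in> FG" and \<delta>: "\<delta> \<in> FG"
  shows "triv (\<lambda>z. ninv (\<gamma> \<circ> \<delta>) z - (ninv \<gamma> z + ninv \<delta> z))"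
proof -
  define \<delta>' where "\<delta>' = inv_into UNIV \<delta>"
  have \<delta>': "\<delta>' \<in> FG" using FG_inv[OF \<delta>] by (simp add: \<delta>'_def)
  obtain N where N: "N > 0" "\<And>z k. \<bar>pos \<gamma> z k - k\<bar> \<le> N" using pos_bound[OF \<gamma>] by blast
  \<comment> \<open>The pair of \<open>w\<close> and \<open>T j w\<close> is inverted by \<gamma>;
    the form is symmetric, so that \<open>j\<close> may have either sign.\<close>
  define J where "J = (\<lambda>w j. j \<noteq> 0 \<and> (pos \<gamma> w j < pos \<gamma> w 0) \<noteq> (j < 0))"
  \<comment> \<open>The preimage of \<open>w\<close> under \<delta> comes before that of
    \<open>T j w\<close>. Such a pair is charged to \<open>w\<close>, and \<open>H\<close> adds up
    these charges.\<close>
  define a where "a = (\<lambda>w j. pos \<delta>' w j > pos \<delta>' w 0)"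
  define H where "H = (\<lambda>w. int (card {j. J w j \<and> a w j}))"
  define M where "M = 2 * N"
  have JM: "\<bar>j\<bar> \<le> M \<and> j \<noteq> 0" if "J w j" for w j
    using that N(2)[of w j] N(2)[of w 0] unfolding J_def M_def by auto
  have lcJ: "loc_const (\<lambda>w. J w j)" and lca: "loc_const (\<lambda>w. a w j)" for j
    unfolding J_def a_def by (intro loc_const_intros loc_const_pos \<gamma> \<delta>')+
  have symJ: "J w (- j) \<longleftrightarrow> J (T (- j) w) j" for w j
  proof (cases "j = 0")
    case False
    then have "pos \<gamma> w (- j) \<noteq> pos \<gamma> w 0" using pos_bij[OF \<gamma>, of w] by (simp add: bij_def inj_eq)
    then show ?thesis using False pos_shift[of \<gamma> "- j" w 0] pos_shift[of \<gamma> "- j" w j]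
      by (auto simp: J_def)
  qed (simp add: J_def)
  have syma: "a w (- j) \<longleftrightarrow> \<not> a (T (- j) w) j" if "j \<noteq> 0" for w j
  proof -
    have "pos \<delta>' w (- j) \<noteq> pos \<delta>' w 0" using that pos_bij[OF \<delta>', of w] by (simp add: bij_def inj_eq)
    then show ?thesis using pos_shift[of \<delta>' "- j" w 0] pos_shift[of \<delta>' "- j" w j] by (auto simp: a_def)
  qed
  \<comment> \<open>For positive \<open>j\<close> these are the pairs on which the two ways of
    charging disagree: \<open>ninv\<close> charges the earlier point \<open>w\<close>, while
    \<open>H\<close> charges the later point \<open>T j w\<close>. This shift by \<open>T j\<close>
    is the source of the coboundary.\<close>
  define u where "u = (\<lambda>j w. of_bool (J w j \<and> \<not> a w j) :: int)"
  have lcu: "loc_const (u j)" for j unfolding u_def by (intro loc_const_intros lcJ lca)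
  have H_sum: "H w = (\<Sum>j\<in>{1..M}. of_bool (J w j \<and> a w j)) + (\<Sum>j\<in>{1..M}. u j (T (- j) w))" for w
  proof -
    have "{j. J w j \<and> a w j} = {1..M} \<inter> {j. J w j \<and> a w j} \<union> {-M..-1} \<inter> {j. J w j \<and> a w j}"
    proof -
      have "j \<in> {1..M} \<union> {-M..-1}" if "J w j" for j using JM[OF that] by auto
      then show ?thesis by blast
    qed
    then have "H w = int (card ({1..M} \<inter> {j. J w j \<and> a w j})) + int (card ({-M..-1} \<inter> {j. J w j \<and> a w j}))"
      unfolding H_def by (subst card_Un_disjoint[symmetric, THEN arg_cong[of _ _ int], unfolded of_nat_add]) auto
    also have "\<dots> = (\<Sum>j\<in>{1..M}. of_bool (J w j \<and> a w j)) + (\<Sum>j\<in>{-M..-1}. of_bool (J w j \<and> a w j))"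
      by simp
    also have "(\<Sum>j\<in>{-M..-1}. of_bool (J w j \<and> a w j)) = (\<Sum>j\<in>{1..M}. u j (T (- j) w))"
    proof (rule sum.reindex_bij_witness[of _ uminus uminus])
      fix j assume "j \<in> {-M..-1}"
      then show "u (- j) (T (- (- j)) w) = of_bool (J w j \<and> a w j)"
        using symJ[of w "- j"] syma[of "- j" w] by (simp add: u_def)
    qed auto
    finally show ?thesis .
  qed
  have ninv_sum: "ninv \<gamma> w = (\<Sum>j\<in>{1..M}. of_bool (J w j \<and> a w j)) + (\<Sum>j\<in>{1..M}. u j w)" for w
  proof -
    have "invs \<gamma> w = {1..M} \<inter> {j. J w j}"
      using JM[of w] unfolding invs_def J_def by (auto simp: abs_le_iff)
    then have "ninv \<gamma> w = (\<Sum>j\<in>{1..M}. of_bool (J w j))" by (simp add: ninv_def)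
    also have "\<dots> = (\<Sum>j\<in>{1..M}. of_bool (J w j \<and> a w j) + u j w)"
      by (intro sum.cong) (auto simp: u_def)
    finally show ?thesis by (simp only: sum.distrib)
  qed
  have lcH: "loc_const H"
  proof -
    have "loc_const (\<lambda>w. u j (T (- j) w))" for j by (rule loc_const_T[OF lcu])
    then have "loc_const (\<lambda>w. (\<Sum>j\<in>{1..M}. of_bool (J w j \<and> a w j)) + (\<Sum>j\<in>{1..M}. u j (T (- j) w)))"
      by (intro loc_const_add loc_const_sum loc_const_of_bool loc_const_conj lcJ lca) auto
    then show ?thesis unfolding H_sum[abs_def] .
  qed
  have "cob (\<lambda>w. \<Sum>j\<in>{1..M}. u j (T (- j) w) - u j w)"
    by (intro cob_sum cob_T lcu) auto
  then have cob1: "cob (\<lambda>w. H w - ninv \<gamma> w)"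
    by (simp add: H_sum ninv_sum sum_subtractf)
  have parity: "even (ninv (\<gamma> \<circ> \<delta>) z - (H (\<delta> z) + ninv \<delta> z))" for z
  proof -
    define i where "i = pos \<delta> z 0"
    define S where "S = {k. k > 0 \<and> J (\<delta> z) (pos \<delta> z k - i)}"
    have w: "\<delta> z = T i z" using pos[OF \<delta>, of 0 z] by (simp add: i_def)
    have inj\<delta>: "pos \<delta> z k = pos \<delta> z l \<longleftrightarrow> k = l" for k l
      using pos_bij[OF \<delta>, of z] by (simp add: bij_def inj_eq)
    have Jw: "J (\<delta> z) (pos \<delta> z k - i) \<longleftrightarrow>
        k \<noteq> 0 \<and> (pos (\<gamma> \<circ> \<delta>) z k < pos (\<gamma> \<circ> \<delta>) z 0) \<noteq> (pos \<delta> z k < pos \<delta> z 0)" for k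
      using inj\<delta>[of k 0] by (simp add: J_def w pos_shift pos_comp[OF \<gamma> \<delta>] i_def)
    \<comment> \<open>This equivalence is the purpose of \<open>a\<close>: \<open>H\<close> charges
      to \<open>\<delta> z\<close> exactly the pairs whose preimages have \<open>z\<close> as their
      earlier point, in agreement with \<open>invs\<close>.\<close>
    have aw: "a (\<delta> z) (pos \<delta> z k - i) \<longleftrightarrow> k > 0" for k
      using pos_inv[OF \<delta>, of z k] pos_inv[OF \<delta>, of z 0] by (simp add: a_def w pos_shift \<delta>'_def i_def)
    have "bij_betw (\<lambda>k. pos \<delta> z k - i) S {j. J (\<delta> z) j \<and> a (\<delta> z) j}"
      unfolding bij_betw_def
    proof
      show "inj_on (\<lambda>k. pos \<delta> z k - i) S" by (auto simp: inj_on_def inj\<delta>)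
      show "(\<lambda>k. pos \<delta> z k - i) ` S = {j. J (\<delta> z) j \<and> a (\<delta> z) j}"
      proof safe
        fix j assume j: "J (\<delta> z) j" "a (\<delta> z) j"
        obtain k where "j + i = pos \<delta> z k" using pos_bij[OF \<delta>, of z] by (metis bij_pointE)
        then have k: "j = pos \<delta> z k - i" by simp
        then show "j \<in> (\<lambda>k. pos \<delta> z k - i) ` S" using j aw[of k] by (auto simp: S_def)
      qed (auto simp: S_def aw)
    qed
    then have HS: "H (\<delta> z) = int (card S)" unfolding H_def using bij_betw_same_card by metis
    have inv1: "finite (invs (\<gamma> \<circ> \<delta>) z)" "finite (invs \<delta> z)" using finite_invs FG_comp \<gamma> \<delta> by auto
    have S: "S = (invs (\<gamma> \<circ> \<delta>) z - invs \<delta> z) \<union> (invs \<delta> z - invs (\<gamma> \<circ> \<delta>) z)"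
      unfolding S_def invs_def by (auto simp: Jw)
    have "card S = card (invs (\<gamma> \<circ> \<delta>) z - invs \<delta> z) + card (invs \<delta> z - invs (\<gamma> \<circ> \<delta>) z)"
      unfolding S using inv1 by (intro card_Un_disjoint) auto
    moreover have "card (invs (\<gamma> \<circ> \<delta>) z) = card (invs (\<gamma> \<circ> \<delta>) z - invs \<delta> z) + card (invs (\<gamma> \<circ> \<delta>) z \<inter> invs \<delta> z)"
      using card_Int_Diff[OF inv1(1)] by (simp add: add.commute)
    moreover have "card (invs \<delta> z) = card (invs \<delta> z - invs (\<gamma> \<circ> \<delta>) z) + card (invs (\<gamma> \<circ> \<delta>) z \<inter> invs \<delta> z)"
      using card_Int_Diff[OF inv1(2), of "invs (\<gamma> \<circ> \<delta>) z"] by (metis add.commute Int_commute)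
    ultimately have "ninv (\<gamma> \<circ> \<delta>) z - (H (\<delta> z) + ninv \<delta> z) = - 2 * int (card (invs \<delta> z - invs (\<gamma> \<circ> \<delta>) z))"
      unfolding HS ninv_def by simp
    then show ?thesis by simp
  qed
  have lcH\<delta>: "loc_const (\<lambda>z. H (\<delta> z))" by (rule loc_const_cont[OF lcH FG_cont[OF \<delta>]])
  have "triv (\<lambda>z. (ninv (\<gamma> \<circ> \<delta>) z - (H (\<delta> z) + ninv \<delta> z)) + ((H (\<delta> z) - H z) + (H z - ninv \<gamma> z)))"
    by (intro triv_add triv_even parity loc_const_diff loc_const_add lcH\<delta> loc_const_ninv FG_comp \<gamma> \<delta> triv_cob cob_add cob1 cob_FG lcH)
  then show ?thesis by (simp add: algebra_simps)
qed

definition sg :: "('a \<Rightarrow> 'a) \<Rightarrow> ('a \<Rightarrow> int) set set" where "sg \<gamma> = Q (ninv \<gamma>)"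

lemma sg_comp:
  assumes "\<gamma> \<in> FG" "\<delta> \<in> FG" shows "sg (\<gamma> \<circ> \<delta>) = sg \<gamma> \<otimes>\<^bsub>K\<^esub> sg \<delta>"
proof -
  have "sg (\<gamma> \<circ> \<delta>) = Q (\<lambda>x. ninv \<gamma> x + ninv \<delta> x)"
    unfolding sg_def using assms by (intro Q_eqI ninv_comp loc_const_add loc_const_ninv FG_comp)
  then show ?thesis unfolding sg_def using Q_add[OF loc_const_ninv[OF assms(1)] loc_const_ninv[OF assms(2)]] by simp
qed

lemma sg_carrier: "\<gamma> \<in> FG \<Longrightarrow> sg \<gamma> \<in> carrier K"
  unfolding sg_def by (intro Q_carrier loc_const_ninv)

subsection \<open>Swaps\<close>

definition iota :: "'a set \<Rightarrow> ('a \<Rightarrow> 'a) \<Rightarrow> 'a \<Rightarrow> 'a" where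
  "iota U g x = (if x \<in> U then g x else if x \<in> g ` U then inv_into UNIV g x else x)"

lemma FG_inv_simps [simp]:
  assumes "g \<in> FG"
  shows "inv_into UNIV g (g x) = x" "g (inv_into UNIV g x) = x"
  using FG_bij[OF assms] by (simp_all add: bij_def surj_f_inv_f)

lemma FG_eq_iff: "g \<in> FG \<Longrightarrow> g x = g y \<longleftrightarrow> x = y"
  using FG_bij[of g] by (simp add: bij_def inj_eq)

lemma FG_image_iff: "g \<in> FG \<Longrightarrow> g x \<in> g ` U \<longleftrightarrow> x \<in> U"
  using FG_bij[of g] by (simp add: bij_def inj_image_mem_iff)

lemma iota_in: "x \<in> U \<Longrightarrow> iota U g x = g x"
  by (simp add: iota_def)

lemma iota_im:
  assumes "g \<in> FG" "U \<inter> g ` U = {}" "x \<in> U" shows "iota U g (g x) = x"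
  using assms FG_image_iff[OF assms(1)] by (auto simp: iota_def)

lemma iota_out: "x \<notin> U \<Longrightarrow> x \<notin> g ` U \<Longrightarrow> iota U g x = x"
  by (simp add: iota_def)

lemma iota_iota:
  assumes "g \<in> FG" "U \<inter> g ` U = {}" shows "iota U g (iota U g x) = x"
proof -
  consider "x \<in> U" | y where "y \<in> U" "x = g y" | "x \<notin> U" "x \<notin> g ` U" by blast
  then show ?thesis
    using assms by cases (auto simp: iota_in iota_im iota_out)
qed

lemma iota_FG:
  assumes "g \<in> FG" "clopen U" "U \<inter> g ` U = {}" shows "iota U g \<in> FG"
proof (rule FG_I)
  show "bij (iota U g)"
    by (rule bij_betw_byWitness[where f' = "iota U g"]) (auto simp: iota_iota assms)
  show "loc_const (\<lambda>x. if x \<in> U then c g x else if x \<in> g ` U then c (inv_into UNIV g) x else 0)"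
    by (intro loc_const_if assms clopen_FG_image FG_cocycle FG_inv loc_const_const)
  show "iota U g x = T (if x \<in> U then c g x else if x \<in> g ` U then c (inv_into UNIV g) x else 0) x" for x
    using FG_cocycle(2)[OF assms(1), of x] FG_cocycle(2)[OF FG_inv[OF assms(1)], of x] by (simp add: iota_def)
qed

lemma iota_empty [simp]: "iota {} g = id"
  by (auto simp: iota_def)

lemma iota_Un:
  assumes g: "g \<in> FG" and "A \<inter> B = {}" "(A \<union> B) \<inter> g ` (A \<union> B) = {}"
  shows "iota (A \<union> B) g = iota A g \<circ> iota B g"
proof
  fix x
  have dis: "A \<inter> g ` A = {}" "B \<inter> g ` B = {}" "A \<inter> g ` B = {}" "B \<inter> g ` A = {}" "g ` A \<inter> g ` B = {}"
    using assms FG_eq_iff[OF g] by (auto simp: image_Un)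
  consider "x \<in> A" | "x \<in> B" | y where "y \<in> A" "x = g y" | y where "y \<in> B" "x = g y"
    | "x \<notin> A \<union> B" "x \<notin> g ` (A \<union> B)" by blast
  then show "iota (A \<union> B) g x = (iota A g \<circ> iota B g) x"
  proof cases
    case 1
    then have "iota B g x = x" using assms(2) dis by (intro iota_out) auto
    then show ?thesis using 1 by (simp add: iota_in)
  next
    case 2
    then have "iota A g (g x) = g x" using dis assms(2) by (intro iota_out) auto
    then show ?thesis using 2 by (simp add: iota_in)
  next
    case 3
    then have "iota B g x = x" using dis by (intro iota_out) auto
    then show ?thesis using 3 assms dis by (simp add: iota_im)
  next
    case 4
    then have "iota A g y = y" using dis assms(2) by (intro iota_out) auto
    then show ?thesis using 4 assms dis by (simp add: iota_im)
  next
    case 5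
    then show ?thesis by (simp add: iota_def image_Un)
  qed
qed

lemma iota_cong:
  assumes "g \<in> FG" "h \<in> FG" "U \<inter> g ` U = {}" "\<And>x. x \<in> U \<Longrightarrow> g x = h x"
  shows "iota U g = iota U h"
proof
  fix x
  have im: "h ` U = g ` U" using assms(4) by auto
  consider "x \<in> U" | y where "y \<in> U" "x = g y" | "x \<notin> U" "x \<notin> g ` U" by blast
  then show "iota U g x = iota U h x"
  proof cases
    case 2
    then have "iota U g x = y" using iota_im[OF assms(1,3)] by (simp only:)
    moreover have "iota U h (h y) = y" using 2 assms(3) by (intro iota_im assms(2)) (simp_all add: im)
    then have "iota U h x = y" using 2 assms(4) by simp
    ultimately show ?thesis by simp
  next
    case 1
    then show ?thesis using assms(4)[OF 1] by (simp only: iota_in)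
  next
    case 3
    then show ?thesis by (simp add: iota_out im)
  qed
qed

lemma iota_sym:
  assumes "g \<in> FG" "U \<inter> g ` U = {}" shows "iota (g ` U) (inv_into UNIV g) = iota U g"
proof
  fix x
  have im: "inv_into UNIV g ` g ` U = U" using assms(1) by (auto simp: image_iff)
  consider "x \<in> U" | y where "y \<in> U" "x = g y" | "x \<notin> U" "x \<notin> g ` U" by blast
  then show "iota (g ` U) (inv_into UNIV g) x = iota U g x"
  proof cases
    case 1
    have "iota (g ` U) (inv_into UNIV g) (inv_into UNIV g (g x)) = g x"
      using 1 assms by (intro iota_im FG_inv) (auto simp: im)
    then show ?thesis using 1 assms by (simp add: iota_in)
  next
    case 2
    then show ?thesis using assms by (simp add: iota_im iota_in)
  qed (simp add: iota_out im)
qed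

text \<open>The identity \<open>(1 3) = (2 3)(1 2)(2 3)\<close> for transpositions, with
  \<open>U\<close>, \<open>g\<close> U\<open>and\<close>f \<open>U\<close> in the roles of 1, 2 and
  3.\<close>

lemma iota_conj:
  assumes g: "g \<in> FG" and f: "f \<in> FG"
    and dis: "U \<inter> g ` U = {}" "U \<inter> f ` U = {}" "g ` U \<inter> f ` U = {}"
  defines "h \<equiv> iota (g ` U) (f \<circ> inv_into UNIV g)"
  shows "iota U f = h \<circ> (iota U g \<circ> h)"
proof
  fix x
  define k where "k = f \<circ> inv_into UNIV g"
  have k: "k \<in> FG" unfolding k_def by (intro FG_comp f FG_inv g)
  have kg: "k (g y) = f y" for y using g by (simp add: k_def)
  have im: "k ` g ` U = f ` U" by (auto simp: kg image_iff)
  have h: "h = iota (g ` U) k" by (simp add: h_def k_def)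
  have h1: "h (g y) = f y" if "y \<in> U" for y using that by (simp add: h iota_in kg)
  have h2: "h (f y) = g y" if "y \<in> U" for y
    using iota_im[OF k, of "g ` U" "g y"] that dis(3) by (simp add: h kg im)
  have h3: "h y = y" if "y \<notin> g ` U" "y \<notin> f ` U" for y
    using that by (simp add: h iota_out im)
  consider "x \<in> U" | y where "y \<in> U" "x = g y" | y where "y \<in> U" "x = f y"
    | "x \<notin> U" "x \<notin> g ` U" "x \<notin> f ` U" by blast
  then show "iota U f x = (h \<circ> (iota U g \<circ> h)) x"
  proof cases
    case 1
    then have "h x = x" using dis by (intro h3) auto
    then show ?thesis using 1 h1 by (simp add: iota_in)
  next
    case 2
    then have "iota U g (f y) = f y" using dis by (intro iota_out) auto
    moreover have "iota U f (g y) = g y" using 2 dis by (intro iota_out) auto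
    ultimately show ?thesis using 2 h1 h2 by simp
  next
    case 3
    then have "h y = y" using dis by (intro h3) auto
    then show ?thesis using 3 h2 iota_im[OF g dis(1)] iota_im[OF f dis(2)] by simp
  next
    case 4
    then show ?thesis by (simp add: h3 iota_out)
  qed
qed

subsection \<open>The abelianization\<close>

text \<open>Products in the quotient groups stay abstract, so that the laws of commutative groups
  apply instead of an unfolding into products of cosets.\<close>

declare mult_FactGroup [simp del] one_FactGroup [simp del]

abbreviation G :: "('a \<Rightarrow> 'a) monoid" where "G \<equiv> full_group0 \<phi>"

lemma G_carrier: "\<gamma> \<in> carrier G \<longleftrightarrow> \<gamma> \<in> FG \<and> index_map \<phi> \<gamma> = 0"
  by (simp add: full_group0_def)

lemma G_simps [simp]: "a \<otimes>\<^bsub>G\<^esub> b = a \<circ> b" "\<one>\<^bsub>G\<^esub> = id"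
  by (simp_all add: full_group0_def)

lemma G_FG: "\<gamma> \<in> carrier G \<Longrightarrow> \<gamma> \<in> FG"
  by (simp add: G_carrier)

lemma G_comp: "a \<in> carrier G \<Longrightarrow> b \<in> carrier G \<Longrightarrow> a \<circ> b \<in> carrier G"
  by (simp add: G_carrier FG_comp index_comp)

lemma G_inv:
  assumes "a \<in> carrier G" shows "inv_into UNIV a \<in> carrier G" "inv_into UNIV a \<circ> a = id"
proof -
  have a: "a \<in> FG" using assms by (simp add: G_carrier)
  show *: "inv_into UNIV a \<circ> a = id" using a by (auto simp: fun_eq_iff)
  show "inv_into UNIV a \<in> carrier G"
    using index_comp[OF FG_inv[OF a] a] assms by (simp add: * G_carrier index_id FG_inv[OF a])
qed

lemma group_G: "group G"
proof (rule groupI)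
  show "\<exists>y\<in>carrier G. y \<otimes>\<^bsub>G\<^esub> x = \<one>\<^bsub>G\<^esub>" if "x \<in> carrier G" for x
    using G_inv[OF that] by auto
qed (auto simp: G_comp comp_assoc G_carrier[of id] FG_id index_id)

lemma involution_G:
  assumes "\<gamma> \<in> FG" "\<gamma> \<circ> \<gamma> = id" shows "\<gamma> \<in> carrier G"
  using index_comp[OF assms(1,1)] assms by (simp add: G_carrier index_id)

lemma iota_G:
  assumes "g \<in> FG" "clopen U" "U \<inter> g ` U = {}" shows "iota U g \<in> carrier G"
  using involution_G[OF iota_FG[OF assms]] iota_iota[OF assms(1,3)] by (auto simp: fun_eq_iff)

abbreviation D :: "('a \<Rightarrow> 'a) set" where "D \<equiv> derived G (carrier G)"
abbreviation A :: "('a \<Rightarrow> 'a) set monoid" where "A \<equiv> G Mod D"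

definition q :: "('a \<Rightarrow> 'a) \<Rightarrow> ('a \<Rightarrow> 'a) set" where "q \<gamma> = D #>\<^bsub>G\<^esub> \<gamma>"

lemma A_comm_group: "comm_group A"
  by (rule group.derived_quot_is_comm_group[OF group_G])

sublocale A: comm_group A by (rule A_comm_group)

lemma q_hom: "q \<in> hom G A"
  unfolding q_def[abs_def]
  by (rule normal.r_coset_hom_Mod[OF group.derived_self_is_normal[OF group_G]])

lemma q_carrier [simp]: "\<gamma> \<in> carrier G \<Longrightarrow> q \<gamma> \<in> carrier A"
  using hom_in_carrier[OF q_hom] .

lemma q_comp: "a \<in> carrier G \<Longrightarrow> b \<in> carrier G \<Longrightarrow> q (a \<circ> b) = q a \<otimes>\<^bsub>A\<^esub> q b"
  using hom_mult[OF q_hom, of a b] by simp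

lemma q_id: "q id = \<one>\<^bsub>A\<^esub>"
  using hom_one[OF q_hom group_G A.is_group] by simp

lemma q_iota_sq:
  assumes "g \<in> FG" "clopen U" "U \<inter> g ` U = {}"
  shows "q (iota U g) \<otimes>\<^bsub>A\<^esub> q (iota U g) = \<one>\<^bsub>A\<^esub>"
proof -
  have "iota U g \<circ> iota U g = id" using iota_iota[OF assms(1,3)] by (auto simp: fun_eq_iff)
  then show ?thesis using q_comp[OF iota_G iota_G, OF assms assms] q_id by simp
qed

lemma q_iota_Un:
  assumes "g \<in> FG" "clopen U" "clopen V" "U \<inter> V = {}" "(U \<union> V) \<inter> g ` (U \<union> V) = {}"
  shows "q (iota (U \<union> V) g) = q (iota U g) \<otimes>\<^bsub>A\<^esub> q (iota V g)"
  unfolding iota_Un[OF assms(1,4,5)] using assms by (intro q_comp iota_G) auto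

text \<open>The conjugating element \<open>h\<close> is itself a swap, hence of index zero even if
  \<open>g\<close> and \<open>f\<close> are not. In the abelianization it occurs twice and
  cancels.\<close>

lemma q_iota_conj:
  assumes "g \<in> FG" "f \<in> FG" "clopen U" "U \<inter> g ` U = {}" "U \<inter> f ` U = {}" "g ` U \<inter> f ` U = {}"
  shows "q (iota U g) = q (iota U f)"
proof -
  define h where "h = iota (g ` U) (f \<circ> inv_into UNIV g)"
  have fg: "f \<circ> inv_into UNIV g \<in> FG" using assms by (intro FG_comp FG_inv)
  have im: "(f \<circ> inv_into UNIV g) ` g ` U = f ` U" using assms(1) by (auto simp: image_iff)
  have dis: "g ` U \<inter> (f \<circ> inv_into UNIV g) ` g ` U = {}" unfolding im by (rule assms(6))
  have hG: "h \<in> carrier G" and hh: "q h \<otimes>\<^bsub>A\<^esub> q h = \<one>\<^bsub>A\<^esub>"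
    unfolding h_def by (intro iota_G q_iota_sq fg dis clopen_FG_image assms)+
  have iG: "iota U g \<in> carrier G" using assms by (intro iota_G)
  have "q (iota U f) = q h \<otimes>\<^bsub>A\<^esub> (q (iota U g) \<otimes>\<^bsub>A\<^esub> q h)"
    using iota_conj[OF assms(1,2,4,5,6)] hG iG by (simp add: h_def[symmetric] q_comp G_comp)
  also have "\<dots> = q (iota U g) \<otimes>\<^bsub>A\<^esub> (q h \<otimes>\<^bsub>A\<^esub> q h)"
    using hG iG by (simp add: A.m_ac)
  finally show ?thesis using hh iG by simp
qed

section \<open>Small neighbourhoods, a colouring, and the class of a clopen set\<close>

lemma disjoint_nbhd:
  assumes "g \<in> FG" "f \<in> FG" "g z \<noteq> f z"
  obtains W where "clopen W" "z \<in> W" "g ` W \<inter> f ` W = {}"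
proof -
  obtain B where B: "clopen B" "g z \<in> B" "f z \<notin> B" using clopen_separate[OF assms(3)] by blast
  let ?W = "{x. g x \<in> B \<and> f x \<notin> B}"
  have "clopen ?W"
    using loc_const_conj[OF loc_const_cont[OF B(1) FG_cont[OF assms(1)]]
        loc_const_not[OF loc_const_cont[OF B(1) FG_cont[OF assms(2)]]]] by simp
  then show thesis using B by (intro that[of ?W]) auto
qed

lemma phi_neq: "\<phi> x \<noteq> x"
  using aperiodic[of 1 x] by auto

lemma small_nbhd:
  assumes "g \<in> FG" "g z \<noteq> z"
  obtains W where "clopen W" "z \<in> W" "W \<inter> g ` W = {}"
  using disjoint_nbhd[OF FG_id assms(1), of z] assms(2) by (metis id_apply image_id)

text \<open>Because \<phi> has no fixed point, one colour is enough on a small set, and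
  \<open>clopen_induct\<close> glues partial colourings together. No colour class meets its image
  under \<phi>, so each can be swapped with that image.\<close>

lemma colouring_exists:
  "\<exists>m (f :: 'a \<Rightarrow> nat). loc_const f \<and> (\<forall>x. f x < m) \<and> (\<forall>x. f x \<noteq> f (\<phi> x))"
proof -
  define P where "P = (\<lambda>U. \<exists>m (f :: 'a \<Rightarrow> nat). loc_const f \<and> (\<forall>x. f x < m) \<and>
     (\<forall>x \<in> U. \<phi> x \<in> U \<longrightarrow> f x \<noteq> f (\<phi> x)))"
  have "P UNIV"
  proof (rule clopen_induct)
    fix z
    obtain W where "clopen W" "z \<in> W" "W \<inter> \<phi> ` W = {}" by (rule small_nbhd[OF FG_phi phi_neq])
    moreover from this have "P W'" if "W' \<subseteq> W" for W'
      unfolding P_def using that by (intro exI[of _ 1] exI[of _ "\<lambda>x. 0"]) auto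
    ultimately show "\<exists>W. clopen W \<and> z \<in> W \<and> (\<forall>W'. clopen W' \<and> W' \<subseteq> W \<longrightarrow> P W')" by blast
  next
    fix U V assume UV: "clopen U" "clopen V" "U \<inter> V = {}" "P U" "P V"
    obtain m :: nat and f :: "'a \<Rightarrow> nat" where f: "loc_const f" "\<And>x. f x < m" "\<And>x. x \<in> U \<Longrightarrow> \<phi> x \<in> U \<Longrightarrow> f x \<noteq> f (\<phi> x)"
      using UV(4) unfolding P_def by blast
    obtain n :: nat and g :: "'a \<Rightarrow> nat" where g: "loc_const g" "\<And>x. g x < n" "\<And>x. x \<in> V \<Longrightarrow> \<phi> x \<in> V \<Longrightarrow> g x \<noteq> g (\<phi> x)"
      using UV(5) unfolding P_def by blast
    show "P (U \<union> V)"
      unfolding P_def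
    proof (intro exI conjI)
      \<comment> \<open>The colours used on \<open>V\<close> are moved up by \<open>m\<close>,
        beyond all those used on \<open>U\<close>, so neighbours in different parts cannot
        clash.\<close>
      show "loc_const (\<lambda>x. if x \<in> U then f x else m + g x)"
        by (intro loc_const_intros UV f g)
      show "\<forall>x. (if x \<in> U then f x else m + g x) < m + n"
        using f(2) g(2) by (auto simp: trans_less_add1)
      have "f x \<noteq> m + g y" for x y using f(2)[of x] by linarith
      then show "\<forall>x\<in>U \<union> V. \<phi> x \<in> U \<union> V \<longrightarrow>
          (if x \<in> U then f x else m + g x) \<noteq> (if \<phi> x \<in> U then f (\<phi> x) else m + g (\<phi> x))"
        using f(3) g(3) by (auto dest: sym)
    qed
  qed simp
  then show ?thesis unfolding P_def by simp
qed

text \<open>One colouring is fixed for all sets: the colour classes of a union are then the unions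
  of the colour classes, which makes \<open>t\<close> additive.\<close>

definition ncol :: nat where
  "ncol = (SOME m. \<exists>f :: 'a \<Rightarrow> nat. loc_const f \<and> (\<forall>x. f x < m) \<and> (\<forall>x. f x \<noteq> f (\<phi> x)))"

definition col :: "'a \<Rightarrow> nat" where
  "col = (SOME f. loc_const f \<and> (\<forall>x. f x < ncol) \<and> (\<forall>x. f x \<noteq> f (\<phi> x)))"

lemma col: "loc_const col" "col x < ncol" "col (\<phi> x) \<noteq> col x"
proof -
  have "\<exists>f :: 'a \<Rightarrow> nat. loc_const f \<and> (\<forall>x. f x < ncol) \<and> (\<forall>x. f x \<noteq> f (\<phi> x))"
    unfolding ncol_def by (rule someI_ex[OF colouring_exists])
  then have "loc_const col \<and> (\<forall>x. col x < ncol) \<and> (\<forall>x. col x \<noteq> col (\<phi> x))"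
    unfolding col_def by (rule someI_ex)
  then show "loc_const col" "col x < ncol" "col (\<phi> x) \<noteq> col x" by metis+
qed

abbreviation part :: "'a set \<Rightarrow> nat \<Rightarrow> 'a set" where "part U i \<equiv> {x \<in> U. col x = i}"

lemma part: assumes "clopen U" shows "clopen (part U i)" "part U i \<inter> \<phi> ` part U i = {}"
proof -
  show "clopen (part U i)" using assms by (auto intro!: loc_const_intros col(1))
  have False if x: "x \<in> part U i" "x \<in> \<phi> ` part U i" for x
  proof -
    obtain y where "x = \<phi> y" "y \<in> part U i" using x(2) by blast
    then show False using x(1) col(3)[of y] by simp
  qed
  then show "part U i \<inter> \<phi> ` part U i = {}" by blast
qed

text \<open>The swaps of different colour classes need not commute, so the order matters here; it is
  lost in the abelianization.\<close>

primrec tt :: "nat \<Rightarrow> 'a set \<Rightarrow> 'a \<Rightarrow> 'a" where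
  "tt 0 U = id"
| "tt (Suc n) U = tt n U \<circ> iota (part U n) \<phi>"

lemma tt_G: "clopen U \<Longrightarrow> tt n U \<in> carrier G"
proof (induction n)
  case 0 show ?case by (simp only: tt.simps G_carrier FG_id index_id)
next
  case (Suc n) then show ?case
    unfolding tt.simps by (intro G_comp iota_G FG_phi part)
qed

definition t :: "'a set \<Rightarrow> ('a \<Rightarrow> 'a) set" where "t U = q (tt ncol U)"

lemma t_carrier [simp]: "clopen U \<Longrightarrow> t U \<in> carrier A"
  by (simp add: t_def tt_G)

lemma q_part: "clopen U \<Longrightarrow> q (iota (part U i) \<phi>) \<in> carrier A"
  using part[of U i] by (intro q_carrier iota_G FG_phi) auto

lemma q_tt_Suc: "clopen U \<Longrightarrow> q (tt (Suc n) U) = q (tt n U) \<otimes>\<^bsub>A\<^esub> q (iota (part U n) \<phi>)"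
  unfolding tt.simps using part[of U n] by (intro q_comp tt_G iota_G FG_phi) auto

lemma t_Un:
  assumes U: "clopen U" and V: "clopen V" and "U \<inter> V = {}"
  shows "t (U \<union> V) = t U \<otimes>\<^bsub>A\<^esub> t V"
proof -
  have "q (tt n (U \<union> V)) = q (tt n U) \<otimes>\<^bsub>A\<^esub> q (tt n V)" for n
  proof (induction n)
    case (Suc n)
    have UV: "clopen (U \<union> V)" using U V by (rule clopen_Un)
    have eq: "part (U \<union> V) n = part U n \<union> part V n" by auto
    have "q (iota (part (U \<union> V) n) \<phi>) = q (iota (part U n) \<phi>) \<otimes>\<^bsub>A\<^esub> q (iota (part V n) \<phi>)"
      using part[OF U, of n] part[OF V, of n] part(2)[OF UV, of n] assms(3) unfolding eq
      by (intro q_iota_Un FG_phi) auto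
    then show ?case
      using Suc tt_G[OF U] tt_G[OF V] q_part[OF U] q_part[OF V]
      by (simp only: q_tt_Suc[OF U] q_tt_Suc[OF V] q_tt_Suc[OF UV] A.m_ac q_carrier A.m_closed)
  qed (simp only: tt.simps q_id A.r_one A.one_closed)
  then show ?thesis by (simp add: t_def)
qed

lemma t_sq: assumes U: "clopen U" shows "t U \<otimes>\<^bsub>A\<^esub> t U = \<one>\<^bsub>A\<^esub>"
proof -
  have "q (tt n U) \<otimes>\<^bsub>A\<^esub> q (tt n U) = \<one>\<^bsub>A\<^esub>" for n
  proof (induction n)
    case (Suc n)
    let ?a = "q (tt n U)" and ?b = "q (iota (part U n) \<phi>)"
    have "(?a \<otimes>\<^bsub>A\<^esub> ?b) \<otimes>\<^bsub>A\<^esub> (?a \<otimes>\<^bsub>A\<^esub> ?b) = (?a \<otimes>\<^bsub>A\<^esub> ?a) \<otimes>\<^bsub>A\<^esub> (?b \<otimes>\<^bsub>A\<^esub> ?b)"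
      using tt_G[OF U] q_part[OF U] by (simp only: A.m_ac q_carrier A.m_closed)
    also have "?b \<otimes>\<^bsub>A\<^esub> ?b = \<one>\<^bsub>A\<^esub>"
      using part[OF U, of n] by (intro q_iota_sq FG_phi) auto
    finally show ?case using Suc by (simp only: q_tt_Suc[OF U] A.r_one A.one_closed)
  qed (simp only: tt.simps q_id A.r_one A.one_closed)
  then show ?thesis by (simp add: t_def)
qed

text \<open>Here the swaps of the colour classes have disjoint supports and multiply to a single
  swap, so the colouring leaves no trace.\<close>

lemma t_eq_iota_phi:
  assumes U: "clopen U" "U \<inter> \<phi> ` U = {}" shows "t U = q (iota U \<phi>)"
proof -
  have "tt n U = iota {x \<in> U. col x < n} \<phi>" for n
  proof (induction n)
    case (Suc n)
    have eq: "{x \<in> U. col x < Suc n} = {x \<in> U. col x < n} \<union> part U n" by auto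
    have "iota {x \<in> U. col x < Suc n} \<phi> = iota {x \<in> U. col x < n} \<phi> \<circ> iota (part U n) \<phi>"
      unfolding eq using U by (intro iota_Un FG_phi) auto
    then show ?case using Suc by simp
  qed simp
  moreover have "{x \<in> U. col x < ncol} = U" using col(2) by auto
  ultimately show ?thesis by (simp add: t_def)
qed

lemma t_empty [simp]: "t {} = \<one>\<^bsub>A\<^esub>"
  using t_eq_iota_phi[of "{}"] q_id by simp

text \<open>Near a point \<open>z\<close> either \<open>g\<close> agrees with \<open>\<phi>\<close>, or \<open>z\<close>, \<open>g z\<close> and \<open>\<phi> z\<close> are distinct; then
  the swaps along \<open>g\<close> and along \<open>\<phi>\<close> of a small neighbourhood of \<open>z\<close> are conjugate.\<close>

theorem q_iota:
  assumes g: "g \<in> FG" and U: "clopen U" "U \<inter> g ` U = {}"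
  shows "q (iota U g) = t U"
proof -
  define P where "P = (\<lambda>X. X \<subseteq> U \<longrightarrow> q (iota X g) = t X)"
  have "P U"
  proof (rule clopen_induct)
    fix z
    show "\<exists>W. clopen W \<and> z \<in> W \<and> (\<forall>W'. clopen W' \<and> W' \<subseteq> W \<longrightarrow> P W')"
    proof (cases "z \<in> U")
      case False
      have "P W'" if "W' \<subseteq> - U" for W'
        unfolding P_def
      proof
        assume "W' \<subseteq> U"
        then have "W' = {}" using that by blast
        then show "q (iota W' g) = t W'" by (simp only: iota_empty q_id t_empty)
      qed
      then show ?thesis using False U(1) by (intro exI[of _ "- U"]) (auto intro: loc_const_not)
    next
      case True
      show ?thesis
      proof (cases "g z = \<phi> z")
        case True
        then have cz: "c g z = 1" using cocycle_eq[OF g, of z 1] by simp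
        obtain W where W: "clopen W" "z \<in> W" "\<And>y. y \<in> W \<Longrightarrow> c g y = c g z"
          using clopen_nbhd_loc_const[OF FG_cocycle(1)[OF g]] by blast
        have "P W'" if W': "clopen W'" "W' \<subseteq> W" for W'
          unfolding P_def
        proof
          assume sub: "W' \<subseteq> U"
          have eq: "g y = \<phi> y" if "y \<in> W'" for y
            using FG_cocycle(2)[OF g, of y] W(3)[of y] W'(2) that cz by auto
          have dis: "W' \<inter> g ` W' = {}" using sub U(2) by blast
          then have "W' \<inter> \<phi> ` W' = {}" using eq by auto
          then show "q (iota W' g) = t W'"
            using t_eq_iota_phi[OF W'(1)] iota_cong[OF g FG_phi dis eq] by simp
        qed
        then show ?thesis using W by blast
      next
        case False
        obtain W1 where W1: "clopen W1" "z \<in> W1" "g ` W1 \<inter> \<phi> ` W1 = {}"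
          using disjoint_nbhd[OF g FG_phi False] by blast
        obtain W2 where W2: "clopen W2" "z \<in> W2" "W2 \<inter> \<phi> ` W2 = {}" by (rule small_nbhd[OF FG_phi phi_neq])
        have "P W'" if W': "clopen W'" "W' \<subseteq> W1 \<inter> W2" for W'
          unfolding P_def
        proof
          assume sub: "W' \<subseteq> U"
          have "W' \<inter> g ` W' = {}" using sub U(2) by blast
          moreover have "W' \<inter> \<phi> ` W' = {}" using W'(2) W2(3) by blast
          moreover have "g ` W' \<inter> \<phi> ` W' = {}" using W'(2) W1(3) by blast
          ultimately show "q (iota W' g) = t W'"
            using t_eq_iota_phi[OF W'(1)] q_iota_conj[OF g FG_phi W'(1)] by simp
        qed
        then show ?thesis using W1 W2 clopen_Int[of W1 W2] by (intro exI[of _ "W1 \<inter> W2"]) blast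
      qed
    qed
  next
    fix X Y assume XY: "clopen X" "clopen Y" "X \<inter> Y = {}" "P X" "P Y"
    show "P (X \<union> Y)"
      unfolding P_def
    proof
      assume sub: "X \<union> Y \<subseteq> U"
      then have "(X \<union> Y) \<inter> g ` (X \<union> Y) = {}" using U(2) by blast
      then show "q (iota (X \<union> Y) g) = t (X \<union> Y)"
        using q_iota_Un[OF g XY(1-3)] t_Un[OF XY(1-3)] XY(4,5) sub by (simp add: P_def)
    qed
  qed (rule U(1))
  then show ?thesis by (simp add: P_def)
qed

text \<open>Around a fixed point \<open>g\<close> is locally the identity. Elsewhere a small set is
  disjoint from its image, and the swap along \<open>g\<close> is also the swap of the image along
  the inverse of \<open>g\<close>: both classes come from the same involution.\<close>

theorem t_image:
  assumes g: "g \<in> FG" and U: "clopen U" shows "t (g ` U) = t U"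
proof -
  define P where "P = (\<lambda>X. t (g ` X) = t X)"
  have "P U"
  proof (rule clopen_induct)
    fix z
    show "\<exists>W. clopen W \<and> z \<in> W \<and> (\<forall>W'. clopen W' \<and> W' \<subseteq> W \<longrightarrow> P W')"
    proof (cases "g z = z")
      case True
      then have cz: "c g z = 0" using cocycle_eq[OF g, of z 0] by simp
      obtain W where W: "clopen W" "z \<in> W" "\<And>y. y \<in> W \<Longrightarrow> c g y = c g z"
        using clopen_nbhd_loc_const[OF FG_cocycle(1)[OF g]] by blast
      have "g y = y" if "y \<in> W" for y
        using FG_cocycle(2)[OF g, of y] W(3)[OF that] cz by simp
      then have "g ` W' = W'" if "W' \<subseteq> W" for W'
        using that by (auto simp: image_iff subset_iff)
      then show ?thesis using W by (auto simp: P_def)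
    next
      case False
      obtain W where W: "clopen W" "z \<in> W" "W \<inter> g ` W = {}" by (rule small_nbhd[OF g False])
      have "P W'" if W': "clopen W'" "W' \<subseteq> W" for W'
      proof -
        have dis: "W' \<inter> g ` W' = {}" using W(3) W'(2) by blast
        have im: "inv_into UNIV g ` g ` W' = W'" using g by (auto simp: image_iff)
        have "t (g ` W') = q (iota (g ` W') (inv_into UNIV g))"
          using dis by (intro q_iota[symmetric] FG_inv g clopen_FG_image W') (auto simp: im)
        then show ?thesis
          using iota_sym[OF g dis] q_iota[OF g W'(1) dis] by (simp add: P_def)
      qed
      then show ?thesis using W by blast
    qed
  next
    fix X Y assume XY: "clopen X" "clopen Y" "X \<inter> Y = {}" "P X" "P Y"
    have "g ` X \<inter> g ` Y = {}" using XY(3) FG_eq_iff[OF g] by auto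
    then have "t (g ` X \<union> g ` Y) = t (g ` X) \<otimes>\<^bsub>A\<^esub> t (g ` Y)"
      using XY g by (intro t_Un clopen_FG_image)
    then show "P (X \<union> Y)" using t_Un[OF XY(1-3)] XY(4,5) by (simp add: P_def image_Un)
  qed (rule U)
  then show ?thesis by (simp add: P_def)
qed

text \<open>The intersection contributes to both factors and cancels by \<open>t_sq\<close>.\<close>

lemma t_sym_diff:
  assumes U: "clopen U" and V: "clopen V"
  shows "t ((U - V) \<union> (V - U)) = t U \<otimes>\<^bsub>A\<^esub> t V"
proof -
  let ?a = "t (U - V)" and ?b = "t (V - U)" and ?i = "t (U \<inter> V)"
  note cl = clopen_Diff[OF U V] clopen_Diff[OF V U] clopen_Int[OF U V]
  have "t ((U - V) \<union> (U \<inter> V)) = ?a \<otimes>\<^bsub>A\<^esub> ?i" "t ((V - U) \<union> (U \<inter> V)) = ?b \<otimes>\<^bsub>A\<^esub> ?i"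
    using cl by (intro t_Un; auto)+
  moreover have "(U - V) \<union> (U \<inter> V) = U" "(V - U) \<union> (U \<inter> V) = V" by auto
  ultimately have "t U \<otimes>\<^bsub>A\<^esub> t V = (?a \<otimes>\<^bsub>A\<^esub> ?i) \<otimes>\<^bsub>A\<^esub> (?b \<otimes>\<^bsub>A\<^esub> ?i)" by simp
  also have "\<dots> = (?a \<otimes>\<^bsub>A\<^esub> ?b) \<otimes>\<^bsub>A\<^esub> (?i \<otimes>\<^bsub>A\<^esub> ?i)"
    using cl[THEN t_carrier] by (simp only: A.m_ac A.m_closed)
  also have "\<dots> = ?a \<otimes>\<^bsub>A\<^esub> ?b" using cl[THEN t_carrier] t_sq[OF cl(3)] by simp
  also have "\<dots> = t ((U - V) \<union> (V - U))" using cl by (intro t_Un[symmetric]) auto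
  finally show ?thesis by simp
qed

subsection \<open>The signature of swaps\<close>

text \<open>No point moves by more than one step, so only neighbours that are exchanged can be
  inverted.\<close>

lemma ninv_iota_phi:
  assumes U: "clopen U" "U \<inter> \<phi> ` U = {}" shows "ninv (iota U \<phi>) = indicator U"
proof
  fix z
  let ?s = "iota U \<phi>"
  have s: "?s \<in> FG" using U by (intro iota_FG FG_phi)
  have cs: "c ?s x = (if x \<in> U then 1 else if x \<in> \<phi> ` U then - 1 else 0)" for x
    by (rule cocycle_eq[OF s]) (simp add: iota_def T_minus_1)
  have p: "k - 1 \<le> pos ?s z k" "pos ?s z k \<le> k + 1" for k
    by (simp_all add: pos_def cs)
  have "invs ?s z = (if z \<in> U then {1} else {})"
  proof -
    have "k = 1 \<and> z \<in> U" if "k > 0" "pos ?s z k < pos ?s z 0" for k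
    proof -
      have "pos ?s z 0 = 1" "k = 1" using that p[of k] p[of 0] by linarith+
      then show ?thesis using cs[of z] by (auto simp: pos_def split: if_splits)
    qed
    moreover have "pos ?s z 1 < pos ?s z 0" if "z \<in> U"
      using that U(2) by (auto simp: pos_def cs)
    ultimately show ?thesis unfolding invs_def by auto
  qed
  then show "ninv ?s z = indicator U z" by (simp add: ninv_def)
qed

lemma loc_const_indicator: "clopen U \<Longrightarrow> loc_const (indicator U :: 'a \<Rightarrow> int)"
  unfolding indicator_def[abs_def] by (intro loc_const_intros)

lemma sg_tt: assumes U: "clopen U" shows "sg (tt ncol U) = Q (indicator U)"
proof -
  have "sg (tt n U) = Q (indicator {x \<in> U. col x < n})" for n
  proof (induction n)
    case 0
    have "ninv id = (\<lambda>z. 0)" by (auto simp: ninv_def invs_def pos_def cocycle_id)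
    moreover have "indicator {} = (\<lambda>z::'a. 0::int)" by auto
    moreover have "{x \<in> U. col x < 0} = {}" by simp
    ultimately show ?case by (simp only: sg_def tt.simps)
  next
    case (Suc n)
    have eq: "indicator {x \<in> U. col x < Suc n} = (\<lambda>x. indicator {x \<in> U. col x < n} x + indicator (part U n) x :: int)"
      by (rule ext) (auto simp: indicator_def)
    have "sg (tt (Suc n) U) = sg (tt n U) \<otimes>\<^bsub>K\<^esub> sg (iota (part U n) \<phi>)"
      unfolding tt.simps using part[OF U, of n] by (intro sg_comp G_FG[OF tt_G] iota_FG FG_phi U) auto
    also have "sg (iota (part U n) \<phi>) = Q (indicator (part U n))"
      unfolding sg_def using part[OF U, of n] by (subst ninv_iota_phi) auto
    also have "sg (tt n U) \<otimes>\<^bsub>K\<^esub> Q (indicator (part U n)) = Q (indicator {x \<in> U. col x < Suc n})"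
      unfolding eq Suc using part(1)[OF U, of n]
      by (intro Q_add[symmetric] loc_const_indicator) (auto intro!: loc_const_intros U col(1))
    finally show ?case .
  qed
  moreover have "{x \<in> U. col x < ncol} = U" using col(2) by auto
  ultimately show ?thesis by metis
qed

section \<open>Passage of the inversion class to the abelianization\<close>

lemma sg_group_hom: "group_hom G K sg"
proof -
  interpret K: comm_group K by (rule K_comm_group)
  show ?thesis
    using group_G K.is_group
    by (intro group_hom.intro group_hom_axioms.intro homI) (auto simp: sg_carrier G_FG sg_comp)
qed

lemma derived_sub_kernel: "D \<subseteq> kernel G K sg"
proof -
  interpret K: comm_group K by (rule K_comm_group)
  interpret S: group_hom G K sg by (rule sg_group_hom)
  have "sg ` D = derived K (sg ` carrier G)" by (rule S.derived_img[symmetric]) simp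
  also have "\<dots> = {\<one>\<^bsub>K\<^esub>}" by (rule K.derived_eq_singleton) auto
  finally show ?thesis
    using S.G.derived_in_carrier[of "carrier G"] by (auto simp: kernel_def)
qed

lemma sg_eq_if_q_eq:
  assumes "a \<in> carrier G" "b \<in> carrier G" "q a = q b" shows "sg a = sg b"
proof -
  interpret S: group_hom G K sg by (rule sg_group_hom)
  obtain \<Psi> where "\<And>x. x \<in> carrier G \<Longrightarrow> \<Psi> (D #>\<^bsub>G\<^esub> x) = sg x"
    using S.FactGroup_universal_kernel[OF S.G.derived_self_is_normal derived_sub_kernel] by metis
  then show ?thesis using assms unfolding q_def by metis
qed

text \<open>An equality in the abelianization determines \<open>sg\<close>, whose value on the
  standard representative \<open>tt ncol U\<close> of \<open>t U\<close> is known.\<close>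

lemma sg_if_q_eq_t:
  assumes "\<gamma> \<in> carrier G" "clopen U" "q \<gamma> = t U" shows "sg \<gamma> = Q (indicator U)"
  using sg_eq_if_q_eq[OF assms(1) tt_G[OF assms(2)]] assms(3) sg_tt[OF assms(2)] by (simp add: t_def)

subsection \<open>Periodic elements\<close>

text \<open>A cycle of length \<open>n\<close> is a product of \<open>n - 1\<close> transpositions
  of consecutive points. They are performed on all towers at once: the swap along \<gamma> of the
  levels \<open>m\<close> and \<open>m + 1\<close>, over all towers tall enough to have both. By
  \<open>t_image\<close> each swap contributes the class of its base, so \<open>t (V n)\<close>
  enters \<open>n - 1\<close> times and survives only for even \<open>n\<close>.\<close>

lemma tower_product:
  assumes \<gamma>: "\<gamma> \<in> FG" and per: "\<And>x. \<exists>n. 0 < n \<and> n \<le> R \<and> (\<gamma> ^^ n) x = x"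
    and V: "tower_bases \<gamma> V"
  shows "\<gamma> \<in> carrier G" "q \<gamma> = t (\<Union>n\<in>{n\<in>{1..R}. even n}. V n)"
proof -
  let ?rt = "return_time \<gamma>"
  have rt: "0 < ?rt x" "?rt x \<le> R" "(\<gamma> ^^ ?rt x) x = x" for x
  proof -
    obtain n where n: "0 < n \<and> n \<le> R \<and> (\<gamma> ^^ n) x = x" using per by blast
    then show "0 < ?rt x" "(\<gamma> ^^ ?rt x) x = x"
      unfolding return_time_def using LeastI[of "\<lambda>n. 0 < n \<and> (\<gamma> ^^ n) x = x" n] by auto
    show "?rt x \<le> R"
      unfolding return_time_def using Least_le[of "\<lambda>n. 0 < n \<and> (\<gamma> ^^ n) x = x" n] n by linarith
  qed
  have Vcl: "clopen (V n)" for n using V unfolding tower_bases_def clopen_iff by blast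
  have Vrt: "?rt v = n" if "v \<in> V n" for v n using V that unfolding tower_bases_def by blast
  have lev_rt: "?rt ((\<gamma> ^^ i) v) = n" if "v \<in> V n" "i < n" for v n i
    using V that unfolding tower_bases_def by blast
  have lev_ex: "\<exists>n i v. v \<in> V n \<and> i < n \<and> n \<in> {1..R} \<and> x = (\<gamma> ^^ i) v" for x
  proof -
    have "x \<in> ?rt -` {?rt x}" by simp
    then have "x \<in> (\<Union>i<?rt x. (\<gamma> ^^ i) ` V (?rt x))"
      using V unfolding tower_bases_def by blast
    then show ?thesis using rt(1,2)[of x] by force
  qed
  have lev_uniq: "n = n' \<and> i = i'" if "v \<in> V n" "i < n" "v' \<in> V n'" "i' < n'" "(\<gamma> ^^ i) v = (\<gamma> ^^ i') v'"
    for n n' i i' v v'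
  proof -
    have n: "n = n'" using lev_rt that by metis
    moreover have "disjoint_family_on (\<lambda>i. (\<gamma> ^^ i) ` V n) {..<n}" using V unfolding tower_bases_def by blast
    ultimately have "i = i'" using that unfolding disjoint_family_on_def by blast
    then show ?thesis using n by simp
  qed
  have top: "(\<gamma> ^^ n) v = v" if "v \<in> V n" for v n using rt(3)[of v] Vrt[OF that] by simp
  \<comment> \<open>The bases of the towers of height at least \<open>i + 2\<close>, which have a
    level \<open>i + 1\<close> to swap with level \<open>i\<close>.\<close>
  define Z where "Z = (\<lambda>i. \<Union>n\<in>{i+2..R}. V n)"
  define W where "W = (\<lambda>i. (\<gamma> ^^ i) ` Z i)"
  have Zcl: "clopen (Z i)" for i
    unfolding Z_def using loc_const_bex[of "{i+2..R}" "\<lambda>n x. x \<in> V n"] Vcl by simp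
  have Wcl: "clopen (W i)" for i unfolding W_def by (intro clopen_FG_image FG_funpow \<gamma> Zcl)
  have W_iff: "(\<gamma> ^^ i) v \<in> W m \<longleftrightarrow> i = m \<and> m + 2 \<le> n"
    and gW_iff: "(\<gamma> ^^ i) v \<in> \<gamma> ` W m \<longleftrightarrow> i = Suc m"
    if v: "v \<in> V n" "i < n" "n \<in> {1..R}" for v n i m
  proof -
    show "(\<gamma> ^^ i) v \<in> W m \<longleftrightarrow> i = m \<and> m + 2 \<le> n"
    proof
      assume "(\<gamma> ^^ i) v \<in> W m"
      then obtain n' v' where "m + 2 \<le> n'" "v' \<in> V n'" "(\<gamma> ^^ i) v = (\<gamma> ^^ m) v'"
        unfolding W_def Z_def by auto
      then show "i = m \<and> m + 2 \<le> n" using lev_uniq[OF v(1,2), of v' n' m] by auto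
    next
      assume "i = m \<and> m + 2 \<le> n"
      moreover from this have "v \<in> Z m" using v unfolding Z_def by auto
      ultimately show "(\<gamma> ^^ i) v \<in> W m" unfolding W_def by blast
    qed
    show "(\<gamma> ^^ i) v \<in> \<gamma> ` W m \<longleftrightarrow> i = Suc m"
    proof
      assume "(\<gamma> ^^ i) v \<in> \<gamma> ` W m"
      then obtain n' v' where "m + 2 \<le> n'" "v' \<in> V n'" "(\<gamma> ^^ i) v = (\<gamma> ^^ Suc m) v'"
        unfolding W_def Z_def by auto
      then show "i = Suc m" using lev_uniq[OF v(1,2), of v' n' "Suc m"] by auto
    next
      assume "i = Suc m"
      moreover from this have "v \<in> Z m" using v unfolding Z_def by auto
      ultimately show "(\<gamma> ^^ i) v \<in> \<gamma> ` W m" unfolding W_def by auto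
    qed
  qed
  have dis: "W m \<inter> \<gamma> ` W m = {}" for m
  proof -
    have False if x: "x \<in> W m" "x \<in> \<gamma> ` W m" for x
    proof -
      obtain n i v where "v \<in> V n" "i < n" "n \<in> {1..R}" "x = (\<gamma> ^^ i) v" using lev_ex by metis
      then show False using x W_iff gW_iff by simp
    qed
    then show ?thesis by blast
  qed
  define P where "P = rec_nat id (\<lambda>m f. f \<circ> iota (W m) \<gamma>)"
  have P_simps: "P 0 = id" "P (Suc m) = P m \<circ> iota (W m) \<gamma>" for m by (simp_all add: P_def)
  \<comment> \<open>After \<open>m\<close> swaps the levels \<open>0\<close> to
    \<open>min m (n - 1)\<close> of a tower of height \<open>n\<close> form one cycle, and the
    higher levels are still fixed.\<close>
  have P_eval: "P m ((\<gamma> ^^ i) v) = (if i < min m (n - 1) then (\<gamma> ^^ Suc i) v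
      else if i = min m (n - 1) then v else (\<gamma> ^^ i) v)"
    if v: "v \<in> V n" "n \<in> {1..R}" "i < n" for m n i v
    using v(3)
  proof (induction m arbitrary: i)
    case 0
    then show ?case by (simp add: P_simps)
  next
    case (Suc m)
    consider "i = m" "m + 2 \<le> n" | "i = Suc m" | "i \<noteq> Suc m" "\<not> (i = m \<and> m + 2 \<le> n)" by blast
    then show ?case
    proof cases
      case 1
      then have "iota (W m) \<gamma> ((\<gamma> ^^ i) v) = (\<gamma> ^^ Suc i) v"
        using W_iff[OF v(1) Suc.prems v(2)] by (simp add: iota_in)
      then show ?thesis using Suc.IH[of "Suc i"] 1 by (simp add: P_simps del: funpow.simps)
    next
      case 2
      then have "(\<gamma> ^^ m) v \<in> W m" using W_iff[OF v(1) _ v(2), of m m] Suc.prems by simp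
      then have "iota (W m) \<gamma> ((\<gamma> ^^ i) v) = (\<gamma> ^^ m) v"
        using iota_im[OF \<gamma> dis] 2 by simp
      then show ?thesis using Suc.IH[of m] 2 Suc.prems by (simp add: P_simps del: funpow.simps)
    next
      case 3
      then have "iota (W m) \<gamma> ((\<gamma> ^^ i) v) = (\<gamma> ^^ i) v"
        using W_iff[OF v(1) Suc.prems v(2)] gW_iff[OF v(1) Suc.prems v(2)] by (intro iota_out) auto
      then show ?thesis using Suc.IH[OF Suc.prems] 3 Suc.prems by (auto simp: P_simps simp del: funpow.simps)
    qed
  qed
  have P_R: "P R = \<gamma>"
  proof
    fix x
    obtain n i v where v: "v \<in> V n" "i < n" "n \<in> {1..R}" "x = (\<gamma> ^^ i) v" using lev_ex by metis
    show "P R x = \<gamma> x"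
    proof (cases "i = n - 1")
      case True
      then have "\<gamma> x = (\<gamma> ^^ n) v" using v by (metis Suc_diff_1 comp_apply funpow.simps(2) gr_implies_not0 not_gr_zero)
      then show ?thesis using P_eval[OF v(1,3,2), of R] v True top[OF v(1)] by simp
    next
      case False
      then show ?thesis using P_eval[OF v(1,3,2), of R] v by auto
    qed
  qed
  have PG: "P m \<in> carrier G" for m
  proof (induction m)
    case 0 show ?case unfolding P_simps G_carrier using FG_id index_id by blast
  next
    case (Suc m) then show ?case unfolding P_simps by (intro G_comp iota_G \<gamma> Wcl dis)
  qed
  show "\<gamma> \<in> carrier G" using PG[of R] P_R by simp
  \<comment> \<open>The base \<open>V n\<close> has been used \<open>min m (n - 1)\<close> times so
    far, and \<open>t\<close> only sees the parity of this number.\<close>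
  define E where "E = (\<lambda>m. \<Union>n\<in>{n\<in>{1..R}. odd (min m (n - 1))}. V n)"
  have Ecl: "clopen (E m)" for m
    unfolding E_def using loc_const_bex[of "{n\<in>{1..R}. odd (min m (n - 1))}" "\<lambda>n x. x \<in> V n"] Vcl by simp
  have mem: "v \<in> (\<Union>n\<in>S. V n) \<longleftrightarrow> n \<in> S" if "v \<in> V n" for v n S
    using that Vrt by blast
  have E_Suc: "E (Suc m) = (E m - Z m) \<union> (Z m - E m)" for m
  proof (rule Set.set_eqI)
    fix v
    show "v \<in> E (Suc m) \<longleftrightarrow> v \<in> (E m - Z m) \<union> (Z m - E m)"
    proof (cases "\<exists>n. v \<in> V n")
      case True
      then obtain n where n: "v \<in> V n" by blast
      have E: "v \<in> E k \<longleftrightarrow> n \<in> {1..R} \<and> odd (min k (n - 1))" for k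
        unfolding E_def mem[OF n] by simp
      have Z: "v \<in> Z m \<longleftrightarrow> n \<in> {m+2..R}"
        unfolding Z_def mem[OF n] ..
      consider "n \<ge> m + 2" | "n \<le> m + 1" by linarith
      then have "(n \<in> {1..R} \<and> odd (min (Suc m) (n - 1))) \<longleftrightarrow>
          ((n \<in> {1..R} \<and> odd (min m (n - 1))) \<noteq> (n \<in> {m+2..R}))"
      proof cases
        case 1
        then have "min (Suc m) (n - 1) = Suc m" "min m (n - 1) = m" by auto
        then show ?thesis using 1 by auto
      next
        case 2
        then have "min (Suc m) (n - 1) = n - 1" "min m (n - 1) = n - 1" by auto
        then show ?thesis using 2 by auto
      qed
      then show ?thesis using E Z by blast
    next
      case False
      then show ?thesis unfolding E_def Z_def by blast
    qed
  qed
  have "q (P m) = t (E m)" for m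
  proof (induction m)
    case 0
    have "E 0 = {}" by (simp add: E_def)
    then show ?case by (simp only: P_simps q_id t_empty)
  next
    case (Suc m)
    have "q (P (Suc m)) = q (P m) \<otimes>\<^bsub>A\<^esub> q (iota (W m) \<gamma>)"
      unfolding P_simps by (intro q_comp PG iota_G \<gamma> Wcl dis)
    also have "q (iota (W m) \<gamma>) = t (Z m)"
      using q_iota[OF \<gamma> Wcl dis] t_image[OF FG_funpow[OF \<gamma>] Zcl] by (simp add: W_def)
    also have "q (P m) \<otimes>\<^bsub>A\<^esub> t (Z m) = t (E (Suc m))"
      unfolding Suc E_Suc by (rule t_sym_diff[OF Ecl Zcl, symmetric])
    finally show ?case .
  qed
  from this[of R] have "q \<gamma> = t (E R)" by (simp only: P_R)
  moreover have "{n\<in>{1..R}. odd (min R (n - 1))} = {n\<in>{1..R}. even n}" by (auto simp: min_def)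
  ultimately show "q \<gamma> = t (\<Union>n\<in>{n\<in>{1..R}. even n}. V n)"
    by (simp only: E_def)
qed

subsection \<open>The subgroup of elements respecting a cut of an orbit\<close>

text \<open>Membership in \<open>full_group_at\<close>, translated by \<open>at_iff\<close> into the
  coordinates of the orbit.\<close>

definition cut :: "('a \<Rightarrow> 'a) \<Rightarrow> 'a \<Rightarrow> bool" where
  "cut \<gamma> z \<longleftrightarrow> (\<forall>k. 1 \<le> k \<longleftrightarrow> 1 \<le> pos \<gamma> z k)"

lemma cut_iff: "cut \<gamma> z \<longleftrightarrow> down \<gamma> z = {} \<and> up \<gamma> z = {}"
  unfolding cut_def down_def up_def by (auto simp: not_le) (meson linorder_not_le zless_imp_add1_zle int_one_le_iff_zero_less)+

lemma at_iff: "\<gamma> \<in> full_group_at \<phi> x \<longleftrightarrow> \<gamma> \<in> FG \<and> cut \<gamma> x"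
proof -
  have fwd: "{T (int n) x | n::nat. 1 \<le> n} = (\<lambda>k. T k x) ` {k. 1 \<le> k}"
  proof safe
    fix n :: nat assume "1 \<le> n"
    then show "T (int n) x \<in> (\<lambda>k. T k x) ` {k. 1 \<le> k}" by auto
  next
    fix k :: int assume "1 \<le> k"
    then show "\<exists>n. T k x = T (int n) x \<and> 1 \<le> n" by (intro exI[of _ "nat k"]) auto
  qed
  have bwd: "{T (1 - int n) x | n::nat. 1 \<le> n} = (\<lambda>k. T k x) ` {k. k \<le> 0}"
  proof safe
    fix n :: nat assume "1 \<le> n"
    then show "T (1 - int n) x \<in> (\<lambda>k. T k x) ` {k. k \<le> 0}" by auto
  next
    fix k :: int assume "k \<le> 0"
    then show "\<exists>n. T k x = T (1 - int n) x \<and> 1 \<le> n" by (intro exI[of _ "nat (1 - k)"]) auto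
  qed
  have img: "\<gamma> ` (\<lambda>k. T k x) ` S = (\<lambda>k. T k x) ` S \<longleftrightarrow> pos \<gamma> x ` S = S" if "\<gamma> \<in> FG" for S
  proof -
    have "\<gamma> ` (\<lambda>k. T k x) ` S = (\<lambda>k. T k x) ` pos \<gamma> x ` S"
      by (auto simp: image_image pos[OF that])
    moreover have "inj (\<lambda>k. T k x)" using T_inj by (auto simp: inj_def)
    ultimately show ?thesis by (simp add: inj_image_eq_iff)
  qed
  have "pos \<gamma> x ` {k. 1 \<le> k} = {k. 1 \<le> k} \<and> pos \<gamma> x ` {k. k \<le> 0} = {k. k \<le> 0} \<longleftrightarrow> cut \<gamma> x" if \<gamma>: "\<gamma> \<in> FG"
  proof
    assume a: "pos \<gamma> x ` {k. 1 \<le> k} = {k. 1 \<le> k} \<and> pos \<gamma> x ` {k. k \<le> 0} = {k. k \<le> 0}"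
    have "1 \<le> pos \<gamma> x k" if "1 \<le> k" for k using a that by blast
    moreover have "pos \<gamma> x k \<le> 0" if "k \<le> 0" for k using a that by blast
    ultimately show "cut \<gamma> x" unfolding cut_def by (meson int_one_le_iff_zero_less linorder_not_le)
  next
    assume a: "cut \<gamma> x"
    have "\<exists>k. j = pos \<gamma> x k" for j using pos_bij[OF \<gamma>, of x] by (metis bij_pointE)
    moreover have "pos \<gamma> x k \<le> 0 \<longleftrightarrow> k \<le> 0" "1 \<le> pos \<gamma> x k \<longleftrightarrow> 1 \<le> k" for k
      using a unfolding cut_def by (auto simp: not_le[symmetric] int_one_le_iff_zero_less)
    ultimately show "pos \<gamma> x ` {k. 1 \<le> k} = {k. 1 \<le> k} \<and> pos \<gamma> x ` {k. k \<le> 0} = {k. k \<le> 0}"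
      by (auto simp: image_iff) metis+
  qed
  then have "\<gamma> \<in> FG \<and> \<gamma> ` (\<lambda>k. T k x) ` {k. 1 \<le> k} = (\<lambda>k. T k x) ` {k. 1 \<le> k}
      \<and> \<gamma> ` (\<lambda>k. T k x) ` {k. k \<le> 0} = (\<lambda>k. T k x) ` {k. k \<le> 0} \<longleftrightarrow> \<gamma> \<in> FG \<and> cut \<gamma> x"
    by (cases "\<gamma> \<in> FG") (simp_all only: img simp_thms)
  then show ?thesis
    unfolding full_group_at_def Let_def fwd bwd mem_Collect_eq .
qed

lemma cut_comp:
  assumes "\<gamma> \<in> FG" "\<delta> \<in> FG" "cut \<gamma> z" "cut \<delta> z" shows "cut (\<gamma> \<circ> \<delta>) z"
  using assms(3,4) by (simp add: cut_def pos_comp[OF assms(1,2)])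

lemma cut_inv:
  assumes "\<gamma> \<in> FG" "cut \<gamma> z" shows "cut (inv_into UNIV \<gamma>) z"
  unfolding cut_def
proof
  fix j
  obtain k where "j = pos \<gamma> z k" using pos_bij[OF assms(1), of z] by (metis bij_pointE)
  then show "1 \<le> j \<longleftrightarrow> 1 \<le> pos (inv_into UNIV \<gamma>) z j"
    using pos_inv[OF assms(1), of z k] assms(2) by (simp add: cut_def)
qed

text \<open>The bound on displacements settles the condition far from the cut, so only finitely many
  \<open>k\<close> count. Hence an element that respects the cut at \<open>x\<close> also respects
  the cuts at all nearby points.\<close>

lemma loc_const_cut:
  assumes "\<gamma> \<in> FG" shows "loc_const (\<lambda>z. cut \<gamma> z)"
proof -
  obtain N where N: "N > 0" "\<And>z k. \<bar>pos \<gamma> z k - k\<bar> \<le> N" using pos_bound[OF assms] by blast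
  have "cut \<gamma> z \<longleftrightarrow> (\<forall>k\<in>{-N..N+1}. 1 \<le> k \<longleftrightarrow> 1 \<le> pos \<gamma> z k)" for z
  proof -
    have "1 \<le> k \<longleftrightarrow> 1 \<le> pos \<gamma> z k" if "k \<notin> {-N..N+1}" for k
      using that N(2)[of z k] N(1) by auto
    then show ?thesis unfolding cut_def by blast
  qed
  moreover have "loc_const (\<lambda>z. \<forall>k\<in>{-N..N+1}. 1 \<le> k \<longleftrightarrow> 1 \<le> pos \<gamma> z k)"
    by (intro loc_const_ball loc_const_eq loc_const_le loc_const_pos assms loc_const_const) auto
  ultimately show ?thesis by simp
qed

text \<open>By minimality the cuts that \<gamma> respects recur with bounded gaps along every orbit,
  and \<gamma> keeps the finite stretch between two of them inside itself. A repetition among the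
  iterates is then forced within a uniform time.\<close>

lemma cut_periodic:
  assumes \<gamma>: "\<gamma> \<in> FG" and x: "cut \<gamma> x"
  obtains R where "\<And>z. \<exists>n. 0 < n \<and> n \<le> R \<and> (\<gamma> ^^ n) z = z"
proof -
  obtain R where R: "R > 0" "\<And>z. \<exists>k. \<bar>k\<bar> \<le> R \<and> T k z \<in> {z. cut \<gamma> z}"
    using bounded_hitting[of "{z. cut \<gamma> z}" x] loc_const_cut[OF \<gamma>] x by auto
  have "\<exists>n. 0 < n \<and> n \<le> nat (4 * R + 2) \<and> (\<gamma> ^^ n) z = z" for z
  proof -
    \<comment> \<open>The search starts \<open>R + 1\<close> steps ahead of \<open>z\<close>, and as
      far behind it, so that the cuts found lie strictly on either side of \<open>z\<close> at
      distance at most \<open>2 * R + 1\<close>.\<close>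
    obtain k where k: "\<bar>k\<bar> \<le> R" "cut \<gamma> (T k (T (R + 1) z))" using R(2)[of "T (R + 1) z"] by auto
    obtain l where l: "\<bar>l\<bar> \<le> R" "cut \<gamma> (T l (T (- R - 1) z))" using R(2)[of "T (- R - 1) z"] by auto
    define b where "b = k + (R + 1)"
    define a where "a = l + (- R - 1)"
    have cb: "cut \<gamma> (T b z)" and ca: "cut \<gamma> (T a z)" using k l by (simp_all add: a_def b_def T_add)
    have ab: "a < 0" "0 < b" "b - a \<le> 4 * R + 2" using k l by (auto simp: a_def b_def)
    have stay: "pos \<gamma> z j \<in> {a<..b}" if "j \<in> {a<..b}" for j
      using cb[unfolded cut_def pos_shift, rule_format, of "j - b"] ca[unfolded cut_def pos_shift, rule_format, of "j - a"] that by auto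
    have orb: "(\<gamma> ^^ i) z \<in> (\<lambda>j. T j z) ` {a<..b}" for i
    proof (induction i)
      case 0
      have "z = T 0 z" by simp
      then show ?case using ab by (intro image_eqI[of _ _ 0]) auto
    next
      case (Suc i)
      then obtain j where "j \<in> {a<..b}" "(\<gamma> ^^ i) z = T j z" by blast
      then show ?case using stay[of j] pos[OF \<gamma>, of j z] by auto
    qed
    let ?L = "nat (4 * R + 2)"
    have "card ((\<lambda>i. (\<gamma> ^^ i) z) ` {0..?L}) \<le> card ((\<lambda>j. T j z) ` {a<..b})"
      using orb by (intro card_mono) auto
    also have "\<dots> \<le> nat (b - a)" using card_image_le[of "{a<..b}" "\<lambda>j. T j z"] by simp
    also have "\<dots> < card {0..?L}" using ab by simp
    finally have "\<not> inj_on (\<lambda>i. (\<gamma> ^^ i) z) {0..?L}" by (rule pigeonhole)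
    then obtain i j where ij: "i < j" "j \<le> ?L" "(\<gamma> ^^ i) z = (\<gamma> ^^ j) z"
      unfolding inj_on_def by (metis atLeastAtMost_iff linorder_neqE_nat)
    have "(\<gamma> ^^ i) z = (\<gamma> ^^ i) ((\<gamma> ^^ (j - i)) z)"
      using ij by (simp add: funpow_add[symmetric, unfolded fun_eq_iff comp_def])
    then have "(\<gamma> ^^ (j - i)) z = z" using FG_eq_iff[OF FG_funpow[OF \<gamma>]] by metis
    then show ?thesis using ij by (intro exI[of _ "j - i"]) auto
  qed
  then show thesis using that by blast
qed

text \<open>The base of each tower is formed by the points that come first, in the order of the
  \<open>\<phi>\<close>-orbit, among the points of their \<open>\<gamma>\<close>-orbit.\<close>

lemma tower_bases_exist:
  assumes \<gamma>: "\<gamma> \<in> FG" and per: "\<And>z. \<exists>n. 0 < n \<and> n \<le> R \<and> (\<gamma> ^^ n) z = z"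
  shows "\<exists>V. tower_bases \<gamma> V"
proof -
  let ?rt = "return_time \<gamma>"
  note g = FG_funpow[OF \<gamma>]
  have rt: "0 < ?rt z" "?rt z \<le> R" "(\<gamma> ^^ ?rt z) z = z" "\<And>m. 0 < m \<Longrightarrow> (\<gamma> ^^ m) z = z \<Longrightarrow> ?rt z \<le> m" for z
  proof -
    obtain n where n: "0 < n \<and> n \<le> R \<and> (\<gamma> ^^ n) z = z" using per by blast
    then show "0 < ?rt z" "(\<gamma> ^^ ?rt z) z = z"
      unfolding return_time_def using LeastI[of "\<lambda>n. 0 < n \<and> (\<gamma> ^^ n) z = z" n] by auto
    show le: "?rt z \<le> m" if "0 < m" "(\<gamma> ^^ m) z = z" for m
      unfolding return_time_def using Least_le[of "\<lambda>n. 0 < n \<and> (\<gamma> ^^ n) z = z" m] that by linarith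
    show "?rt z \<le> R" using le[of n] n by simp
  qed
  have fix_iff: "(\<gamma> ^^ n) z = z \<longleftrightarrow> c (\<gamma> ^^ n) z = 0" for n z
  proof -
    have gn: "\<gamma> ^^ n \<in> FG" by (rule g)
    show ?thesis using cocycle_eq[OF gn, of z 0] FG_cocycle(2)[OF gn, of z] by auto
  qed
  \<comment> \<open>As the minimum of a finite set described by locally constant conditions, the
    return time is locally constant.\<close>
  have rt_Min: "?rt z = Min {n\<in>{1..R}. c (\<gamma> ^^ n) z = 0}" for z
    using rt(1-3)[of z] rt(4)[of _ z] by (intro Min_eqI[symmetric]) (auto simp: fix_iff)
  have lc_rt: "loc_const ?rt"
    unfolding rt_Min[abs_def]
    by (intro loc_const_comp[of _ Min] loc_const_Collect loc_const_eq FG_cocycle g loc_const_const) auto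
  define V where "V = (\<lambda>n. {z. ?rt z = n \<and> (\<forall>i\<in>{1..<n}. 0 < c (\<gamma> ^^ i) z)})"
  have Vcl: "clopen (V n)" for n
    unfolding V_def mem_Collect_eq
    by (intro loc_const_conj loc_const_ball loc_const_eq loc_const_less lc_rt FG_cocycle g loc_const_const) auto
  have add: "(\<gamma> ^^ (i + j)) z = (\<gamma> ^^ i) ((\<gamma> ^^ j) z)" for i j z by (simp add: funpow_add)
  have rt_orb: "?rt ((\<gamma> ^^ i) z) = ?rt z" for i z
  proof (rule antisym)
    have "(\<gamma> ^^ m) ((\<gamma> ^^ i) z) = (\<gamma> ^^ i) z \<longleftrightarrow> (\<gamma> ^^ m) z = z" for m
      using FG_eq_iff[OF g] add by (metis add.commute)
    then show "?rt ((\<gamma> ^^ i) z) \<le> ?rt z" "?rt z \<le> ?rt ((\<gamma> ^^ i) z)"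
      using rt by metis+
  qed
  have cadd: "c (\<gamma> ^^ (i + j)) z = c (\<gamma> ^^ i) ((\<gamma> ^^ j) z) + c (\<gamma> ^^ j) z" for i j z
  proof -
    have gi: "\<gamma> ^^ i \<in> FG" and gj: "\<gamma> ^^ j \<in> FG" by (rule g)+
    show ?thesis using cocycle_comp[OF gi gj, of z] by (simp add: funpow_add)
  qed
  have cper: "c (\<gamma> ^^ (m + ?rt z)) z = c (\<gamma> ^^ m) z" for m z
    using cadd[of m "?rt z" z] rt(3)[of z] fix_iff[of "?rt z" z] by simp
  have "tower_bases \<gamma> V"
    unfolding tower_bases_def
  proof (intro allI conjI)
    fix n
    show "open (V n)" "closed (V n)" using Vcl unfolding clopen_iff by auto
    show "V n \<subseteq> ?rt -` {n}" by (auto simp: V_def)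
    show "?rt -` {n} = (\<Union>i<n. (\<gamma> ^^ i) ` V n)"
    proof safe
      fix z assume n: "n = ?rt z"
      let ?f = "\<lambda>i. c (\<gamma> ^^ i) z"
      have fin: "finite {..<n}" "{..<n} \<noteq> {}" using rt(1)[of z] n by auto
      \<comment> \<open>The values \<open>?f i\<close> locate the points of the cycle on the
        \<phi>-orbit relative to \<open>z\<close>; the smallest one belongs to the base point
        \<open>w\<close>.\<close>
      define j where "j = arg_min_on ?f {..<n}"
      have j: "j < n" using arg_min_if_finite(1)[OF fin, of ?f] by (simp add: j_def)
      have jmin: "?f j \<le> ?f i" if "i < n" for i
        using arg_min_least[OF fin(1,2), of i ?f] that by (simp add: j_def)
      define w where "w = (\<gamma> ^^ j) z"
      have "0 < c (\<gamma> ^^ i) w" if i: "i \<in> {1..<n}" for i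
      proof -
        \<comment> \<open>Exponents that run past the end of the cycle are reduced by its length
          \<open>n\<close>.\<close>
        have "?f j \<le> ?f (i + j)"
        proof (cases "i + j < n")
          case False
          then have "?f (i + j) = ?f (i + j - n)" using cper[of "i + j - n" z] n by simp
          moreover have "i + j - n < n" using i[unfolded atLeastLessThan_iff] j by arith
          ultimately show ?thesis using jmin[of "i + j - n"] by simp
        qed (rule jmin)
        moreover have "c (\<gamma> ^^ i) w \<noteq> 0"
          using fix_iff[of i w] rt(4)[of i w] rt_orb[of j z] i n by (auto simp: w_def)
        ultimately show ?thesis using cadd[of i j z] by (simp add: w_def)
      qed
      then have wV: "w \<in> V n" using rt_orb[of j z] n by (simp add: V_def w_def)
      show "z \<in> (\<Union>i<?rt z. (\<gamma> ^^ i) ` V (?rt z))"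
      proof (cases "j = 0")
        case True
        then have "z = (\<gamma> ^^ 0) w" by (simp add: w_def)
        then show ?thesis using wV rt(1)[of z] n by blast
      next
        case False
        have "(\<gamma> ^^ (n - j)) w = (\<gamma> ^^ (n - j + j)) z" unfolding w_def by (rule add[symmetric])
        then have "z = (\<gamma> ^^ (n - j)) w" using j rt(3)[of z] n by simp
        moreover have "n - j < n" using False j by simp
        ultimately show ?thesis
          using wV unfolding n[symmetric] by (intro UN_I[of "n - j"] image_eqI[of _ _ w]) simp_all
      qed
    next
      fix v i assume "v \<in> V n"
      then show "(\<gamma> ^^ i) v \<in> ?rt -` {n}" using rt_orb by (simp add: V_def)
    qed
    show "disjoint_family_on (\<lambda>i. (\<gamma> ^^ i) ` V n) {..<n}"
    proof -
      \<comment> \<open>Two levels that meet make the base point \<open>v\<close> an iterate of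
        \<open>v'\<close>. The way around the cycle from \<open>v'\<close> to \<open>v\<close> and
        back would consist of two positive displacements with sum zero.\<close>
      have False if ij: "i < j" "j < n" and v: "v \<in> V n" "v' \<in> V n" and eq: "(\<gamma> ^^ i) v = (\<gamma> ^^ j) v'" for i j v v'
      proof -
        define d where "d = j - i"
        have d: "0 < d" "d < n" using ij by (auto simp: d_def)
        have "(\<gamma> ^^ i) v = (\<gamma> ^^ i) ((\<gamma> ^^ d) v')" using eq ij add[of i d v'] by (simp add: d_def)
        then have vd: "v = (\<gamma> ^^ d) v'" using FG_eq_iff[OF g] by blast
        have "c (\<gamma> ^^ (n - d + d)) v' = c (\<gamma> ^^ (n - d)) v + c (\<gamma> ^^ d) v'"
          unfolding vd by (rule cadd)
        moreover have "c (\<gamma> ^^ n) v' = 0" using v(2) rt(3)[of v'] fix_iff[of n v'] by (simp add: V_def)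
        moreover have "0 < c (\<gamma> ^^ (n - d)) v" "0 < c (\<gamma> ^^ d) v'"
          using v d by (auto simp: V_def)
        ultimately show False using d by simp
      qed
      then show ?thesis
        unfolding disjoint_family_on_def by (auto, metis linorder_neqE_nat)
    qed
  qed
  then show ?thesis by blast
qed

lemma K0_class_disjoint_sum:
  assumes "finite S" "\<And>n. n \<in> S \<Longrightarrow> clopen (V n)" "\<And>m n. m \<in> S \<Longrightarrow> n \<in> S \<Longrightarrow> m \<noteq> n \<Longrightarrow> V m \<inter> V n = {}"
  shows "finprod (K0 \<phi>) (\<lambda>n. K0_class \<phi> (indicator (V n))) S = K0_class \<phi> (indicator (\<Union>n\<in>S. V n))"
  using assms
proof (induction S rule: finite_induct)
  case empty
  interpret comm_group "K0 \<phi>" by (rule K0_comm_group)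
  have "indicator {} = (\<lambda>z::'a. 0::int)" by (rule ext) simp
  then show ?case using K0_class_cob[OF cob_0] by simp
next
  case (insert n S)
  interpret comm_group "K0 \<phi>" by (rule K0_comm_group)
  have U: "clopen (\<Union>n\<in>S. V n)" using loc_const_bex[of S "\<lambda>n x. x \<in> V n"] insert by simp
  have "finprod (K0 \<phi>) (\<lambda>n. K0_class \<phi> (indicator (V n))) (insert n S)
    = K0_class \<phi> (indicator (V n)) \<otimes>\<^bsub>K0 \<phi>\<^esub> finprod (K0 \<phi>) (\<lambda>n. K0_class \<phi> (indicator (V n))) S"
    using insert by (intro finprod_insert) (auto intro!: K0_class_carrier loc_const_indicator)
  also have "\<dots> = K0_class \<phi> (indicator (V n)) \<otimes>\<^bsub>K0 \<phi>\<^esub> K0_class \<phi> (indicator (\<Union>n\<in>S. V n))"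
    using insert by simp
  also have "\<dots> = K0_class \<phi> (\<lambda>x. indicator (V n) x + indicator (\<Union>n\<in>S. V n) x)"
    using insert(4) U by (intro K0_class_add[symmetric] loc_const_indicator) auto
  also have "(\<lambda>x. indicator (V n) x + indicator (\<Union>n\<in>S. V n) x) = (indicator (\<Union>n\<in>insert n S. V n) :: 'a \<Rightarrow> int)"
  proof
    fix x
    have "V n \<inter> (\<Union>n\<in>S. V n) = {}" using insert(5) insert(2) by blast
    then show "indicator (V n) x + indicator (\<Union>n\<in>S. V n) x = (indicator (\<Union>n\<in>insert n S. V n) x :: int)"
      by (auto simp: indicator_def)
  qed
  finally show ?case .
qed

text \<open>Of the selected \<open>V\<close> only \<open>tower_bases \<gamma> V\<close> enters, so
  the identification with \<open>sg\<close> also shows that the choice is immaterial.\<close>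

theorem sgn_at_eq:
  assumes "\<gamma> \<in> full_group_at \<phi> x"
  shows "\<gamma> \<in> carrier G" "sgn_at \<phi> \<gamma> = sg \<gamma>" "\<exists>E. clopen E \<and> q \<gamma> = t E"
proof -
  have \<gamma>: "\<gamma> \<in> FG" and cut: "cut \<gamma> x" using assms at_iff by auto
  obtain R where R: "\<And>z. \<exists>n. 0 < n \<and> n \<le> R \<and> (\<gamma> ^^ n) z = z"
    using cut_periodic[OF \<gamma> cut] by blast
  define V where "V = (SOME V. tower_bases \<gamma> V)"
  have V: "tower_bases \<gamma> V"
    unfolding V_def by (rule someI_ex[OF tower_bases_exist[OF \<gamma> R]])
  have Vcl: "clopen (V n)" and Vrt: "V n \<subseteq> return_time \<gamma> -` {n}" for n
    using V unfolding tower_bases_def clopen_iff by blast+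
  define E where "E = (\<Union>n\<in>{n\<in>{1..R}. even n}. V n)"
  have Ecl: "clopen E" unfolding E_def using loc_const_bex[of "{n\<in>{1..R}. even n}" "\<lambda>n x. x \<in> V n"] Vcl by simp
  show G: "\<gamma> \<in> carrier G" by (rule tower_product(1)[OF \<gamma> R V])
  have qE: "q \<gamma> = t E" unfolding E_def by (rule tower_product(2)[OF \<gamma> R V])
  then show "\<exists>E. clopen E \<and> q \<gamma> = t E" using Ecl by blast
  have rt: "return_time \<gamma> z \<in> {1..R}" for z
  proof -
    obtain n where n: "0 < n \<and> n \<le> R \<and> (\<gamma> ^^ n) z = z" using R by blast
    then show ?thesis
      unfolding return_time_def
      using LeastI[of "\<lambda>n. 0 < n \<and> (\<gamma> ^^ n) z = z" n] Least_le[of "\<lambda>n. 0 < n \<and> (\<gamma> ^^ n) z = z" n] by auto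
  qed
  let ?S = "{n. even n \<and> V n \<noteq> {}}"
  have sub: "?S \<subseteq> {1..R}" using Vrt rt by fastforce
  then have fin: "finite ?S" by (rule finite_subset) simp
  have dis: "V m \<inter> V n = {}" if "m \<noteq> n" for m n using Vrt[of m] Vrt[of n] that by blast
  have "E = (\<Union>n\<in>?S. V n)" unfolding E_def using sub by blast
  then have "finprod (K0 \<phi>) (\<lambda>n. K0_class \<phi> (indicator (V n))) ?S = K0_class \<phi> (indicator E)"
    using K0_class_disjoint_sum[OF fin Vcl dis] by simp
  then have "sgn_at \<phi> \<gamma> = Q (indicator E)"
    unfolding sgn_at_def Let_def V_def[symmetric] Q_def by simp
  then show "sgn_at \<phi> \<gamma> = sg \<gamma>" using sg_if_q_eq_t[OF G Ecl qE] by simp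
qed

subsection \<open>Decomposition of the elements of index zero\<close>

text \<open>Baire's theorem: an orbit is a countable union of singletons, which are closed with
  empty interior.\<close>

lemma other_orbit: "\<exists>y. y \<notin> int_orbit \<phi> x"
proof (rule ccontr)
  assume "\<nexists>y. y \<notin> int_orbit \<phi> x"
  then have all: "\<Union> (range (\<lambda>k. {T k x})) = UNIV" by (auto simp: int_orbit_def)
  have "euclidean interior_of \<Union> (range (\<lambda>k. {T k x})) = {}"
  proof (rule Baire_category_alt)
    have cpt: "compact_space (euclidean :: 'a topology)"
      using compact_UNIV by (simp add: compact_space_def)
    show "completely_metrizable_space (euclidean :: 'a topology) \<or>
        locally_compact_space (euclidean :: 'a topology) \<and> regular_space (euclidean :: 'a topology)"
      using compact_imp_locally_compact_space[OF cpt] compact_Hausdorff_imp_regular_space[OF cpt hausdorff] by blast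
    fix S assume "S \<in> range (\<lambda>k. {T k x})"
    then obtain k where S: "S = {T k x}" by blast
    have "\<not> open {T k x}"
      using islimpt_UNIV[of "T k x"] unfolding islimpt_def by blast
    then have "interior {T k x} = {}" using interior_subset[of "{T k x}"] open_interior[of "{T k x}"]
      by (metis subset_singletonD)
    then show "closedin euclidean S \<and> euclidean interior_of S = {}"
      using closed_finite[of S] S by (simp add: euclidean_interior_of)
  qed simp
  then show False unfolding all by simp
qed

text \<open>The swap exchanging \<open>k\<close> and \<open>b\<close> on the orbit of \<open>x\<close> acts elsewhere on the orbits of \<open>x\<close> and \<open>y\<close>
  too, but only so far from the cuts that no point crosses them.\<close>

lemma crossing_swap:
  assumes \<gamma>: "\<gamma> \<in> FG" and y: "y \<notin> int_orbit \<phi> x" and k: "k \<in> down \<gamma> x" and b: "b \<in> up \<gamma> x"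
  obtains s where "s \<in> FG" "cut s y" "down (\<gamma> \<circ> s) x = down \<gamma> x - {k}" "up (\<gamma> \<circ> s) x = up \<gamma> x - {b}"
proof -
  obtain N where N: "N > 0" "\<And>z k. \<bar>pos \<gamma> z k - k\<bar> \<le> N" using pos_bound[OF \<gamma>] by blast
  have kb: "1 \<le> k" "pos \<gamma> x k \<le> 0" "b \<le> 0" "1 \<le> pos \<gamma> x b"
    using k b unfolding down_def up_def by auto
  \<comment> \<open>Large enough that a point farther than \<open>M\<close> from \<open>k\<close> or
    from \<open>b\<close> cannot reach the cut, even by a jump of length \<open>k - b\<close>
    followed by a displacement under \<gamma>.\<close>
  define M where "M = N + k - b + 1"
  \<comment> \<open>The stretches of both orbits that the neighbourhood \<open>W\<close> of
    \<open>x\<close> has to avoid; within distance \<open>M\<close> its only visit is then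
    \<open>x\<close> itself.\<close>
  define F where "F = (\<lambda>m. T m x) ` ({-M..M} - {0}) \<union> (\<lambda>m. T m y) ` {-M..M}"
  have "x \<notin> F"
  proof
    assume "x \<in> F"
    then consider m where "m \<noteq> 0" "x = T m x" | m where "x = T m y" unfolding F_def by blast
    then show False
    proof cases
      case 1
      then show False using aperiodic by metis
    next
      case 2
      then have "y = T (- m) x" by simp
      then show False using y unfolding int_orbit_def by blast
    qed
  qed
  moreover have "finite F" by (simp add: F_def)
  ultimately obtain W1 where W1: "clopen W1" "x \<in> W1" "W1 \<inter> F = {}"
    using clopen_separate_finite by metis
  have "T (b - k) x \<noteq> x" using aperiodic[of "b - k" x] kb by auto
  then obtain W2 where W2: "clopen W2" "x \<in> W2" "W2 \<inter> T (b - k) ` W2 = {}"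
    using small_nbhd[OF FG_T] by metis
  define W where "W = W1 \<inter> W2"
  have W: "clopen W" "x \<in> W" using W1 W2 by (auto simp: W_def intro: loc_const_conj)
  have dis: "W \<inter> T (b - k) ` W = {}" using W2(3) unfolding W_def by blast
  have Wx: "m = 0 \<or> \<bar>m\<bar> > M" if "T m x \<in> W" for m
    using that W1(3) unfolding W_def F_def by force
  have Wy: "\<bar>m\<bar> > M" if "T m y \<in> W" for m
    using that W1(3) unfolding W_def F_def by force
  \<comment> \<open>Carried along by \<open>T k\<close>, the neighbourhood surrounds
    \<open>T k x\<close>, so the swap by \<open>T (b - k)\<close> exchanges \<open>T k x\<close>
    with \<open>T b x\<close>.\<close>
  let ?U = "T k ` W"
  have im: "T (b - k) ` ?U = T b ` W" by (simp add: image_image flip: T_add)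
  have disU: "?U \<inter> T (b - k) ` ?U = {}"
  proof -
    have False if "T k w = T b w'" "w \<in> W" "w' \<in> W" for w w'
    proof -
      have "w = T (b - k) w'"
        using T_eqD[OF that(1)] by (simp flip: T_add)
      then show False using dis that by blast
    qed
    then show ?thesis unfolding im by blast
  qed
  define s where "s = iota ?U (T (b - k))"
  have s: "s \<in> FG" unfolding s_def by (intro iota_FG FG_T clopen_T_image W disU)
  have inU: "T j z \<in> ?U \<longleftrightarrow> T (j - k) z \<in> W" and inU': "T j z \<in> T b ` W \<longleftrightarrow> T (j - b) z \<in> W" for j z
    by (simp_all add: T_image_iff flip: T_add)
  have pos_s: "pos s z j = (if T (j - k) z \<in> W then j + b - k else if T (j - b) z \<in> W then j + k - b else j)" for z j
  proof (rule pos_eqI[OF s])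
    consider "T (j - k) z \<in> W" | "T (j - k) z \<notin> W" "T (j - b) z \<in> W" | "T (j - k) z \<notin> W" "T (j - b) z \<notin> W" by blast
    then show "s (T j z) = T (if T (j - k) z \<in> W then j + b - k else if T (j - b) z \<in> W then j + k - b else j) z"
    proof cases
      case 1
      then show ?thesis unfolding s_def by (simp add: iota_in inU add.commute[of "b - k"] flip: T_add) (simp add: algebra_simps)
    next
      case 2
      then have "T (j + k - b) z \<in> ?U" by (simp add: inU)
      then have "s (T (b - k) (T (j + k - b) z)) = T (j + k - b) z"
        unfolding s_def by (intro iota_im FG_T disU)
      then show ?thesis using 2 by (simp flip: T_add)
    next
      case 3
      then show ?thesis unfolding s_def by (simp add: iota_out inU inU' im)
    qed
  qed
  have "cut s y"
    unfolding cut_def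
  proof
    fix j
    show "1 \<le> j \<longleftrightarrow> 1 \<le> pos s y j"
      using Wy[of "j - k"] Wy[of "j - b"] kb N(1) by (auto simp: pos_s M_def)
  qed
  have ps: "pos (\<gamma> \<circ> s) x j = pos \<gamma> x (pos s x j)" for j by (rule pos_comp[OF \<gamma> s])
  have sk: "pos s x k = b" using W(2) by (simp add: pos_s)
  have sb: "pos s x b = k"
  proof -
    have "T (b - k) x \<notin> W" using Wx[of "b - k"] kb N(1) by (auto simp: M_def)
    then show ?thesis using W(2) by (simp add: pos_s)
  qed
  \<comment> \<open>Every other point moved by \<open>s\<close> is so far out that it stays on its
    side of the cut both under \<gamma> and under \<open>\<gamma> \<circ> s\<close>.\<close>
  have other: "pos s x j = j \<or> (1 \<le> j \<and> 1 \<le> pos \<gamma> x j \<and> 1 \<le> pos (\<gamma> \<circ> s) x j)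
      \<or> (j \<le> 0 \<and> pos \<gamma> x j \<le> 0 \<and> pos (\<gamma> \<circ> s) x j \<le> 0)" if "j \<noteq> k" "j \<noteq> b" for j
  proof (cases "T (j - k) x \<in> W")
    case True
    then have "\<bar>j - k\<bar> > M" using Wx[of "j - k"] that by auto
    then show ?thesis
      using True N(2)[of x j] N(2)[of x "j + b - k"] kb N(1) by (auto simp: ps pos_s M_def)
  next
    case F: False
    show ?thesis
    proof (cases "T (j - b) x \<in> W")
      case True
      then have "\<bar>j - b\<bar> > M" using Wx[of "j - b"] that by auto
      then show ?thesis
        using True F N(2)[of x j] N(2)[of x "j + k - b"] kb N(1) by (auto simp: ps pos_s M_def)
    next
      case False
      then show ?thesis using F by (simp add: pos_s)
    qed
  qed
  have "j \<in> down (\<gamma> \<circ> s) x \<longleftrightarrow> j \<in> down \<gamma> x - {k}" "j \<in> up (\<gamma> \<circ> s) x \<longleftrightarrow> j \<in> up \<gamma> x - {b}" for j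
  proof -
    consider "j = k" | "j = b" | "j \<noteq> k" "j \<noteq> b" by blast
    then have "(j \<in> down (\<gamma> \<circ> s) x \<longleftrightarrow> j \<in> down \<gamma> x - {k}) \<and> (j \<in> up (\<gamma> \<circ> s) x \<longleftrightarrow> j \<in> up \<gamma> x - {b})"
    proof cases
      case 1
      then have "pos (\<gamma> \<circ> s) x j = pos \<gamma> x b" using ps[of j] sk by simp
      then show ?thesis using 1 kb unfolding down_def up_def by auto
    next
      case 2
      then have "pos (\<gamma> \<circ> s) x j = pos \<gamma> x k" using ps[of j] sb by simp
      then show ?thesis using 2 kb unfolding down_def up_def by auto
    next
      case 3
      then show ?thesis using other[OF 3] ps[of j] unfolding down_def up_def by auto
    qed
    then show "j \<in> down (\<gamma> \<circ> s) x \<longleftrightarrow> j \<in> down \<gamma> x - {k}" "j \<in> up (\<gamma> \<circ> s) x \<longleftrightarrow> j \<in> up \<gamma> x - {b}"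
      by blast+
  qed
  then show thesis using that[OF s \<open>cut s y\<close>] by blast
qed

text \<open>Each swap removes one crossing in each direction, so equal numbers of them run out
  together. The swaps are collected in \<delta>, whose inverse becomes the second factor of the
  decomposition.\<close>

lemma remove_crossings:
  assumes "\<gamma> \<in> FG" "y \<notin> int_orbit \<phi> x" "card (down \<gamma> x) = n" "card (up \<gamma> x) = n"
  shows "\<exists>\<delta> \<in> FG. cut \<delta> y \<and> cut (\<gamma> \<circ> \<delta>) x"
  using assms
proof (induction n arbitrary: \<gamma>)
  case 0
  then have "cut \<gamma> x" using finite_down_up[OF 0(1)] by (simp add: cut_iff)
  moreover have "cut id y" by (simp add: cut_def pos_def cocycle_id)
  ultimately have "cut id y \<and> cut (\<gamma> \<circ> id) x" by (simp only: comp_id)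
  then show ?case using FG_id by blast
next
  case (Suc n)
  obtain k b where kb: "k \<in> down \<gamma> x" "b \<in> up \<gamma> x"
    using Suc.prems by (metis card.empty all_not_in_conv nat.distinct(1))
  obtain s where s: "s \<in> FG" "cut s y" "down (\<gamma> \<circ> s) x = down \<gamma> x - {k}" "up (\<gamma> \<circ> s) x = up \<gamma> x - {b}"
    using crossing_swap[OF Suc.prems(1,2) kb] by blast
  have "card (down (\<gamma> \<circ> s) x) = n" "card (up (\<gamma> \<circ> s) x) = n"
    using Suc.prems kb unfolding s(3,4) by simp_all
  then obtain \<delta> where \<delta>: "\<delta> \<in> FG" "cut \<delta> y" "cut ((\<gamma> \<circ> s) \<circ> \<delta>) x"
    using Suc.IH[OF FG_comp[OF Suc.prems(1) s(1)] Suc.prems(2)] by blast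
  then show ?case
    using FG_comp[OF s(1) \<delta>(1)] cut_comp[OF s(1) \<delta>(1) s(2) \<delta>(2)] unfolding comp_assoc by blast
qed

theorem decomposition:
  assumes "\<gamma> \<in> carrier G" obtains p where "sgn_decomposition \<phi> \<gamma> p"
proof -
  have \<gamma>: "\<gamma> \<in> FG" using assms by (rule G_FG)
  define x :: 'a where "x = undefined"
  obtain y where y: "y \<notin> int_orbit \<phi> x" using other_orbit by blast
  have "y \<in> int_orbit \<phi> y" unfolding int_orbit_def by (rule range_eqI[of _ _ 0]) simp
  then have orb: "int_orbit \<phi> x \<noteq> int_orbit \<phi> y" using y by auto
  have "card (down \<gamma> x) = card (up \<gamma> x)"
    using index_eq_count[OF \<gamma>, of x] assms by (simp add: G_carrier)
  then obtain \<delta> where \<delta>: "\<delta> \<in> FG" "cut \<delta> y" "cut (\<gamma> \<circ> \<delta>) x"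
    using remove_crossings[OF \<gamma> y] by metis
  have "\<gamma> = (\<gamma> \<circ> \<delta>) \<circ> inv_into UNIV \<delta>" using \<delta>(1) by (auto simp: fun_eq_iff)
  then have "sgn_decomposition \<phi> \<gamma> (\<gamma> \<circ> \<delta>, inv_into UNIV \<delta>)"
    unfolding sgn_decomposition_def prod.case
    using orb \<delta> FG_comp[OF \<gamma> \<delta>(1)] FG_inv[OF \<delta>(1)] cut_inv[OF \<delta>(1,2)] at_iff by blast
  then show thesis by (rule that)
qed

section \<open>The signature, its kernel and its image\<close>

lemma signature_eq:
  assumes "\<gamma> \<in> carrier G"
  shows "signature \<phi> \<gamma> = sg \<gamma>" "\<exists>E. clopen E \<and> q \<gamma> = t E"
proof -
  define p where "p = (SOME p. sgn_decomposition \<phi> \<gamma> p)"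
  obtain \<gamma>1 \<gamma>2 where p: "p = (\<gamma>1, \<gamma>2)" by (cases p)
  have "\<exists>p. sgn_decomposition \<phi> \<gamma> p" using decomposition[OF assms] by blast
  then have "sgn_decomposition \<phi> \<gamma> p" unfolding p_def by (rule someI_ex)
  \<comment> \<open>Nothing more is retained of the chosen pair. As \<open>sg\<close> is
    multiplicative on the whole group, every decomposition leads to the same value.\<close>
  then obtain x y where xy: "\<gamma>1 \<in> full_group_at \<phi> x" "\<gamma>2 \<in> full_group_at \<phi> y" "\<gamma> = \<gamma>1 \<circ> \<gamma>2"
    unfolding sgn_decomposition_def p by auto
  note e1 = sgn_at_eq[OF xy(1)] and e2 = sgn_at_eq[OF xy(2)]
  show "signature \<phi> \<gamma> = sg \<gamma>"
    unfolding signature_def p_def[symmetric] p using e1 e2 sg_comp[OF e1(1)[THEN G_FG] e2(1)[THEN G_FG]] xy(3) by simp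
  obtain E F where "clopen E" "q \<gamma>1 = t E" "clopen F" "q \<gamma>2 = t F" using e1(3) e2(3) by blast
  then show "\<exists>E. clopen E \<and> q \<gamma> = t E"
    using q_comp[OF e1(1) e2(1)] t_sym_diff[of E F] clopen_Un[OF clopen_Diff[of E F] clopen_Diff[of F E]] xy(3)
    by (intro exI[of _ "(E - F) \<union> (F - E)"]) simp
qed

text \<open>Modulo 2 a coboundary is the indicator of \<open>U \<triangle> \<phi>(U)\<close>, whose image is \<open>t U + t U = 0\<close>.\<close>

lemma t_triv:
  assumes E: "clopen E" and "triv (indicator E)" shows "t E = \<one>\<^bsub>A\<^esub>"
proof -
  obtain h where h: "loc_const h" "cob (\<lambda>x. indicator E x - 2 * h x)" using assms unfolding triv_def by blast
  obtain g where g: "loc_const g" "\<And>x. indicator E x - 2 * h x = g x - g (inv_into UNIV \<phi> x)"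
    using cobD[OF h(2)] by (metis (no_types, lifting))
  define U where "U = {x. odd (g x)}"
  have U: "clopen U" unfolding U_def mem_Collect_eq by (rule loc_const_comp[OF g(1)])
  have "x \<in> E \<longleftrightarrow> x \<in> (U - \<phi> ` U) \<union> (\<phi> ` U - U)" for x
  proof -
    have im: "x \<in> \<phi> ` U \<longleftrightarrow> odd (g (inv_into UNIV \<phi> x))"
      unfolding U_def by (metis (mono_tags, lifting) image_iff mem_Collect_eq phi_inv)
    have "x \<in> E \<longleftrightarrow> odd (indicator E x - 2 * h x)" by (auto simp: indicator_def)
    also have "\<dots> \<longleftrightarrow> odd (g x - g (inv_into UNIV \<phi> x))" by (simp only: g(2))
    finally show ?thesis using im by (auto simp: U_def)
  qed
  then have "E = (U - \<phi> ` U) \<union> (\<phi> ` U - U)" by blast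
  then have "t E = t U \<otimes>\<^bsub>A\<^esub> t (\<phi> ` U)"
    using t_sym_diff[OF U clopen_FG_image[OF FG_phi U]] by simp
  then show ?thesis using t_image[OF FG_phi U] t_sq[OF U] by simp
qed

text \<open>The class of \<gamma> is some \<open>t E\<close>, so \<open>sg \<gamma>\<close> is the
  class of the indicator of \<open>E\<close>; if that is trivial, \<open>t_triv\<close> makes
  \<open>q \<gamma>\<close> trivial as well.\<close>

lemma kernel_sg: "kernel G K sg = D"
proof
  interpret G: group G by (rule group_G)
  show "D \<subseteq> kernel G K sg" by (rule derived_sub_kernel)
  show "kernel G K sg \<subseteq> D"
  proof
    fix \<gamma> assume "\<gamma> \<in> kernel G K sg"
    then have \<gamma>: "\<gamma> \<in> carrier G" "sg \<gamma> = \<one>\<^bsub>K\<^esub>" by (auto simp: kernel_def)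
    obtain E where E: "clopen E" "q \<gamma> = t E" using signature_eq(2)[OF \<gamma>(1)] by blast
    have "triv (indicator E)"
      using sg_if_q_eq_t[OF \<gamma>(1) E] \<gamma>(2) Q_one_iff[OF loc_const_indicator[OF E(1)]] by simp
    then have "q \<gamma> = \<one>\<^bsub>A\<^esub>" using t_triv[OF E(1)] E(2) by simp
    then have "D #>\<^bsub>G\<^esub> \<gamma> = D" by (simp add: q_def one_FactGroup)
    then show "\<gamma> \<in> D"
      using G.coset_join1[OF _ \<gamma>(1)] G.derived_is_subgroup[of "carrier G"] by simp
  qed
qed

text \<open>Modulo 2 a function equals the indicator of the set where it is odd, and
  \<open>tt\<close> realizes the class of every clopen set.\<close>

lemma sg_onto: "sg ` carrier G = carrier K"
proof
  show "sg ` carrier G \<subseteq> carrier K" using sg_carrier G_FG by blast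
  show "carrier K \<subseteq> sg ` carrier G"
  proof
    fix C assume "C \<in> carrier K"
    then obtain f where f: "loc_const f" "C = Q f" by (rule Q_surj)
    define U where "U = {x. odd (f x)}"
    have U: "clopen U" unfolding U_def mem_Collect_eq by (rule loc_const_comp[OF f(1)])
    have "Q f = Q (indicator U)"
      by (intro Q_eqI triv_even f loc_const_diff loc_const_indicator U) (auto simp: U_def indicator_def)
    then show "C \<in> sg ` carrier G" using f(2) sg_tt[OF U] tt_G[OF U] by (metis imageI)
  qed
qed

theorem kernel_and_iso:
  "kernel G K (signature \<phi>) = D \<and>
   (\<exists>\<Psi> \<in> iso A K. \<forall>\<gamma> \<in> carrier G. \<Psi> (D #>\<^bsub>G\<^esub> \<gamma>) = signature \<phi> \<gamma>)"
proof
  interpret S: group_hom G K sg by (rule sg_group_hom)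
  show "kernel G K (signature \<phi>) = D"
    using kernel_sg signature_eq(1) by (auto simp: kernel_def)
  have "(\<lambda>X. the_elem (sg ` X)) \<in> iso A K"
    using S.FactGroup_iso_set[OF sg_onto] by (simp only: kernel_sg)
  moreover have "the_elem (sg ` (D #>\<^bsub>G\<^esub> \<gamma>)) = signature \<phi> \<gamma>" if "\<gamma> \<in> carrier G" for \<gamma>
  proof -
    have eq: "sg \<delta> = sg \<gamma>" if \<delta>: "\<delta> \<in> D #>\<^bsub>G\<^esub> \<gamma>" for \<delta>
    proof -
      obtain d where d: "d \<in> D" "\<delta> = d \<otimes>\<^bsub>G\<^esub> \<gamma>" using \<delta> unfolding r_coset_def by blast
      then have "d \<in> carrier G" "sg d = \<one>\<^bsub>K\<^esub>" using derived_sub_kernel by (auto simp: kernel_def)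
      then show ?thesis using d(2) \<open>\<gamma> \<in> carrier G\<close> S.hom_mult by (simp del: G_simps)
    qed
    have mem: "\<gamma> \<in> D #>\<^bsub>G\<^esub> \<gamma>"
      using S.G.rcos_self[OF that S.G.derived_is_subgroup[of "carrier G"]] by simp
    have "sg ` (D #>\<^bsub>G\<^esub> \<gamma>) = {sg \<gamma>}"
    proof
      show "sg ` (D #>\<^bsub>G\<^esub> \<gamma>) \<subseteq> {sg \<gamma>}" using eq by blast
      show "{sg \<gamma>} \<subseteq> sg ` (D #>\<^bsub>G\<^esub> \<gamma>)" using mem by blast
    qed
    then show ?thesis using signature_eq(1)[OF that] by simp
  qed
  ultimately show "\<exists>\<Psi> \<in> iso A K. \<forall>\<gamma> \<in> carrier G. \<Psi> (D #>\<^bsub>G\<^esub> \<gamma>) = signature \<phi> \<gamma>"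
    by (intro bexI[of _ "\<lambda>X. the_elem (sg ` X)"] ballI)
qed

end

theorem theorem4p8:
  fixes \<phi> :: "'a::topological_space \<Rightarrow> 'a"
  assumes "cantor_minimal_system \<phi>"
  shows "kernel (full_group0 \<phi>) (K0_mod2 \<phi>) (signature \<phi>)
           = derived (full_group0 \<phi>) (carrier (full_group0 \<phi>))
       \<and> (\<exists>\<Psi> \<in> iso (full_group0 \<phi> Mod derived (full_group0 \<phi>) (carrier (full_group0 \<phi>)))
                    (K0_mod2 \<phi>).
            \<forall>\<gamma> \<in> carrier (full_group0 \<phi>).
              \<Psi> (derived (full_group0 \<phi>) (carrier (full_group0 \<phi>)) #>\<^bsub>full_group0 \<phi>\<^esub> \<gamma>)
                = signature \<phi> \<gamma>)"
proof -
  interpret cms \<phi> using assms by (rule cms.intro)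
  show ?thesis by (rule kernel_and_iso)
qed

end
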